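(* Let $p=(p_k)_{k\ge0}$ be a probability distribution on $\mathbb{N}_0$ with $p_0=0$, $p_1<1$, $m_{\mathtt{BGW}}=\sum_k kp_k<\infty$, let $\omega$ have law $\mathtt{BGW}$, and let $d_{\min}:=\min\{k:p_k>0\}$; assume $d_{\min}\ge2$. Let $\lambda>0$ and let $(X(u),u\in\mathbb{T})$ be the $\lambda$-biased branching random walk on $\omega$ with reproduction law $\mu$, where $\mu_0=0$, $\mu_1<1$, $m=\sum_k k\mu_k\in(1,\infty)$. Assume $\lambda<d_{\min}$ and $m\le\frac{d_{\min}+\lambda}{2\sqrt{\lambda d_{\min}}}$. Then for $\mathtt{BGW}$-a.e. $\omega$, $$\lim_{n\to\infty}\frac1n\min_{|u|=n}|X(u)|=\tilde v_{\lambda,m}\qquad\mathbf{P}_\omega\text{-a.s.},$$ where $\tilde v_{\lambda,m}:=\inf\{a\in[0,v_\lambda]: I_\lambda(a)\le\log m\}\in[0,v_\lambda)$ is a constant depending only on $\lambda$, $m$ and $p$.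
   Context: $\varrho$ is the root of $\omega$; $|x|$ is the distance of $x$ to $\varrho$, $x_-$ the parent and $\kappa_x$ the number of children of $x$. The $\lambda$-biased random walk $(S_n)$ on $\omega$, started at $\varrho$, jumps from $\varrho$ to each child with probability $1/\kappa_\varrho$, and from $x\ne\varrho$ to $x_-$ with probability $\lambda/(\lambda+\kappa_x)$ and to each child with probability $1/(\lambda+\kappa_x)$; quenched law $\mathrm{P}_\omega$, annealed law $\mathbb{P}=\int\mathrm{P}_\omega\,\mathtt{BGW}(d\omega)$. $v_\lambda$ is its deterministic a.s. speed $\lim|S_n|/n$. Here $I_\lambda:[0,v_\lambda]\to[0,\infty)$ is the slowdown large deviation rate function: the continuous, convex, decreasing function with $I_\lambda(v_\lambda)=0$ such that for $0\le b<a<v_\lambda$, $\lim_n\frac1n\log\mathrm{P}_\omega(|S_n|/n\in[b,a))=\lim_n\frac1n\log\mathbb{P}(|S_n|/n\in[b,a))=-I_\lambda(a)$ for $\mathtt{BGW}$-a.e. $\omega$. The $\lambda$-biased branching random walk: genealogy $\mathbb{T}$ is a Bienaymé–Galton–Watson tree with offspring law $\mu$ (root $\varnothing$, $|u|$ the generation), independent of $\omega$; $X(\varnothing)=\varrho$; given $\omega$, each child of a particle at $x$ is placed independently by one step of the $\lambda$-biased walk from $x$. $\mathbf{P}_\omega$ is the quenched law. *)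

theory Defs
  imports "HOL-Probability.Probability"
begin

text \<open>Trees: vertices are Ulam-Harris words (nat list), the root is the empty list,
  the parent of a vertex x is butlast x, the children of x are x @ [i] for i < kappa x.
  An environment omega :: nat list => nat assigns to every word its number of children;
  the vertex set of the tree is the set of words reachable from the root.
  BGW(p): the numbers of children are i.i.d. with law p.\<close>

definition bgw :: "nat pmf \<Rightarrow> (nat list \<Rightarrow> nat) measure" where
  "bgw p = PiM UNIV (\<lambda>_. measure_pmf p)"

definition tree_vertices :: "(nat list \<Rightarrow> nat) \<Rightarrow> nat list set" where
  "tree_vertices \<omega> = {x. \<forall>i < length x. x ! i < \<omega> (take i x)}"

definition step_pmf :: "real \<Rightarrow> (nat list \<Rightarrow> nat) \<Rightarrow> nat list \<Rightarrow> nat list pmf" where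
  "step_pmf lam \<omega> x =
     (if x = [] then map_pmf (\<lambda>i. [i]) (pmf_of_set {..<\<omega> []})
      else bind_pmf (bernoulli_pmf (lam / (lam + real (\<omega> x))))
             (\<lambda>b. if b then return_pmf (butlast x)
                  else map_pmf (\<lambda>i. x @ [i]) (pmf_of_set {..<\<omega> x})))"

text \<open>Quenched law of the walk: J (n, x) is the position reached by the (n+1)-th step
  if the walker is at x at time n; all these are independent with law step_pmf.\<close>
definition walk_space :: "real \<Rightarrow> (nat list \<Rightarrow> nat) \<Rightarrow> (nat \<times> nat list \<Rightarrow> nat list) measure" where
  "walk_space lam \<omega> = PiM UNIV (\<lambda>(n, x). measure_pmf (step_pmf lam \<omega> x))"

primrec walk :: "(nat \<times> nat list \<Rightarrow> nat list) \<Rightarrow> nat \<Rightarrow> nat list" where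
  "walk J 0 = []"
| "walk J (Suc n) = J (n, walk J n)"

definition qprob :: "real \<Rightarrow> (nat list \<Rightarrow> nat) \<Rightarrow> nat \<Rightarrow> real \<Rightarrow> real \<Rightarrow> real" where
  "qprob lam \<omega> n b a = measure (walk_space lam \<omega>)
     {J \<in> space (walk_space lam \<omega>). real (length (walk J n)) / real n \<in> {b..<a}}"

definition aprob :: "nat pmf \<Rightarrow> real \<Rightarrow> nat \<Rightarrow> real \<Rightarrow> real \<Rightarrow> real" where
  "aprob p lam n b a = (\<integral>\<omega>. qprob lam \<omega> n b a \<partial>bgw p)"

definition is_speed :: "nat pmf \<Rightarrow> real \<Rightarrow> real \<Rightarrow> bool" where
  "is_speed p lam v \<longleftrightarrow>
     (AE \<omega> in bgw p. AE J in walk_space lam \<omega>.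
        (\<lambda>n. real (length (walk J n)) / real n) \<longlonglongrightarrow> v)"

definition is_slowdown_rate :: "nat pmf \<Rightarrow> real \<Rightarrow> real \<Rightarrow> (real \<Rightarrow> real) \<Rightarrow> bool" where
  "is_slowdown_rate p lam v I \<longleftrightarrow>
     (\<forall>a\<in>{0..v}. 0 \<le> I a) \<and>
     continuous_on {0..v} I \<and> convex_on {0..v} I \<and> antimono_on {0..v} I \<and> I v = 0 \<and>
     (\<forall>b a. 0 \<le> b \<and> b < a \<and> a < v \<longrightarrow>
        (AE \<omega> in bgw p. (\<lambda>n. ln (qprob lam \<omega> n b a) / real n) \<longlonglongrightarrow> - I a) \<and>
        (\<lambda>n. ln (aprob p lam n b a) / real n) \<longlonglongrightarrow> - I a)"

text \<open>Branching random walk. N u = number of children of particle u (i.i.d. with law mu);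
  J (u, x) = position of particle u if its parent sits at x (independent steps).
  The genealogy is the set of words u with u!i < N (take i u).\<close>
definition brw_space :: "nat pmf \<Rightarrow> real \<Rightarrow> (nat list \<Rightarrow> nat)
    \<Rightarrow> ((nat list \<Rightarrow> nat) \<times> (nat list \<times> nat list \<Rightarrow> nat list)) measure" where
  "brw_space \<mu> lam \<omega> =
     (PiM UNIV (\<lambda>_::nat list. measure_pmf \<mu>)) \<Otimes>\<^sub>M
     (PiM UNIV (\<lambda>(u::nat list, x::nat list). measure_pmf (step_pmf lam \<omega> x)))"

definition in_genealogy :: "(nat list \<Rightarrow> nat) \<Rightarrow> nat list \<Rightarrow> bool" where
  "in_genealogy N u \<longleftrightarrow> (\<forall>i < length u. u ! i < N (take i u))"

primrec brw_pos_aux :: "(nat list \<times> nat list \<Rightarrow> nat list) \<Rightarrow> nat list \<Rightarrow> nat \<Rightarrow> nat list" where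
  "brw_pos_aux J u 0 = []"
| "brw_pos_aux J u (Suc k) = J (take (Suc k) u, brw_pos_aux J u k)"

definition brw_pos :: "(nat list \<times> nat list \<Rightarrow> nat list) \<Rightarrow> nat list \<Rightarrow> nat list" where
  "brw_pos J u = brw_pos_aux J u (length u)"

definition min_disp :: "(nat list \<Rightarrow> nat) \<Rightarrow> (nat list \<times> nat list \<Rightarrow> nat list) \<Rightarrow> nat \<Rightarrow> nat" where
  "min_disp N J n = Min {length (brw_pos J u) | u. in_genealogy N u \<and> length u = n}"

end

theory Submission
  imports Defs
begin

text \<open>
  Let \<open>d\<close> be the minimal degree and \<open>\<rho> = 2 * sqrt (lam * d) / (lam + d)\<close>. The function
  \<open>sqrt (lam / d) ^ |x|\<close> is a \<open>\<rho>\<close>-supersolution for the walk in every environment, which gives the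
  positive speed and all return estimates. The lower bound on the minimum is the first moment
  \<open>m ^ n * P(|S n| < a * n)\<close>.

  For the upper bound let \<open>ln m > I a\<close>. Decomposing a path with \<open>|S n| < a * n\<close> at its last visit to the root
  and at its first visit to level \<open>l = a * n\<close>, and bounding the time spent outside by powers of \<open>\<rho>\<close>,
  shows that \<open>P(|S n| < a * n)\<close> is, up to polynomial factors, at most the sum over \<open>s\<close> of
  \<open>\<rho> ^ (n - s)\<close> times the probability that the walk killed above the root first hits level \<open>l\<close> at time \<open>s\<close>.
  A finite \<open>d\<close>-regular piece of the tree acts as a trap where a particle can wait at a rate arbitrarily close to
  \<open>\<rho>\<close>, so the missing time can be spent there: with probability close to one, the expected number of particles
  that arrive for the first time at level \<open>l\<close> after a time at least \<open>n\<close>, without leaving the subtree, is large.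
  The subtrees below that level are fresh. Since each vertex has two children with independent subtrees,
  the probability \<open>b\<close> that a subtree does not sustain a slow line with probability at least \<open>\<theta>\<close>
  satisfies \<open>b' \<le> \<eta> + 4 * b\<^sup>2\<close> from one horizon to the next, hence stays small. By convexity of the offspring
  generating function \<open>g\<close>, the quenched failure probability at the root is at most the mean of the \<open>k\<close>-th iterate of \<open>g\<close>
  applied to the failure probability at the first visit to level \<open>k\<close>, and these iterates tend to zero on \<open>[0, 1)\<close>.
\<close>

section \<open>Product measures with discrete factors\<close>

text \<open>All particles share one environment, so the subtrees they visit are not independent of
  each other and no Galton-Watson process embeds directly under the annealed law. For a fixed
  environment, however, the branching is independent, and every survival probability is a functional
  \<open>sv\<close> of \<open>\<omega>\<close> given by a nonlinear recursion; the randomness of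
  \<open>\<omega>\<close> enters only through integrals of such functionals. Independence then has
  to come from the tree. Killing makes a functional depend on one subtree alone, and first arrivals
  at a level leave everything beyond that level unexplored. The event of being below level
  \<open>a * n\<close> at time \<open>n\<close> offers neither: the walk may have been far deeper
  before, or may have lingered at the reflecting root. It is therefore traded for killed hitting
  times, and the waiting is moved into a trap at the start of the block. One child per block would
  bound the bad probability only by \<open>\<eta> + 2 * b\<close>, which does not close; two
  children replace this by a square. The recursion yields good subtrees with a possibly tiny
  survival probability \<open>\<theta>\<close>; raising it to almost one is left to the branching
  before level \<open>k\<close>.\<close>

definition ppm :: "('i \<Rightarrow> 'a pmf) \<Rightarrow> ('i \<Rightarrow> 'a) measure" where
  "ppm q = PiM UNIV (\<lambda>i. measure_pmf (q i))"

abbreviation coords :: "('i \<Rightarrow> 'a) measure" where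
  "coords \<equiv> PiM UNIV (\<lambda>_. count_space UNIV)"

definition mix :: "'i set \<Rightarrow> ('i \<Rightarrow> 'a) \<Rightarrow> ('i \<Rightarrow> 'a) \<Rightarrow> 'i \<Rightarrow> 'a" where
  "mix A \<omega> \<omega>' = (\<lambda>i. if i \<in> A then \<omega> i else \<omega>' i)"

lemma sets_ppm [measurable_cong, simp]: "sets (ppm q) = sets coords"
  unfolding ppm_def by (rule sets_PiM_cong) auto

lemma space_ppm [simp]: "space (ppm q) = UNIV"
  by (auto simp: ppm_def space_PiM)

lemma prob_space_ppm: "prob_space (ppm q)"
  unfolding ppm_def by (intro prob_space_PiM) (auto intro: prob_space_measure_pmf)

lemma measurable_coord [measurable]: "(\<lambda>\<omega>. \<omega> i) \<in> measurable coords (count_space UNIV)"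
  by (rule measurable_component_singleton) simp

lemma measurable_coordsI:
  "(\<And>i. (\<lambda>x. f x i) \<in> measurable M (count_space UNIV)) \<Longrightarrow> f \<in> measurable M coords"
  by (rule measurable_PiM_single') auto

lemma measurable_mix [measurable]: "(\<lambda>(\<omega>, \<omega>'). mix A \<omega> \<omega>') \<in> measurable (coords \<Otimes>\<^sub>M coords) coords"
  unfolding mix_def split_def by (intro measurable_coordsI) auto

lemma measurable_mix_right [measurable]: "mix A \<omega> \<in> measurable coords coords"
  unfolding mix_def by (intro measurable_coordsI) auto

text \<open>A cylinder set pulls back to a rectangle whose two sides constrain disjoint sets of
  coordinates, so gluing two independent samples along \<open>A\<close> keeps the product law. With
  Fubini this becomes \<open>integral_mix\<close>, which plays the part of conditioning on the
  coordinates in \<open>A\<close>.\<close>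

lemma distr_mix:
  fixes q :: "'i \<Rightarrow> 'a pmf"
  shows "distr (ppm q \<Otimes>\<^sub>M ppm q) (ppm q) (\<lambda>(\<omega>, \<omega>'). mix A \<omega> \<omega>') = ppm q"
proof -
  interpret P: prob_space "ppm q" by (rule prob_space_ppm)
  interpret PP: pair_prob_space "ppm q" "ppm q" by unfold_locales
  interpret Q: product_prob_space "\<lambda>i. measure_pmf (q i)" UNIV
    by unfold_locales
  let ?M = "\<lambda>i. measure_pmf (q i)"
  show ?thesis
  proof (subst (4) ppm_def, rule Q.PiM_eq)
    show "sets (distr (ppm q \<Otimes>\<^sub>M ppm q) (ppm q) (\<lambda>(\<omega>, \<omega>'). mix A \<omega> \<omega>')) = sets (Pi\<^sub>M UNIV ?M)"
      by (simp add: ppm_def)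
    fix J :: "'i set" and F :: "'i \<Rightarrow> 'a set" assume J: "finite J"
    let ?X = "prod_emb UNIV ?M J (\<Pi>\<^sub>E j\<in>J. F j)"
    have e: "emeasure (ppm q) (prod_emb UNIV ?M K (Pi\<^sub>E K F)) = (\<Prod>i\<in>K. emeasure (?M i) (F i))" if "finite K" for K
      unfolding ppm_def using that by (intro emeasure_PiM_emb) (auto intro: prob_space_measure_pmf)
    have s: "prod_emb UNIV ?M K (Pi\<^sub>E K F) \<in> sets (ppm q)" if "finite K" for K
      unfolding ppm_def using that by (intro sets_PiM_I) auto
    have "(\<lambda>(\<omega>, \<omega>'). mix A \<omega> \<omega>') -` ?X \<inter> space (ppm q \<Otimes>\<^sub>M ppm q)
      = prod_emb UNIV ?M (J \<inter> A) (Pi\<^sub>E (J \<inter> A) F) \<times> prod_emb UNIV ?M (J - A) (Pi\<^sub>E (J - A) F)"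
      by (auto simp: prod_emb_def mix_def space_pair_measure PiE_iff restrict_def extensional_def split: if_splits)
    then have "emeasure (distr (ppm q \<Otimes>\<^sub>M ppm q) (ppm q) (\<lambda>(\<omega>, \<omega>'). mix A \<omega> \<omega>')) ?X
      = emeasure (ppm q \<Otimes>\<^sub>M ppm q) (prod_emb UNIV ?M (J \<inter> A) (Pi\<^sub>E (J \<inter> A) F) \<times> prod_emb UNIV ?M (J - A) (Pi\<^sub>E (J - A) F))"
      using s[OF J] by (subst emeasure_distr) auto
    also have "\<dots> = (\<Prod>i\<in>J \<inter> A. emeasure (?M i) (F i)) * (\<Prod>i\<in>J - A. emeasure (?M i) (F i))"
      using s[of "J \<inter> A"] s[of "J - A"] J by (subst P.emeasure_pair_measure_Times) (auto simp: e)
    also have "\<dots> = (\<Prod>i\<in>J. emeasure (?M i) (F i))"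
      using J by (subst prod.union_disjoint[symmetric]) (auto intro!: prod.cong)
    finally show "emeasure (distr (ppm q \<Otimes>\<^sub>M ppm q) (ppm q) (\<lambda>(\<omega>, \<omega>'). mix A \<omega> \<omega>')) ?X
      = (\<Prod>i\<in>J. emeasure (?M i) (F i))" .
  qed
qed

lemma integrable_ppm:
  fixes f :: "_ \<Rightarrow> real"
  assumes "f \<in> borel_measurable coords" "\<And>\<omega>. \<bar>f \<omega>\<bar> \<le> B"
  shows "integrable (ppm q) f"
proof -
  interpret P: prob_space "ppm q" by (rule prob_space_ppm)
  show ?thesis using assms by (intro P.integrable_const_bound[of _ B]) auto
qed

lemma integral_ppm_bounds:
  fixes f :: "_ \<Rightarrow> real"
  assumes "f \<in> borel_measurable coords" "\<And>\<omega>. 0 \<le> f \<omega>" "\<And>\<omega>. f \<omega> \<le> B"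
  shows "0 \<le> (\<integral>\<omega>. f \<omega> \<partial>ppm q)" "(\<integral>\<omega>. f \<omega> \<partial>ppm q) \<le> B"
proof -
  interpret P: prob_space "ppm q" by (rule prob_space_ppm)
  show "0 \<le> (\<integral>\<omega>. f \<omega> \<partial>ppm q)" using assms by simp
  have "integrable (ppm q) f" using assms by (intro integrable_ppm[of _ B]) (auto simp: abs_le_iff intro: order_trans)
  then show "(\<integral>\<omega>. f \<omega> \<partial>ppm q) \<le> B" using assms by (intro P.integral_le_const) auto
qed

lemma integral_mix:
  fixes f :: "_ \<Rightarrow> real"
  assumes [measurable]: "f \<in> borel_measurable coords" and B: "\<And>\<omega>. \<bar>f \<omega>\<bar> \<le> B"
  shows "(\<integral>\<omega>. f \<omega> \<partial>ppm q) = (\<integral>\<omega>. (\<integral>\<omega>'. f (mix A \<omega> \<omega>') \<partial>ppm q) \<partial>ppm q)"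
proof -
  interpret P: prob_space "ppm q" by (rule prob_space_ppm)
  interpret PP: pair_prob_space "ppm q" "ppm q" by unfold_locales
  have "(\<integral>\<omega>. f \<omega> \<partial>ppm q) = (\<integral>\<omega>. f \<omega> \<partial>distr (ppm q \<Otimes>\<^sub>M ppm q) (ppm q) (\<lambda>(\<omega>, \<omega>'). mix A \<omega> \<omega>'))"
    by (simp add: distr_mix)
  also have "\<dots> = (\<integral>x. f (case x of (\<omega>, \<omega>') \<Rightarrow> mix A \<omega> \<omega>') \<partial>(ppm q \<Otimes>\<^sub>M ppm q))"
    by (subst integral_distr) auto
  also have "\<dots> = (\<integral>x. (case x of (\<omega>, \<omega>') \<Rightarrow> f (mix A \<omega> \<omega>')) \<partial>(ppm q \<Otimes>\<^sub>M ppm q))"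
    by (intro Bochner_Integration.integral_cong) auto
  also have "\<dots> = (\<integral>\<omega>. (\<integral>\<omega>'. f (mix A \<omega> \<omega>') \<partial>ppm q) \<partial>ppm q)"
  proof -
    have "integrable (ppm q \<Otimes>\<^sub>M ppm q) (\<lambda>x. case x of (\<omega>, \<omega>') \<Rightarrow> f (mix A \<omega> \<omega>'))"
      by (intro PP.integrable_const_bound[of _ B]) (auto simp: B)
    from PP.integral_fst'[OF this] show ?thesis by simp
  qed
  finally show ?thesis .
qed

section \<open>Independence of functions of disjoint sets of coordinates\<close>

definition depends_on :: "(('i \<Rightarrow> 'a) \<Rightarrow> 'b) \<Rightarrow> 'i set \<Rightarrow> bool" where
  "depends_on f A \<longleftrightarrow> (\<forall>\<omega> \<omega>'. (\<forall>i\<in>A. \<omega> i = \<omega>' i) \<longrightarrow> f \<omega> = f \<omega>')"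

lemma integral_mult_independent:
  fixes f g :: "_ \<Rightarrow> real"
  assumes [measurable]: "f \<in> borel_measurable coords" "g \<in> borel_measurable coords"
    and B: "\<And>\<omega>. \<bar>f \<omega>\<bar> \<le> B" "\<And>\<omega>. \<bar>g \<omega>\<bar> \<le> C"
    and A: "depends_on f A" "depends_on g A'" "A \<inter> A' = {}"
  shows "(\<integral>\<omega>. f \<omega> * g \<omega> \<partial>ppm q) = (\<integral>\<omega>. f \<omega> \<partial>ppm q) * (\<integral>\<omega>. g \<omega> \<partial>ppm q)"
proof -
  have f: "f (mix A \<omega> \<omega>') = f \<omega>" for \<omega> \<omega>'
    using A(1) by (auto simp: depends_on_def mix_def)
  have g: "g (mix A \<omega> \<omega>') = g \<omega>'" for \<omega> \<omega>'
  proof -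
    have "\<forall>i\<in>A'. mix A \<omega> \<omega>' i = \<omega>' i" using A(3) by (auto simp: mix_def)
    then show ?thesis using A(2) by (simp add: depends_on_def)
  qed
  have "\<bar>f \<omega> * g \<omega>\<bar> \<le> B * C" for \<omega>
    using B[of \<omega>] by (simp add: abs_mult mult_mono')
  then have "(\<integral>\<omega>. f \<omega> * g \<omega> \<partial>ppm q) = (\<integral>\<omega>. (\<integral>\<omega>'. f \<omega> * g \<omega>' \<partial>ppm q) \<partial>ppm q)"
    by (subst integral_mix[where A = A and B = "B * C"]) (auto simp: f g)
  then show ?thesis by simp
qed

lemma integral_prod_independent:
  fixes F :: "'k \<Rightarrow> _ \<Rightarrow> real"
  assumes K: "finite K" and m: "\<And>i. i \<in> K \<Longrightarrow> F i \<in> borel_measurable coords"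
    and B: "\<And>i \<omega>. i \<in> K \<Longrightarrow> \<bar>F i \<omega>\<bar> \<le> 1"
    and A: "\<And>i. i \<in> K \<Longrightarrow> depends_on (F i) (A i)" "disjoint_family_on A K"
  shows "(\<integral>\<omega>. (\<Prod>i\<in>K. F i \<omega>) \<partial>ppm q) = (\<Prod>i\<in>K. (\<integral>\<omega>. F i \<omega> \<partial>ppm q))"
  using K m B A
proof (induction K)
  case empty
  interpret P: prob_space "ppm q" by (rule prob_space_ppm)
  show ?case using P.prob_space by simp
next
  case (insert k K)
  have "(\<integral>\<omega>. F k \<omega> * (\<Prod>i\<in>K. F i \<omega>) \<partial>ppm q) = (\<integral>\<omega>. F k \<omega> \<partial>ppm q) * (\<integral>\<omega>. (\<Prod>i\<in>K. F i \<omega>) \<partial>ppm q)"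
  proof (rule integral_mult_independent)
    show "\<bar>\<Prod>i\<in>K. F i \<omega>\<bar> \<le> 1" for \<omega>
      using insert.prems(2) by (subst abs_prod) (auto intro!: prod_le_1)
    show "depends_on (\<lambda>\<omega>. \<Prod>i\<in>K. F i \<omega>) (\<Union>i\<in>K. A i)"
      using insert.prems(3) unfolding depends_on_def
      by (intro allI impI prod.cong refl) (meson UN_I insertCI)
    show "A k \<inter> (\<Union>i\<in>K. A i) = {}"
      using insert.prems(4) insert.hyps by (fastforce simp: disjoint_family_on_def)
  qed (use insert.prems in auto)
  also have "(\<integral>\<omega>. (\<Prod>i\<in>K. F i \<omega>) \<partial>ppm q) = (\<Prod>i\<in>K. (\<integral>\<omega>. F i \<omega> \<partial>ppm q))"
    using insert.prems by (intro insert.IH) (auto simp: disjoint_family_on_def)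
  finally show ?case using insert.hyps by simp
qed

section \<open>Reindexed families: environments and genealogies below a vertex\<close>

lemma measurable_reindex: "(\<lambda>\<omega> i. \<omega> (h i)) \<in> measurable coords coords"
  by (intro measurable_coordsI) auto

lemma distr_reindex:
  assumes "inj h"
  shows "distr (ppm q) coords (\<lambda>\<omega> i. \<omega> (h i)) = ppm (\<lambda>i. q (h i))"
proof -
  have "distr (Pi\<^sub>M UNIV (\<lambda>i. measure_pmf (q i))) (\<Pi>\<^sub>M i\<in>UNIV. measure_pmf (q (h i))) (\<lambda>\<omega>. \<lambda>n\<in>UNIV. \<omega> (h n))
     = (\<Pi>\<^sub>M i\<in>UNIV. measure_pmf (q (h i)))"
    using assms by (intro distr_PiM_reindex[where M = "\<lambda>i. measure_pmf (q i)"]) (auto intro: prob_space_measure_pmf)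
  moreover have "distr (ppm q) (ppm (\<lambda>i. q (h i))) (\<lambda>\<omega> i. \<omega> (h i)) = distr (ppm q) coords (\<lambda>\<omega> i. \<omega> (h i))"
    by (intro distr_cong) auto
  ultimately show ?thesis by (simp add: ppm_def restrict_UNIV)
qed

lemma integral_reindex:
  fixes f :: "_ \<Rightarrow> real"
  assumes "inj h" "f \<in> borel_measurable coords"
  shows "(\<integral>\<omega>. f (\<lambda>i. \<omega> (h i)) \<partial>ppm q) = (\<integral>\<omega>. f \<omega> \<partial>ppm (\<lambda>i. q (h i)))"
  unfolding distr_reindex[OF assms(1), symmetric] using assms(2) measurable_reindex[of h] by (subst integral_distr) (auto simp: measurable_cong_sets[OF sets_ppm refl])

lemma AE_reindex:
  assumes "inj h" "AE \<omega> in ppm (\<lambda>i. q (h i)). P \<omega>"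
  shows "AE \<omega> in ppm q. P (\<lambda>i. \<omega> (h i))"
  using assms(2) unfolding distr_reindex[OF assms(1), symmetric] by (rule AE_distrD[rotated]) (use measurable_reindex[of h] in \<open>simp add: measurable_cong_sets[OF sets_ppm refl]\<close>)

lemma distr_coord: "distr (ppm q) (measure_pmf (q i)) (\<lambda>\<omega>. \<omega> i) = measure_pmf (q i)"
  unfolding ppm_def by (rule distr_PiM_component) (auto intro: prob_space_measure_pmf)

lemma integral_coord:
  fixes f :: "_ \<Rightarrow> real"
  shows "(\<integral>\<omega>. f (\<omega> i) \<partial>ppm q) = measure_pmf.expectation (q i) f"
  by (subst distr_coord[of q i, symmetric], subst integral_distr) auto

lemma AE_coord:
  assumes "\<And>y. y \<in> set_pmf (q i) \<Longrightarrow> P y"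
  shows "AE \<omega> in ppm q. P (\<omega> i)"
  unfolding ppm_def
  by (rule AE_PiM_component) (auto intro: prob_space_measure_pmf simp: AE_measure_pmf_iff assms)

section \<open>One step of the walk and the law of the branching random walk\<close>

text \<open>\<open>b = True\<close>: the walk itself, reflected at the root. \<open>b = False\<close>: the root behaves like any other
  vertex and the walk is killed when it steps above it. The killed walk restricts to subtrees, see \<open>step_op_shift\<close>.\<close>

definition step_op :: "bool \<Rightarrow> real \<Rightarrow> (nat list \<Rightarrow> nat) \<Rightarrow> (nat list \<Rightarrow> real) \<Rightarrow> nat list \<Rightarrow> real" where
  "step_op b lam \<omega> \<phi> x = (if x = [] then 0 else lam / (lam + \<omega> x) * \<phi> (butlast x))
     + (if b \<and> x = [] then 1 / \<omega> x else 1 / (lam + \<omega> x)) * (\<Sum>i<\<omega> x. \<phi> (x @ [i]))"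

lemma step_op_add: "step_op b lam \<omega> (\<lambda>y. \<phi> y + \<psi> y) x = step_op b lam \<omega> \<phi> x + step_op b lam \<omega> \<psi> x"
  by (simp add: step_op_def sum.distrib algebra_simps add_divide_distrib)

lemma step_op_cmult: "step_op b lam \<omega> (\<lambda>y. c * \<phi> y) x = c * step_op b lam \<omega> \<phi> x"
  by (simp add: step_op_def sum_distrib_left[symmetric] algebra_simps)

lemma step_op_zero: "step_op b lam \<omega> (\<lambda>y. 0) x = 0"
  by (simp add: step_op_def)

lemma step_op_diff: "step_op b lam \<omega> (\<lambda>y. \<phi> y - \<psi> y) x = step_op b lam \<omega> \<phi> x - step_op b lam \<omega> \<psi> x"
  by (simp add: step_op_def sum_subtractf algebra_simps diff_divide_distrib)

lemma step_op_sum: "finite S \<Longrightarrow> step_op b lam \<omega> (\<lambda>y. \<Sum>s\<in>S. \<phi> s y) x = (\<Sum>s\<in>S. step_op b lam \<omega> (\<phi> s) x)"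
  by (induction S rule: finite_induct) (auto simp: step_op_zero step_op_add)

lemma step_op_mono:
  assumes "0 < lam" "\<And>i. i < \<omega> x \<Longrightarrow> \<phi> (x @ [i]) \<le> \<psi> (x @ [i])"
    "x \<noteq> [] \<Longrightarrow> \<phi> (butlast x) \<le> \<psi> (butlast x)"
  shows "step_op b lam \<omega> \<phi> x \<le> step_op b lam \<omega> \<psi> x"
  unfolding step_op_def using assms
  by (intro add_mono mult_left_mono sum_mono) (auto intro!: divide_right_mono mult_left_mono)

lemma step_op_mono_level:
  assumes "0 < lam" "\<And>y. length y \<le> Suc (length x) \<Longrightarrow> \<phi> y \<le> \<psi> y"
  shows "step_op b lam \<omega> \<phi> x \<le> step_op b lam \<omega> \<psi> x"
  using assms by (intro step_op_mono) auto

lemma step_op_nonneg: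
  assumes "0 < lam" "\<And>y. 0 \<le> \<phi> y"
  shows "0 \<le> step_op b lam \<omega> \<phi> x"
  using step_op_mono[of lam \<omega> x "\<lambda>_. 0" \<phi> b] assms by (simp add: step_op_zero)

lemma step_op_const:
  assumes "0 < lam" "0 < \<omega> x" "b \<or> x \<noteq> []"
  shows "step_op b lam \<omega> (\<lambda>_. c) x = c"
proof -
  have "lam + real (\<omega> x) \<noteq> 0" "real (\<omega> x) \<noteq> 0" using assms by auto
  then have "lam * c / (lam + real (\<omega> x)) + real (\<omega> x) * c / (lam + real (\<omega> x)) = c"
    by (simp add: add_divide_distrib[symmetric] distrib_right[symmetric])
  then show ?thesis using assms by (auto simp: step_op_def)
qed

lemma step_op_const_le:
  assumes "0 < lam" "0 < \<omega> x" "0 \<le> c"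
  shows "step_op b lam \<omega> (\<lambda>_. c) x \<le> c"
proof (cases "b \<or> x \<noteq> []")
  case False
  then show ?thesis using assms by (auto simp: step_op_def field_simps)
qed (use step_op_const[of lam \<omega> x b c] assms in auto)

lemma step_op_bounds:
  assumes "0 < lam" "0 < \<omega> x" "\<And>y. 0 \<le> \<phi> y" "\<And>y. \<phi> y \<le> c"
  shows "0 \<le> step_op b lam \<omega> \<phi> x" "step_op b lam \<omega> \<phi> x \<le> c"
proof -
  show "0 \<le> step_op b lam \<omega> \<phi> x" using assms by (intro step_op_nonneg) auto
  have "0 \<le> c" using assms(3,4)[of undefined] by simp
  then have "step_op b lam \<omega> (\<lambda>_. c) x \<le> c" using assms by (intro step_op_const_le)
  moreover have "step_op b lam \<omega> \<phi> x \<le> step_op b lam \<omega> (\<lambda>_. c) x" using assms by (intro step_op_mono) auto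
  ultimately show "step_op b lam \<omega> \<phi> x \<le> c" by simp
qed

lemma step_op_kill_le:
  assumes "0 < lam" "0 < \<omega> x" "\<And>y. 0 \<le> \<phi> y"
  shows "step_op False lam \<omega> \<phi> x \<le> step_op True lam \<omega> \<phi> x"
proof (cases "x = []")
  case True
  have "1 / (lam + real (\<omega> x)) \<le> 1 / real (\<omega> x)" using assms by (auto simp: field_simps)
  then show ?thesis using assms(3) True unfolding step_op_def by (auto intro!: mult_right_mono sum_nonneg simp del: times_divide_eq_left)
qed (simp add: step_op_def)

lemma measurable_step_op [measurable]:
  fixes w :: "'a \<Rightarrow> nat list \<Rightarrow> nat" and \<phi> :: "'a \<Rightarrow> nat list \<Rightarrow> real"
  assumes "(\<lambda>z. w z x) \<in> measurable M (count_space UNIV)" "\<And>y. (\<lambda>z. \<phi> z y) \<in> borel_measurable M"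
  shows "(\<lambda>z. step_op b lam (w z) (\<phi> z) x) \<in> borel_measurable M"
proof -
  have [measurable]: "(\<lambda>z. \<phi> z y) \<in> borel_measurable M" for y by fact
  \<comment> \<open>The number of summands is random: it is first frozen to \<open>k\<close>, and
    the countably valued degree is substituted afterwards.\<close>
  have "(\<lambda>z. (if x = [] then 0 else lam / (lam + k) * \<phi> z (butlast x))
     + (if b \<and> x = [] then 1 / k else 1 / (lam + k)) * (\<Sum>i<k. \<phi> z (x @ [i]))) \<in> borel_measurable M" for k :: nat
    by measurable
  from measurable_compose_countable[OF this assms(1)] show ?thesis unfolding step_op_def .
qed

lemma integral_step_op:
  assumes "\<And>y. integrable M (\<lambda>z. \<phi> z y)"
  shows "integrable M (\<lambda>z. step_op b lam \<omega> (\<phi> z) x)"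
    "(\<integral>z. step_op b lam \<omega> (\<phi> z) x \<partial>M) = step_op b lam \<omega> (\<lambda>y. \<integral>z. \<phi> z y \<partial>M) x"
proof -
  have [simp]: "integrable M (\<lambda>z. \<phi> z y)" for y by fact
  show "integrable M (\<lambda>z. step_op b lam \<omega> (\<phi> z) x)"
    "(\<integral>z. step_op b lam \<omega> (\<phi> z) x \<partial>M) = step_op b lam \<omega> (\<lambda>y. \<integral>z. \<phi> z y \<partial>M) x"
    unfolding step_op_def by (cases "x = []"; simp)+
qed

lemma expectation_step_pmf:
  assumes "0 < lam" "0 < \<omega> x"
  shows "measure_pmf.expectation (step_pmf lam \<omega> x) \<phi> = step_op True lam \<omega> \<phi> x"
proof -
  have ne: "{..<\<omega> x} \<noteq> {}" using assms by auto
  show ?thesis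
  proof (cases "x = []")
    case True
    then show ?thesis using ne
      by (simp add: step_pmf_def step_op_def integral_pmf_of_set)
  next
    case False
    have p: "0 \<le> lam / (lam + real (\<omega> x))" "lam / (lam + real (\<omega> x)) \<le> 1" using assms by auto
    have fin: "finite (set_pmf (pmf_of_set {..<\<omega> x}))" using ne by simp
    have q: "1 - lam / (lam + real (\<omega> x)) = real (\<omega> x) / (lam + real (\<omega> x))"
      using assms by (simp add: field_simps)
    have "measure_pmf.expectation (step_pmf lam \<omega> x) \<phi> =
      (\<Sum>b\<in>UNIV. pmf (bernoulli_pmf (lam / (lam + real (\<omega> x)))) b *\<^sub>R measure_pmf.expectation
         (if b then return_pmf (butlast x) else map_pmf (\<lambda>i. x @ [i]) (pmf_of_set {..<\<omega> x})) \<phi>)"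
      using False fin unfolding step_pmf_def by (simp only: if_False, intro pmf_expectation_bind) auto
    also have "\<dots> = step_op True lam \<omega> \<phi> x"
      using False ne p assms by (simp add: UNIV_bool step_op_def integral_pmf_of_set q)
    finally show ?thesis .
  qed
qed

section \<open>Offspring generating function and the survival recursion\<close>

definition gfun :: "nat pmf \<Rightarrow> real \<Rightarrow> real" where
  "gfun \<mu> q = measure_pmf.expectation \<mu> (\<lambda>k. q ^ k)"

text \<open>The probability that at least one child succeeds when each does so independently with
  probability \<open>q\<close>.\<close>

definition hit_prob :: "nat pmf \<Rightarrow> real \<Rightarrow> real" where
  "hit_prob \<mu> q = 1 - gfun \<mu> (1 - q)"

lemma integrable_power_pmf: "0 \<le> q \<Longrightarrow> q \<le> (1::real) \<Longrightarrow> integrable (measure_pmf \<mu>) (\<lambda>k. q ^ k)"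
  by (rule measure_pmf.integrable_const_bound[of _ 1]) (auto simp: power_le_one)

lemma gfun_bounds:
  assumes "0 \<le> q" "q \<le> 1" shows "0 \<le> gfun \<mu> q" "gfun \<mu> q \<le> 1"
proof -
  show "0 \<le> gfun \<mu> q" using assms unfolding gfun_def by simp
  show "gfun \<mu> q \<le> 1" using assms unfolding gfun_def
    by (intro measure_pmf.integral_le_const integrable_power_pmf) (auto simp: power_le_one)
qed

lemma gfun_mono: "0 \<le> q \<Longrightarrow> q \<le> q' \<Longrightarrow> q' \<le> 1 \<Longrightarrow> gfun \<mu> q \<le> gfun \<mu> q'"
  unfolding gfun_def by (intro integral_mono integrable_power_pmf) (auto intro: power_mono)

lemma hit_prob_bounds: "0 \<le> q \<Longrightarrow> q \<le> 1 \<Longrightarrow> 0 \<le> hit_prob \<mu> q" "0 \<le> q \<Longrightarrow> q \<le> 1 \<Longrightarrow> hit_prob \<mu> q \<le> 1"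
  using gfun_bounds[of "1 - q" \<mu>] by (auto simp: hit_prob_def)

lemma hit_prob_mono: "0 \<le> q \<Longrightarrow> q \<le> q' \<Longrightarrow> q' \<le> 1 \<Longrightarrow> hit_prob \<mu> q \<le> hit_prob \<mu> q'"
  unfolding hit_prob_def by (simp add: gfun_mono)

lemma measurable_gfun [measurable]: "gfun \<mu> \<in> borel_measurable borel"
proof -
  have "(\<lambda>(q, k). q ^ k :: real) \<in> borel_measurable (borel \<Otimes>\<^sub>M measure_pmf \<mu>)"
    unfolding split_def by measurable
  then show ?thesis unfolding gfun_def
    by (rule measure_pmf.borel_measurable_lebesgue_integral)
qed

lemma measurable_hit_prob [measurable]: "hit_prob \<mu> \<in> borel_measurable borel"
  unfolding hit_prob_def by measurable

text \<open>The probability that a branching walk with motion \<open>K\<close>, started from one particle at \<open>x\<close>, has a line of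
  descent up to generation \<open>j\<close> whose position in each generation \<open>i\<close> satisfies \<open>Q i\<close>; see \<open>prob_surv\<close>.\<close>

primrec sv :: "nat pmf \<Rightarrow> ((nat list \<Rightarrow> real) \<Rightarrow> nat list \<Rightarrow> real) \<Rightarrow> nat \<Rightarrow> (nat \<Rightarrow> nat list \<Rightarrow> bool) \<Rightarrow> nat list \<Rightarrow> real" where
  "sv \<mu> K 0 Q x = of_bool (Q 0 x)"
| "sv \<mu> K (Suc j) Q x = of_bool (Q 0 x) * hit_prob \<mu> (K (sv \<mu> K j (\<lambda>k. Q (Suc k))) x)"

lemma sv_bounds:
  assumes "0 < lam" "\<And>x. 0 < \<omega> x"
  shows "0 \<le> sv \<mu> (step_op b lam \<omega>) j Q x \<and> sv \<mu> (step_op b lam \<omega>) j Q x \<le> 1"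
proof (induction j arbitrary: Q x)
  case (Suc j)
  then show ?case using hit_prob_bounds step_op_bounds[OF assms(1), of \<omega> x "sv \<mu> (step_op b lam \<omega>) j (\<lambda>k. Q (Suc k))" 1 b] assms
    by (auto simp: mult_le_one)
qed simp

text \<open>The event whose probability is \<open>sv\<close>. The family below child
  \<open>i\<close> is read off from the labels that begin with \<open>i\<close>, so it is again a
  full family of independent variables.\<close>

primrec surv :: "nat \<Rightarrow> (nat \<Rightarrow> nat list \<Rightarrow> bool) \<Rightarrow> (nat list \<Rightarrow> nat) \<Rightarrow> (nat list \<times> nat list \<Rightarrow> nat list) \<Rightarrow> nat list \<Rightarrow> bool" where
  "surv 0 Q N J x \<longleftrightarrow> Q 0 x"
| "surv (Suc j) Q N J x \<longleftrightarrow> Q 0 x \<and> (\<exists>i<N []. surv j (\<lambda>k. Q (Suc k)) (\<lambda>u. N (i # u)) (\<lambda>z. J (i # fst z, snd z)) (J ([i], x)))"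

lemma measurable_surv:
  "Measurable.pred (coords \<Otimes>\<^sub>M coords) (\<lambda>z. surv j Q (fst z) (snd z) x)"
proof (induction j arbitrary: Q x)
  case (Suc j)
  have [measurable]: "Measurable.pred (coords \<Otimes>\<^sub>M coords)
      (\<lambda>z. surv j Q (\<lambda>u. fst z (i # u)) (\<lambda>y. snd z (i # fst y, snd y)) x)" for i Q x
  proof -
    have "(\<lambda>z. (\<lambda>u. fst z (i # u), \<lambda>y. snd z (i # fst y, snd y))) \<in> measurable (coords \<Otimes>\<^sub>M coords) (coords \<Otimes>\<^sub>M coords)"
      by (intro measurable_Pair measurable_coordsI) measurable
    from measurable_compose[OF this Suc[of Q x]] show ?thesis by simp
  qed
  have f [measurable]: "(\<lambda>z. fst z []) \<in> measurable (coords \<Otimes>\<^sub>M coords) (count_space UNIV)"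
    by (rule measurable_compose[OF measurable_fst measurable_coord])
  have [measurable]: "Measurable.pred (coords \<Otimes>\<^sub>M coords)
      (\<lambda>z. surv j (\<lambda>k. Q (Suc k)) (\<lambda>u. fst z (i # u)) (\<lambda>y. snd z (i # fst y, snd y)) (snd z ([i], x)))" for i
    by (rule measurable_compose_countable[where g = "\<lambda>z. snd z ([i], x)"])
       (auto intro: measurable_compose[OF measurable_snd measurable_coord])
  have "Measurable.pred (coords \<Otimes>\<^sub>M coords) (\<lambda>z. \<exists>i<k. surv j (\<lambda>k. Q (Suc k)) (\<lambda>u. fst z (i # u))
      (\<lambda>y. snd z (i # fst y, snd y)) (snd z ([i], x)))" for k :: nat
    by measurable
  from measurable_compose_countable[OF this f] show ?case by simp
qed simp

lemma measurable_surv_snd: "Measurable.pred coords (\<lambda>J. surv j Q N J x)"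
  using measurable_compose[OF measurable_Pair1'[of N coords coords] measurable_surv[of j Q x]] by (simp add: space_PiM)

text \<open>Only non-empty labels are ever read. This frees the coordinate \<open>([], x)\<close>
  for the step that leads to the start of a family, see \<open>sJ_child\<close>.\<close>

lemma surv_ignores_root: "(\<And>u y. u \<noteq> [] \<Longrightarrow> J (u, y) = J' (u, y)) \<Longrightarrow> surv j Q N J x = surv j Q N J' x"
proof (induction j arbitrary: Q N J J' x)
  case (Suc j)
  have "surv j Q' N' (\<lambda>z. J (i # fst z, snd z)) y = surv j Q' N' (\<lambda>z. J' (i # fst z, snd z)) y" for Q' N' i y
    by (rule Suc.IH) (simp add: Suc.prems)
  then show ?case using Suc.prems by simp
qed simp

lemma of_bool_ex_less: "of_bool (\<exists>i<n::nat. P i) = (1::real) - (\<Prod>i<n. 1 - of_bool (P i))"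
proof (cases "\<exists>i<n. P i")
  case True
  then have "(\<Prod>i<n. 1 - of_bool (P i)) = (0::real)" by (intro prod_zero) auto
  with True show ?thesis by simp
qed (auto intro!: prod.neutral)

locale quenched =
  fixes lam :: real and \<omega> :: "nat list \<Rightarrow> nat"
  assumes lam_pos: "0 < lam" and deg_pos: "\<And>x. 0 < \<omega> x"
begin

abbreviation "steps \<equiv> ppm (\<lambda>z :: nat list \<times> nat list. step_pmf lam \<omega> (snd z))"

definition sJ :: "nat \<Rightarrow> (nat \<Rightarrow> nat list \<Rightarrow> bool) \<Rightarrow> (nat list \<Rightarrow> nat) \<Rightarrow> nat list \<Rightarrow> real" where
  "sJ j Q N x = (\<integral>J. of_bool (surv j Q N J x) \<partial>steps)"

lemma sJ_bounds: "0 \<le> sJ j Q N x" "sJ j Q N x \<le> 1"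
  unfolding sJ_def using measurable_surv_snd[of j Q N x] by (intro integral_ppm_bounds[where B = 1]; simp)+

text \<open>Reindexing turns the step of child \<open>i\<close> into the coordinate
  \<open>([], x)\<close> and its descendants into a full family, which does not read that
  coordinate. Hence the step and the family are independent.\<close>

lemma sJ_child:
  "(\<integral>J. of_bool (surv j Q N (\<lambda>z. J (i # fst z, snd z)) (J ([i], x))) \<partial>steps) = step_op True lam \<omega> (sJ j Q N) x"
proof -
  let ?h = "\<lambda>z :: nat list \<times> nat list. (i # fst z, snd z)"
  have inj: "inj ?h" by (auto simp: inj_def)
  have pm [measurable]: "Measurable.pred coords (\<lambda>J. surv j Q N J y)" for y
    by (rule measurable_surv_snd)
  have m: "Measurable.pred coords (\<lambda>J. surv j Q N J (J ([], x)))"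
    by (rule measurable_compose_countable[where g = "\<lambda>J. J ([], x)"]) measurable
  have "(\<integral>J. of_bool (surv j Q N (\<lambda>z. J (i # fst z, snd z)) (J ([i], x))) \<partial>steps)
    = (\<integral>J. (of_bool (surv j Q N J (J ([], x))) :: real) \<partial>steps)"
    using integral_reindex[OF inj, of "\<lambda>J. of_bool (surv j Q N J (J ([], x)))" "\<lambda>z. step_pmf lam \<omega> (snd z)"] m
    by simp
  also have "\<dots> = (\<integral>J. (\<integral>J'. of_bool (surv j Q N (mix {([], x)} J J') (mix {([], x)} J J' ([], x))) \<partial>steps) \<partial>steps)"
    using m by (intro integral_mix[where B = 1]) auto
  also have "\<dots> = (\<integral>J. sJ j Q N (J ([], x)) \<partial>steps)"
  proof -
    have "surv j Q N (mix {([], x)} J J') y = surv j Q N J' y" for J J' y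
      by (rule surv_ignores_root) (auto simp: mix_def)
    then show ?thesis by (simp add: sJ_def) (simp add: mix_def)
  qed
  also have "\<dots> = step_op True lam \<omega> (sJ j Q N) x"
    by (simp add: integral_coord expectation_step_pmf lam_pos deg_pos)
  finally show ?thesis .
qed

lemma sJ_Suc:
  "sJ (Suc j) Q N x = of_bool (Q 0 x) * (1 - (\<Prod>i<N []. 1 - step_op True lam \<omega> (sJ j (\<lambda>k. Q (Suc k)) (\<lambda>u. N (i # u))) x))"
proof -
  interpret P: prob_space steps by (rule prob_space_ppm)
  let ?F = "\<lambda>i J. of_bool (surv j (\<lambda>k. Q (Suc k)) (\<lambda>u. N (i # u)) (\<lambda>z. J (i # fst z, snd z)) (J ([i], x))) :: real"
  have m [measurable]: "?F i \<in> borel_measurable coords" for i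
  proof -
    have [measurable]: "Measurable.pred coords (\<lambda>J. surv j (\<lambda>k. Q (Suc k)) (\<lambda>u. N (i # u)) (\<lambda>z. J (i # fst z, snd z)) y)" for y
      by (rule measurable_compose[OF measurable_reindex measurable_surv_snd])
    have "Measurable.pred coords (\<lambda>J. surv j (\<lambda>k. Q (Suc k)) (\<lambda>u. N (i # u)) (\<lambda>z. J (i # fst z, snd z)) (J ([i], x)))"
      by (rule measurable_compose_countable[where g = "\<lambda>J. J ([i], x)"]) measurable
    then show ?thesis by simp
  qed
  have F1: "integrable steps (?F i)" for i by (rule integrable_ppm[of _ 1]) auto
  have "(\<integral>J. (\<Prod>i<N []. 1 - ?F i J) \<partial>steps) = (\<Prod>i<N []. \<integral>J. 1 - ?F i J \<partial>steps)"
  \<comment> \<open>Labels with different first letters are disjoint coordinate sets, so the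
    children fail independently given \<open>N\<close> and the common position
    \<open>x\<close>.\<close>
  proof (rule integral_prod_independent[where A = "\<lambda>i. {(i # u, y) | u y. True}"])
    show "depends_on (\<lambda>J. 1 - ?F i J) {(i # u, y) | u y. True}" for i
      unfolding depends_on_def
    proof (intro allI impI)
      fix J J' :: "nat list \<times> nat list \<Rightarrow> nat list"
      assume *: "\<forall>z\<in>{(i # u, y) |u y. True}. J z = J' z"
      then have "J (i # u, y) = J' (i # u, y)" for u y by auto
      then show "1 - ?F i J = 1 - ?F i J'" by simp
    qed
  qed (auto simp: disjoint_family_on_def)
  also have "\<dots> = (\<Prod>i<N []. 1 - step_op True lam \<omega> (sJ j (\<lambda>k. Q (Suc k)) (\<lambda>u. N (i # u))) x)"
    using F1 P.prob_space by (intro prod.cong refl) (simp add: sJ_child)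
  finally have *: "(\<integral>J. (\<Prod>i<N []. 1 - ?F i J) \<partial>steps) = \<dots>" .
  have "integrable steps (\<lambda>J. \<Prod>i<N []. 1 - ?F i J)"
    by (rule integrable_ppm[of _ 1]) (auto simp: abs_prod intro!: prod_le_1)
  moreover have "of_bool (surv (Suc j) Q N J x) = of_bool (Q 0 x) * (1 - (\<Prod>i<N []. 1 - ?F i J))" for J
    by (simp add: of_bool_ex_less of_bool_conj)
  ultimately show ?thesis
    using P.prob_space unfolding sJ_def[of "Suc j"] by (simp add: * del: surv.simps)
qed

lemma sJ_measurable [measurable]: "(\<lambda>N. sJ j Q N x) \<in> borel_measurable coords"
proof -
  interpret P: prob_space steps by (rule prob_space_ppm)
  have "(\<lambda>(N, J). of_bool (surv j Q N J x) :: real) \<in> borel_measurable (coords \<Otimes>\<^sub>M steps)"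
    using measurable_surv[of j Q x] by (simp add: split_def)
  then show ?thesis unfolding sJ_def by (rule P.borel_measurable_lebesgue_integral)
qed

text \<open>\<open>N []\<close> is separated from the labels below it; the children then become
  identically distributed, and the power with exponent \<open>N []\<close> integrates to the
  generating function.\<close>

lemma integral_sJ: "(\<integral>N. sJ j Q N x \<partial>ppm (\<lambda>_. \<mu>)) = sv \<mu> (step_op True lam \<omega>) j Q x"
proof (induction j arbitrary: Q x)
  case 0
  interpret P: prob_space steps by (rule prob_space_ppm)
  interpret P': prob_space "ppm (\<lambda>_::nat list. \<mu>)" by (rule prob_space_ppm)
  show ?case using P.prob_space P'.prob_space by (simp add: sJ_def)
next
  case (Suc j)
  let ?P = "ppm (\<lambda>_::nat list. \<mu>)"
  interpret P': prob_space ?P by (rule prob_space_ppm)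
  let ?Q = "\<lambda>k. Q (Suc k)"
  let ?F = "\<lambda>N. 1 - step_op True lam \<omega> (sJ j ?Q N) x"
  have [measurable]: "?F \<in> borel_measurable coords" by measurable
  have Fb: "0 \<le> ?F N" "?F N \<le> 1" for N
    using step_op_bounds[of lam \<omega> x "sJ j ?Q N" 1 True] sJ_bounds lam_pos deg_pos by auto
  have m2 [measurable]: "(\<lambda>N. ?F (\<lambda>u. N (i # u))) \<in> borel_measurable coords" for i
    by (rule measurable_compose[OF measurable_reindex]) measurable
  have m3: "(\<lambda>N. \<Prod>i<N []. ?F (\<lambda>u. N (i # u))) \<in> borel_measurable coords"
    by (rule measurable_compose_countable[where g = "\<lambda>N. N []" and f = "\<lambda>k N. \<Prod>i<k. ?F (\<lambda>u. N (i # u))"]) measurable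
  have int: "integrable ?P (\<lambda>N. sJ j ?Q N y)" for y
    using sJ_bounds by (intro integrable_ppm[of _ 1]) (auto simp: abs_le_iff intro: order_trans[of _ 0])
  have EF: "(\<integral>N. ?F N \<partial>?P) = 1 - step_op True lam \<omega> (sv \<mu> (step_op True lam \<omega>) j ?Q) x"
    using integral_step_op[OF int] P'.prob_space by (simp add: Suc)
  have pb: "\<bar>\<Prod>i<k. ?F (\<lambda>u. N (i # u))\<bar> \<le> 1" for k N
    using Fb by (subst abs_prod) (auto intro!: prod_le_1 simp: abs_le_iff intro: order_trans[of _ 0])
  have "(\<integral>N. (\<Prod>i<N []. ?F (\<lambda>u. N (i # u))) \<partial>?P)
      = (\<integral>N. (\<integral>N'. (\<Prod>i<N []. ?F (\<lambda>u. N' (i # u))) \<partial>?P) \<partial>?P)"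
    using m3 pb by (subst integral_mix[where A = "{[]}" and B = 1]) (auto simp: mix_def)
  also have "\<dots> = (\<integral>N. (\<integral>N'. ?F N' \<partial>?P) ^ N [] \<partial>?P)"
  proof -
    have "(\<integral>N'. (\<Prod>i<k. ?F (\<lambda>u. N' (i # u))) \<partial>?P) = (\<Prod>i<k. (\<integral>N'. ?F (\<lambda>u. N' (i # u)) \<partial>?P))" for k
    proof (rule integral_prod_independent[where A = "\<lambda>i. range ((#) i)"])
      show "depends_on (\<lambda>N. ?F (\<lambda>u. N (i # u))) (range ((#) i))" for i
        by (auto simp: depends_on_def)
      show "\<bar>?F (\<lambda>u. N (i # u))\<bar> \<le> 1" for i N
        using Fb[of "\<lambda>u. N (i # u)"] by (auto simp: abs_le_iff intro: order_trans[of _ 0])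
    qed (auto simp: disjoint_family_on_def)
    also have "\<dots> k = (\<integral>N'. ?F N' \<partial>?P) ^ k" for k
      by (subst integral_reindex[where h = "(#) _"]) (auto simp: inj_def)
    finally show ?thesis by simp
  qed
  also have "\<dots> = gfun \<mu> (\<integral>N'. ?F N' \<partial>?P)"
    unfolding gfun_def by (rule integral_coord)
  finally have "(\<integral>N. (\<Prod>i<N []. ?F (\<lambda>u. N (i # u))) \<partial>?P) = gfun \<mu> (\<integral>N'. ?F N' \<partial>?P)" .
  moreover have "integrable ?P (\<lambda>N. \<Prod>i<N []. ?F (\<lambda>u. N (i # u)))"
    using m3 pb by (intro integrable_ppm[of _ 1]) auto
  ultimately show ?case
    using P'.prob_space by (simp add: sJ_Suc EF hit_prob_def)
qed

lemma brw_space_eq: "brw_space \<mu> lam \<omega> = ppm (\<lambda>_. \<mu>) \<Otimes>\<^sub>M steps"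
  by (simp add: brw_space_def ppm_def split_def)

lemma prob_space_brw: "prob_space (brw_space \<mu> lam \<omega>)"
proof -
  interpret A: prob_space "ppm (\<lambda>_::nat list. \<mu>)" by (rule prob_space_ppm)
  interpret B: prob_space steps by (rule prob_space_ppm)
  interpret C: pair_prob_space "ppm (\<lambda>_::nat list. \<mu>)" steps by unfold_locales
  show ?thesis unfolding brw_space_eq by unfold_locales
qed

lemma space_brw [simp]: "space (brw_space \<mu> lam \<omega>) = UNIV"
  by (simp add: brw_space_eq space_pair_measure)

lemma sets_brw: "sets (brw_space \<mu> lam \<omega>) = sets (coords \<Otimes>\<^sub>M coords)"
  unfolding brw_space_eq by (intro sets_pair_measure_cong) auto

lemma surv_sets: "{NJ. surv j Q (fst NJ) (snd NJ) x} \<in> sets (brw_space \<mu> lam \<omega>)"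
  using measurable_surv[of j Q x] unfolding sets_brw pred_def by (simp add: space_pair_measure space_PiM)

text \<open>The link between the particle system and the recursion; afterwards probabilities of the
  branching walk are handled through \<open>sv\<close>.\<close>

lemma prob_surv:
  "measure (brw_space \<mu> lam \<omega>) {NJ. surv j Q (fst NJ) (snd NJ) x} = sv \<mu> (step_op True lam \<omega>) j Q x"
proof -
  interpret A: prob_space "ppm (\<lambda>_::nat list. \<mu>)" by (rule prob_space_ppm)
  interpret B: prob_space steps by (rule prob_space_ppm)
  interpret C: pair_prob_space "ppm (\<lambda>_::nat list. \<mu>)" steps by unfold_locales
  interpret D: prob_space "brw_space \<mu> lam \<omega>" by (rule prob_space_brw)
  have m: "(\<lambda>NJ. of_bool (surv j Q (fst NJ) (snd NJ) x) :: real) \<in> borel_measurable (ppm (\<lambda>_. \<mu>) \<Otimes>\<^sub>M steps)"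
    using measurable_surv[of j Q x] by simp
  then have int: "integrable (ppm (\<lambda>_. \<mu>) \<Otimes>\<^sub>M steps) (\<lambda>NJ. of_bool (surv j Q (fst NJ) (snd NJ) x) :: real)"
    by (intro C.integrable_const_bound[of _ 1]) auto
  have "measure (brw_space \<mu> lam \<omega>) {NJ. surv j Q (fst NJ) (snd NJ) x}
    = (\<integral>NJ. indicator {NJ. surv j Q (fst NJ) (snd NJ) x} NJ \<partial>brw_space \<mu> lam \<omega>)"
    by simp
  also have "\<dots> = (\<integral>NJ. of_bool (surv j Q (fst NJ) (snd NJ) x) \<partial>(ppm (\<lambda>_. \<mu>) \<Otimes>\<^sub>M steps))"
    unfolding brw_space_eq by (intro Bochner_Integration.integral_cong) (auto simp: indicator_def)
  also have "\<dots> = (\<integral>N. sJ j Q N x \<partial>ppm (\<lambda>_. \<mu>))"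
    using C.integral_fst'[OF int] by (simp add: sJ_def)
  finally show ?thesis by (simp add: integral_sJ)
qed

end

section \<open>The law of the walk, generating functions and the minimal displacement\<close>

lemma divide_le_divideI: "0 < y \<Longrightarrow> 0 < z \<Longrightarrow> x * z \<le> w * y \<Longrightarrow> x / y \<le> w / (z :: real)"
  by (simp add: field_simps)

context quenched begin

lemma walk_space_eq: "walk_space lam \<omega> = ppm (\<lambda>z :: nat \<times> nat list. step_pmf lam \<omega> (snd z))"
  by (simp add: walk_space_def ppm_def split_def)

lemma measurable_walk [measurable]: "(\<lambda>J. walk J n) \<in> measurable coords (count_space UNIV)"
proof (induction n)
  case (Suc n)
  show ?case unfolding walk.simps
    by (rule measurable_compose_countable[where g = "\<lambda>J. walk J n"]) (use Suc in auto)
qed simp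

lemma walk_mix: "walk (mix {z. fst z < n} J J') k = walk J k" if "k \<le> n"
  using that by (induction k) (auto simp: mix_def)

lemma integral_walk:
  fixes \<phi> :: "nat list \<Rightarrow> real"
  assumes "\<And>x. 0 \<le> \<phi> x" "\<And>x. \<phi> x \<le> B"
  shows "(\<integral>J. \<phi> (walk J n) \<partial>walk_space lam \<omega>) = (step_op True lam \<omega> ^^ n) \<phi> []"
  using assms
proof (induction n arbitrary: \<phi>)
  case 0
  interpret P: prob_space "walk_space lam \<omega>" unfolding walk_space_eq by (rule prob_space_ppm)
  show ?case using P.prob_space by simp
next
  case (Suc n)
  let ?W = "ppm (\<lambda>z :: nat \<times> nat list. step_pmf lam \<omega> (snd z))"
  \<comment> \<open>The position at time \<open>n\<close> reads only coordinates with time index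
    below \<open>n\<close>, so the next step can be averaged first.\<close>
  have "(\<integral>J. \<phi> (walk J (Suc n)) \<partial>?W) = (\<integral>J. (\<integral>J'. \<phi> (walk (mix {z. fst z < n} J J') (Suc n)) \<partial>?W) \<partial>?W)"
    using Suc.prems by (intro integral_mix[where B = B]) (auto simp: abs_le_iff intro: order_trans[of _ 0] order_trans)
  also have "\<dots> = (\<integral>J. step_op True lam \<omega> \<phi> (walk J n) \<partial>?W)"
    unfolding walk.simps walk_mix[OF le_refl]
    by (simp add: mix_def integral_coord expectation_step_pmf lam_pos deg_pos)
  also have "\<dots> = (step_op True lam \<omega> ^^ n) (step_op True lam \<omega> \<phi>) []"
    using Suc.IH[of "step_op True lam \<omega> \<phi>"] Suc.prems step_op_bounds[OF lam_pos deg_pos, of \<phi> B] walk_space_eq by auto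
  finally show ?case by (simp add: walk_space_eq funpow_swap1)
qed

lemma measure_walk:
  "measure (walk_space lam \<omega>) {J. P (walk J n)} = (step_op True lam \<omega> ^^ n) (\<lambda>x. of_bool (P x)) []"
proof -
  have "measure (walk_space lam \<omega>) {J. P (walk J n)} = (\<integral>J. indicator {J. P (walk J n)} J \<partial>walk_space lam \<omega>)"
    by (simp add: walk_space_eq)
  also have "\<dots> = (\<integral>J. of_bool (P (walk J n)) \<partial>walk_space lam \<omega>)"
    by (intro Bochner_Integration.integral_cong) (auto simp: indicator_def)
  also have "\<dots> = (step_op True lam \<omega> ^^ n) (\<lambda>x. of_bool (P x)) []"
    by (rule integral_walk[where B = 1]) auto
  finally show ?thesis .
qed

definition stay :: "nat \<Rightarrow> nat \<Rightarrow> nat list \<Rightarrow> real" where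
  "stay l n = (step_op True lam \<omega> ^^ n) (\<lambda>x. of_bool (length x < l))"

lemma stay_0: "stay l 0 x = of_bool (length x < l)"
  and stay_Suc: "stay l (Suc n) x = step_op True lam \<omega> (stay l n) x"
  by (simp_all add: stay_def)

lemma stay_bounds: "0 \<le> stay l n x \<and> stay l n x \<le> 1"
proof (induction n arbitrary: x)
  case (Suc n)
  then show ?case using step_op_bounds[OF lam_pos deg_pos, of "stay l n" 1] by (auto simp: stay_Suc)
qed (simp add: stay_0)

lemma less_nat_ceiling_iff: "k < nat \<lceil>y\<rceil> \<longleftrightarrow> real k < y"
  by linarith

lemma qprob_eq_stay:
  assumes "0 < n"
  shows "qprob lam \<omega> n 0 a = stay (nat \<lceil>a * n\<rceil>) n []"
proof -
  have "(real (length x) / real n \<in> {0..<a}) = (length x < nat \<lceil>a * n\<rceil>)" for x :: "nat list"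
    using assms by (simp add: less_nat_ceiling_iff field_simps)
  then show ?thesis unfolding qprob_def stay_def
    using measure_walk[of "\<lambda>x. length x < nat \<lceil>a * n\<rceil>" n] by (simp add: walk_space_eq)
qed

text \<open>The walk can oscillate between the root and its children. Positivity matters because
  \<open>ln 0 = 0\<close>: a vanishing probability would pass through a limit of logarithms
  unnoticed.\<close>

lemma stay_pos:
  assumes "2 \<le> l" "length x \<le> 1"
  shows "0 < stay l n x"
  using assms(2)
proof (induction n arbitrary: x)
  case (Suc n)
  have nn: "0 \<le> stay l n y" for y using stay_bounds by blast
  show ?case
  proof (cases "x = []")
    case True
    have "0 < (\<Sum>i<\<omega> x. stay l n (x @ [i]))"
      using Suc.IH deg_pos[of x] True by (intro sum_pos) auto
    then show ?thesis using True deg_pos[of x] by (simp add: stay_Suc step_op_def)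
  next
    case False
    with Suc.prems have "0 < stay l n (butlast x)" by (intro Suc.IH) auto
    then show ?thesis using False lam_pos deg_pos[of x] nn
      unfolding stay_Suc step_op_def by (auto intro!: add_pos_nonneg mult_pos_pos mult_nonneg_nonneg sum_nonneg divide_nonneg_nonneg)
  qed
qed (use assms in \<open>simp add: stay_0\<close>)

end

section \<open>The exponential supersolution and positive speed\<close>

locale biased = quenched +
  fixes d :: nat
  assumes deg_ge: "\<And>x. d \<le> \<omega> x" and lam_less: "lam < d" and d_ge: "2 \<le> d"
begin

text \<open>If every vertex has \<open>d\<close> children, one step multiplies
  \<open>r ^ length x\<close> by \<open>(lam / r + d * r) / (lam + d)\<close> away from the root.
  \<open>ratio\<close> is the minimising \<open>r\<close> and \<open>rho\<close> the minimum, the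
  spectral radius of that walk.\<close>

definition rho :: real where "rho = 2 * sqrt (lam * d) / (lam + d)"
definition ratio :: real where "ratio = sqrt (lam / d)"

lemma ratio_pos: "0 < ratio" and ratio_less: "ratio < 1" and ratio_sq: "ratio\<^sup>2 = lam / d"
  and rho_ratio: "rho * ratio = 2 * lam / (lam + d)" and rho_pos: "0 < rho"
  and ratio_le_rho: "ratio \<le> rho"
proof -
  show p: "0 < ratio" "ratio < 1" using lam_pos lam_less by (auto simp: ratio_def)
  show sq: "ratio\<^sup>2 = lam / d" using lam_pos by (simp add: ratio_def)
  have "sqrt (lam * d) * sqrt (lam / d) = lam"
    using lam_pos d_ge by (simp add: real_sqrt_mult[symmetric] power2_eq_square[symmetric])
  then show r: "rho * ratio = 2 * lam / (lam + d)"
    unfolding rho_def ratio_def by (metis mult.assoc times_divide_eq_left)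
  show "0 < rho" using lam_pos d_ge by (auto simp: rho_def)
  have "lam / d \<le> 2 * lam / (lam + d)"
    using lam_pos lam_less d_ge by (simp add: field_simps)
  then have "ratio * ratio \<le> rho * ratio"
    using sq r by (simp add: power2_eq_square)
  then show "ratio \<le> rho" using p by simp
qed

lemma rho_less: "rho < 1"
proof -
  have "0 < (sqrt lam - sqrt d)\<^sup>2" using lam_less by (simp add: zero_less_power2)
  then have "2 * (sqrt lam * sqrt d) < lam + d"
    using lam_pos by (simp add: power2_diff)
  then show ?thesis using lam_pos d_ge by (simp add: rho_def real_sqrt_mult)
qed

text \<open>The factor \<open>(lam + k * ratio\<^sup>2) / (lam + k)\<close> decreases in the degree
  \<open>k\<close> because \<open>ratio < 1\<close>, so degree \<open>d\<close> is the worst case.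
  At the reflecting root the factor is \<open>ratio\<close>, which is at most \<open>rho\<close>
  since \<open>lam < d\<close>.\<close>

lemma step_op_ratio: "step_op b lam \<omega> (\<lambda>y. ratio ^ length y) x \<le> rho * ratio ^ length x"
proof -
  have "step_op True lam \<omega> (\<lambda>y. ratio ^ length y) x \<le> rho * ratio ^ length x"
  proof (cases "x = []")
    case True
    then show ?thesis using ratio_le_rho deg_pos[of x] by (simp add: step_op_def)
  next
    case False
    then obtain n where n: "length x = Suc n" by (cases x) auto
    let ?k = "real (\<omega> x)"
    have k: "real d \<le> ?k" using deg_ge by simp
    have "(?k - d) * (d - lam) \<ge> 0" using k lam_less by simp
    then have "(d + ?k) * (lam + d) \<le> 2 * d * (lam + ?k)" by (simp add: algebra_simps)
    then have "lam * (d + ?k) * (lam + d) \<le> lam * (2 * d * (lam + ?k))"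
      using lam_pos by (simp add: mult.assoc)
    then have "lam * (d + ?k) / (d * (lam + ?k)) \<le> 2 * lam / (lam + d)"
      using lam_pos d_ge k by (intro divide_le_divideI) (auto simp: mult_ac)
    moreover have "lam * (d + ?k) / (d * (lam + ?k)) = (lam + ?k * ratio\<^sup>2) / (lam + ?k)"
      using lam_pos d_ge by (simp add: ratio_sq field_simps)
    ultimately have "(lam + ?k * ratio\<^sup>2) / (lam + ?k) * ratio ^ n \<le> rho * ratio * ratio ^ n"
      using ratio_pos by (intro mult_right_mono) (simp_all add: rho_ratio)
    then show ?thesis using False n
      by (simp add: step_op_def power2_eq_square algebra_simps add_divide_distrib)
  qed
  moreover have "step_op False lam \<omega> (\<lambda>y. ratio ^ length y) x \<le> step_op True lam \<omega> (\<lambda>y. ratio ^ length y) x"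
    using lam_pos deg_pos ratio_pos by (intro step_op_kill_le) auto
  ultimately show ?thesis by (cases b) auto
qed

lemma stay_le: "stay l n x \<le> rho ^ n * ratio ^ length x / ratio ^ l"
proof (induction n arbitrary: x)
  case 0
  show ?case using ratio_pos ratio_less
    by (auto simp: stay_0 power_decreasing)
next
  case (Suc n)
  have "stay l n y \<le> (rho ^ n / ratio ^ l) * ratio ^ length y" for y using Suc[of y] by simp
  then have "stay l (Suc n) x \<le> step_op True lam \<omega> (\<lambda>y. (rho ^ n / ratio ^ l) * ratio ^ length y) x"
    unfolding stay_Suc by (intro step_op_mono lam_pos)
  also have "\<dots> \<le> (rho ^ n / ratio ^ l) * (rho * ratio ^ length x)"
    unfolding step_op_cmult using ratio_pos rho_pos by (intro mult_left_mono step_op_ratio) auto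
  finally show ?case by (simp add: field_simps)
qed

lemma speed_pos:
  assumes "AE J in walk_space lam \<omega>. (\<lambda>n. real (length (walk J n)) / real n) \<longlonglongrightarrow> v"
  shows "0 < v"
proof -
  interpret P: prob_space "walk_space lam \<omega>" unfolding walk_space_eq by (rule prob_space_ppm)
  \<comment> \<open>Chosen so that \<open>ratio powr a = sqrt rho\<close>: the bound from
    \<open>stay_le\<close> at level \<open>a * n\<close> is then \<open>sqrt rho ^ n\<close> up to a
    constant, hence summable.\<close>
  define a where "a = ln rho / (2 * ln ratio)"
  have a: "0 < a" using rho_pos rho_less ratio_pos ratio_less
    by (auto simp: a_def intro!: divide_neg_neg mult_pos_neg)
  have ra: "ratio powr a = sqrt rho"
    using rho_pos ratio_pos ratio_less by (simp add: a_def powr_def powr_half_sqrt[symmetric])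
  let ?A = "\<lambda>n. {J. length (walk J n) < nat \<lceil>a * n\<rceil>}"
  have m: "measure (walk_space lam \<omega>) (?A n) \<le> sqrt rho ^ n / ratio" for n
  proof -
    have "measure (walk_space lam \<omega>) (?A n) = stay (nat \<lceil>a * n\<rceil>) n []"
      unfolding stay_def by (rule measure_walk)
    also have "\<dots> \<le> rho ^ n / ratio ^ nat \<lceil>a * n\<rceil>" using stay_le[of _ n "[]"] by simp
    also have "\<dots> \<le> rho ^ n / (ratio powr (a * n + 1))"
    proof (intro divide_left_mono mult_pos_pos)
      have "ratio powr (a * n + 1) \<le> ratio powr real (nat \<lceil>a * n\<rceil>)"
        using ratio_pos ratio_less a by (intro powr_mono') (auto, linarith?)
      then show "ratio powr (a * n + 1) \<le> ratio ^ nat \<lceil>a * n\<rceil>"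
        using ratio_pos by (simp add: powr_realpow)
    qed (use rho_pos ratio_pos in auto)
    also have "\<dots> = sqrt rho ^ n / ratio"
    proof -
      have "ratio powr (a * n + 1) = sqrt rho ^ n * ratio"
        using ratio_pos rho_pos by (simp add: powr_add powr_powr[symmetric] ra powr_realpow)
      moreover have "rho ^ n = sqrt rho ^ n * sqrt rho ^ n"
        using rho_pos by (simp add: power_mult_distrib[symmetric])
      ultimately show ?thesis using rho_pos by simp
    qed
    finally show ?thesis .
  qed
  have "AE J in walk_space lam \<omega>. eventually (\<lambda>n. J \<in> space (walk_space lam \<omega>) - ?A n) sequentially"
  proof (rule borel_cantelli_AE1)
    show "?A n \<in> sets (walk_space lam \<omega>)" for n
      using measurable_sets[OF measurable_walk, of "{x. length x < nat \<lceil>a * n\<rceil>}" n] by (simp add: walk_space_eq vimage_def space_PiM)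
    have "summable (\<lambda>n. sqrt rho ^ n / ratio)"
      using rho_pos rho_less by (intro summable_divide summable_geometric) auto
    then show "summable (\<lambda>n. measure (walk_space lam \<omega>) (?A n))"
      by (rule summable_comparison_test') (use m in auto)
  qed (simp add: P.emeasure_eq_measure)
  then have "AE J in walk_space lam \<omega>. a \<le> v"
    using assms
  proof eventually_elim
    case (elim J)
    have "eventually (\<lambda>n. a \<le> real (length (walk J n)) / real n) sequentially"
      using elim(1) eventually_gt_at_top[of 0]
    proof eventually_elim
      case (elim n)
      then show ?case by (auto simp: less_nat_ceiling_iff field_simps)
    qed
    then show ?case by (intro tendsto_lowerbound[OF elim(2)]) auto
  qed
  then show ?thesis using a by (simp add: P.AE_const)
qed

end

section \<open>Bounds on the offspring generating function\<close>

lemma expectation_nat_pmf: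
  fixes f :: "nat \<Rightarrow> real"
  assumes "\<And>k. 0 \<le> f k" "summable (\<lambda>k. pmf \<mu> k * f k)"
  shows "measure_pmf.expectation \<mu> f = (\<Sum>k. pmf \<mu> k * f k)"
  unfolding measure_pmf_eq_density using assms
  by (subst integral_density) (auto intro!: integral_count_space_nat simp: integrable_count_space_nat_iff)

lemma hit_prob_sums:
  assumes "0 \<le> q" "q \<le> 1"
  shows "(\<lambda>k. pmf \<mu> k * (1 - (1 - q) ^ k)) sums hit_prob \<mu> q"
proof -
  have s: "summable (pmf \<mu>)"
    using integrable_pmf[of UNIV \<mu>] by (simp add: integrable_count_space_nat_iff)
  have b: "0 \<le> (1 - q) ^ k" "(1 - q) ^ k \<le> 1" for k using assms by (auto simp: power_le_one)
  have s2: "summable (\<lambda>k. pmf \<mu> k * (1 - (1 - q) ^ k))"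
    by (rule summable_comparison_test'[OF s]) (use b in \<open>auto simp: mult_left_le\<close>)
  have "hit_prob \<mu> q = measure_pmf.expectation \<mu> (\<lambda>k. 1 - (1 - q) ^ k)"
    unfolding hit_prob_def gfun_def using assms integrable_power_pmf[of "1 - q" \<mu>] by simp
  also have "\<dots> = (\<Sum>k. pmf \<mu> k * (1 - (1 - q) ^ k))"
    using b s2 by (intro expectation_nat_pmf) auto
  finally show ?thesis using s2 by (simp add: sums_iff)
qed

lemma hit_prob_le_mean:
  assumes "summable (\<lambda>k. real k * pmf \<mu> k)" "0 \<le> q" "q \<le> 1"
  shows "hit_prob \<mu> q \<le> (\<Sum>k. real k * pmf \<mu> k) * q"
proof -
  have "(\<lambda>k. real k * pmf \<mu> k * q) sums ((\<Sum>k. real k * pmf \<mu> k) * q)"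
    using assms(1) by (intro sums_mult2 summable_sums)
  from sums_le[OF _ hit_prob_sums[OF assms(2,3)] this] show ?thesis
  proof -
    have "1 - (1 - q) ^ k \<le> k * q" for k
      using Bernoulli_inequality[of "-q" k] assms by simp
    then have "pmf \<mu> k * (1 - (1 - q) ^ k) \<le> pmf \<mu> k * (k * q)" for k by (intro mult_left_mono) auto
    then show ?thesis using \<open>(\<And>n. pmf \<mu> n * (1 - (1 - q) ^ n) \<le> real n * pmf \<mu> n * q) \<Longrightarrow> _\<close> by (simp add: mult_ac)
  qed
qed

lemma power_one_minus_le:
  fixes q :: real
  assumes "0 \<le> q" "q \<le> 1"
  shows "(1 - q) ^ k \<le> 1 - k * q + (k * q)\<^sup>2"
proof (induction k)
  case (Suc k)
  have "(1 - q) ^ Suc k \<le> (1 - q) * (1 - k * q + (k * q)\<^sup>2)"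
    using Suc assms by (simp add: mult_left_mono)
  also have "\<dots> = 1 - Suc k * q + (k * q * q + (k * q)\<^sup>2 - q * (k * q)\<^sup>2)"
    by (simp add: algebra_simps power2_eq_square)
  also have "\<dots> \<le> 1 - Suc k * q + (Suc k * q)\<^sup>2"
    using assms by (simp add: algebra_simps power2_eq_square)
  finally show ?case .
qed simp

text \<open>The second moment of the offspring law may be infinite. The mean is therefore cut to
  finitely many terms that still exceed \<open>m'\<close>; their quadratic error
  \<open>B * q\<close> is absorbed by the surplus \<open>e\<close> when \<open>q\<close> is
  small.\<close>

lemma hit_prob_ge_linear:
  assumes "summable (\<lambda>k. real k * pmf \<mu> k)" "m' < (\<Sum>k. real k * pmf \<mu> k)"
  obtains q0 where "0 < q0" "q0 \<le> 1" "\<And>q. 0 \<le> q \<Longrightarrow> q \<le> q0 \<Longrightarrow> m' * q \<le> hit_prob \<mu> q"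
proof -
  have "(\<lambda>n. \<Sum>k<n. real k * pmf \<mu> k) \<longlonglongrightarrow> (\<Sum>k. real k * pmf \<mu> k)"
    using assms(1) by (rule summable_LIMSEQ)
  then have "eventually (\<lambda>n. m' < (\<Sum>k<n. real k * pmf \<mu> k)) sequentially"
    using assms(2) by (rule order_tendstoD)
  then obtain n where n: "m' < (\<Sum>k<n. real k * pmf \<mu> k)" by (auto simp: eventually_sequentially)
  define e where "e = (\<Sum>k<n. real k * pmf \<mu> k) - m'"
  define B where "B = (\<Sum>k<n. pmf \<mu> k * (real k)\<^sup>2)"
  have B: "0 \<le> B" unfolding B_def by (intro sum_nonneg) auto
  define q0 where "q0 = min 1 (e / (B + 1))"
  show thesis
  proof (rule that[of q0])
    show "0 < q0" "q0 \<le> 1" using n B by (auto simp: q0_def e_def)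
    fix q assume q: "0 \<le> q" "q \<le> q0"
    then have q1: "q \<le> 1" and qB: "q * B \<le> e"
    proof -
      show "q \<le> 1" using q by (simp add: q0_def)
      have "q * (B + 1) \<le> e" using q B by (simp add: q0_def field_simps)
      then show "q * B \<le> e" using q by (simp add: algebra_simps)
    qed
    have "m' * q \<le> ((\<Sum>k<n. real k * pmf \<mu> k) - q * B) * q"
      using qB q unfolding e_def by (intro mult_right_mono) auto
    also have "\<dots> = (\<Sum>k<n. pmf \<mu> k * (k * q - (k * q)\<^sup>2))"
      unfolding B_def by (simp add: algebra_simps sum_distrib_left sum_subtractf power2_eq_square)
    also have "\<dots> \<le> (\<Sum>k<n. pmf \<mu> k * (1 - (1 - q) ^ k))"
    proof (intro sum_mono mult_left_mono)
      show "real k * q - (real k * q)\<^sup>2 \<le> 1 - (1 - q) ^ k" for k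
        using power_one_minus_le[of q k] q q1 by simp
    qed auto
    also have "\<dots> \<le> hit_prob \<mu> q"
      using hit_prob_sums[OF q(1) q1, of \<mu>] q q1
      by (subst sums_unique[OF hit_prob_sums[OF q(1) q1]], intro sum_le_suminf) (auto simp: sums_iff power_le_one)
    finally show "m' * q \<le> hit_prob \<mu> q" .
  qed
qed

lemma power_tangent:
  fixes c q :: real
  assumes "0 \<le> c" "0 \<le> q"
  shows "c ^ k + k * c ^ (k - 1) * (q - c) \<le> q ^ k"
proof (induction k)
  case (Suc k)
  have "q * (c ^ k + k * c ^ (k - 1) * (q - c)) \<le> q ^ Suc k"
    using Suc assms by (simp add: mult_left_mono)
  moreover have "q * (c ^ k + k * c ^ (k - 1) * (q - c)) - (c ^ Suc k + Suc k * c ^ k * (q - c))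
     = k * c ^ (k - 1) * (q - c)\<^sup>2"
    by (cases k) (simp_all add: algebra_simps power2_eq_square)
  moreover have "0 \<le> k * c ^ (k - 1) * (q - c)\<^sup>2" using assms by simp
  ultimately show ?case by simp
qed simp

text \<open>Each power lies above its tangent at the mean \<open>?c\<close>, and the reflected
  operator preserves constants, so applying it to the tangent returns exactly
  \<open>?c ^ k\<close>.\<close>

lemma (in quenched) gfun_jensen:
  assumes "\<And>y. 0 \<le> \<phi> y" "\<And>y. \<phi> y \<le> 1"
  shows "gfun \<mu> (step_op True lam \<omega> \<phi> x) \<le> step_op True lam \<omega> (\<lambda>y. gfun \<mu> (\<phi> y)) x"
proof -
  let ?c = "step_op True lam \<omega> \<phi> x"
  have c: "0 \<le> ?c" "?c \<le> 1" using step_op_bounds[OF lam_pos deg_pos, of \<phi> 1] assms by auto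
  have "?c ^ k \<le> step_op True lam \<omega> (\<lambda>y. \<phi> y ^ k) x" for k
  proof -
    let ?t = "real k * ?c ^ (k - 1)"
    have "?c ^ k = step_op True lam \<omega> (\<lambda>y. (?c ^ k - ?t * ?c) + ?t * \<phi> y) x"
      unfolding step_op_add step_op_cmult by (subst step_op_const) (auto simp: lam_pos deg_pos)
    also have "\<dots> \<le> step_op True lam \<omega> (\<lambda>y. \<phi> y ^ k) x"
      using power_tangent[OF c(1) assms(1), of k] by (intro step_op_mono lam_pos) (auto simp: algebra_simps)
    finally show ?thesis .
  qed
  then have "gfun \<mu> ?c \<le> measure_pmf.expectation \<mu> (\<lambda>k. step_op True lam \<omega> (\<lambda>y. \<phi> y ^ k) x)"
    unfolding gfun_def using assms c
    by (intro integral_mono integral_step_op integrable_power_pmf) auto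
  also have "\<dots> = step_op True lam \<omega> (\<lambda>y. gfun \<mu> (\<phi> y)) x"
    unfolding gfun_def using assms by (intro integral_step_op integrable_power_pmf) auto
  finally show ?thesis .
qed

lemma gfun_one: "gfun \<mu> 1 = 1"
  by (simp add: gfun_def)

lemma gfun_le_quadratic:
  assumes "pmf \<mu> 0 = 0" "0 \<le> q" "q \<le> 1"
  shows "gfun \<mu> q \<le> pmf \<mu> 1 * q + (1 - pmf \<mu> 1) * q\<^sup>2"
proof -
  have i: "integrable (measure_pmf \<mu>) (\<lambda>k. of_bool (k = 1) :: real)"
    by (rule measure_pmf.integrable_const_bound[of _ 1]) auto
  have e: "measure_pmf.expectation \<mu> (\<lambda>k. of_bool (k = 1)) = pmf \<mu> 1"
    by (subst integral_measure_pmf_real[where A = "{1}"]) auto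
  have "gfun \<mu> q \<le> measure_pmf.expectation \<mu> (\<lambda>k. q\<^sup>2 + (q - q\<^sup>2) * of_bool (k = 1))"
    unfolding gfun_def
  proof (rule integral_mono_AE)
    show "AE k in measure_pmf \<mu>. q ^ k \<le> q\<^sup>2 + (q - q\<^sup>2) * of_bool (k = 1)"
    proof (rule AE_pmfI)
      fix k assume "k \<in> set_pmf \<mu>"
      then have "k \<noteq> 0" using assms(1) by (metis set_pmf_iff)
      then consider "k = 1" | "2 \<le> k" by linarith
      then show "q ^ k \<le> q\<^sup>2 + (q - q\<^sup>2) * of_bool (k = 1)"
        using assms by cases (auto simp: power_decreasing)
    qed
  qed (use assms i in \<open>auto intro: integrable_power_pmf\<close>)
  also have "\<dots> = q\<^sup>2 + (q - q\<^sup>2) * pmf \<mu> 1" using i e by simp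
  finally show ?thesis by (simp add: algebra_simps)
qed

lemma gfun_iterates_tendsto:
  assumes "pmf \<mu> 0 = 0" "pmf \<mu> 1 < 1" "0 \<le> q" "q < 1"
  shows "(\<lambda>k. (gfun \<mu> ^^ k) q) \<longlonglongrightarrow> 0"
proof -
  \<comment> \<open>The quadratic bound gives \<open>gfun \<mu> r \<le> c * r\<close> for
    \<open>0 \<le> r \<le> q\<close>, so the iterates decay geometrically.\<close>
  define c where "c = pmf \<mu> 1 + (1 - pmf \<mu> 1) * q"
  have c: "0 \<le> c" "c < 1"
  proof -
    have "(1 - pmf \<mu> 1) * q < (1 - pmf \<mu> 1) * 1" using assms by (intro mult_strict_left_mono) auto
    then show "c < 1" unfolding c_def by (simp add: algebra_simps)
    show "0 \<le> c" using assms unfolding c_def by (intro add_nonneg_nonneg mult_nonneg_nonneg) auto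
  qed
  have *: "0 \<le> (gfun \<mu> ^^ k) q \<and> (gfun \<mu> ^^ k) q \<le> c ^ k * q" for k
  proof (induction k)
    case (Suc k)
    let ?r = "(gfun \<mu> ^^ k) q"
    have "c ^ k * q \<le> q" using c assms by (simp add: mult_left_le_one_le power_le_one)
    then have r: "0 \<le> ?r" "?r \<le> q" "?r \<le> 1" using Suc assms by auto
    have "gfun \<mu> ?r \<le> (pmf \<mu> 1 + (1 - pmf \<mu> 1) * ?r) * ?r"
      using gfun_le_quadratic[OF assms(1) r(1,3)] by (simp add: algebra_simps power2_eq_square)
    also have "\<dots> \<le> c * ?r" unfolding c_def using r
      by (intro mult_right_mono add_left_mono mult_left_mono) (auto simp: pmf_le_1)
    also have "\<dots> \<le> c * (c ^ k * q)" using Suc c by (intro mult_left_mono) auto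
    finally show ?case using gfun_bounds[OF r(1,3)] by (simp add: mult.assoc)
  qed (use assms in auto)
  have "(\<lambda>k. c ^ k * q) \<longlonglongrightarrow> 0" using c by (intro tendsto_mult_left_zero LIMSEQ_power_zero) auto
  then show "(\<lambda>k. (gfun \<mu> ^^ k) q) \<longlonglongrightarrow> 0"
    by (rule tendsto_sandwich[of "\<lambda>_. 0" "\<lambda>k. (gfun \<mu> ^^ k) q" sequentially "\<lambda>k. c ^ k * q" 0, rotated 3])
       (simp_all only: * always_eventually simp_thms tendsto_const)
qed

text \<open>First moment bound: the constraint binds only in the last generation, and each
  generation costs a factor equal to the offspring mean by \<open>hit_prob_le_mean\<close>.\<close>

lemma (in quenched) sv_last_le:
  assumes "summable (\<lambda>k. real k * pmf \<mu> k)"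
  shows "sv \<mu> (step_op True lam \<omega>) n (\<lambda>i y. i < n \<or> length y < l) x \<le> (\<Sum>k. real k * pmf \<mu> k) ^ n * stay l n x"
proof (induction n arbitrary: x)
  case (Suc n)
  let ?K = "step_op True lam \<omega>" and ?m = "\<Sum>k. real k * pmf \<mu> k"
  let ?s = "sv \<mu> ?K n (\<lambda>i y. i < n \<or> length y < l)"
  have m: "0 \<le> ?m" using assms by (intro suminf_nonneg) auto
  have b: "0 \<le> ?K ?s x" "?K ?s x \<le> 1"
    using step_op_bounds[OF lam_pos deg_pos, of ?s 1] sv_bounds[OF lam_pos deg_pos] by auto
  have "hit_prob \<mu> (?K ?s x) \<le> ?m * ?K ?s x"
    using hit_prob_le_mean[OF assms b] .
  also have "\<dots> \<le> ?m * ?K (\<lambda>y. ?m ^ n * stay l n y) x"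
    using m Suc lam_pos by (intro mult_left_mono step_op_mono) auto
  finally have "hit_prob \<mu> (?K ?s x) \<le> ?m ^ Suc n * ?K (stay l n) x"
    unfolding step_op_cmult by simp
  then show ?case by (simp add: stay_Suc)
qed (simp add: stay_0)

section \<open>Lines of descent and the minimal displacement\<close>

primrec traj :: "(nat list \<times> nat list \<Rightarrow> nat list) \<Rightarrow> nat list \<Rightarrow> nat list \<Rightarrow> nat \<Rightarrow> nat list" where
  "traj J x u 0 = x"
| "traj J x u (Suc k) = J (take (Suc k) u, traj J x u k)"

lemma traj_root: "traj J [] u k = brw_pos_aux J u k"
  by (induction k) auto

text \<open>Deleting the first label moves the starting point, which is why \<open>traj\<close> has
  a free start \<open>x\<close> where \<open>brw_pos_aux\<close> starts at the root.\<close>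

lemma traj_Cons: "traj J x (i # u) (Suc k) = traj (\<lambda>z. J (i # fst z, snd z)) (J ([i], x)) u k"
  by (induction k) auto

lemma in_genealogy_Nil: "in_genealogy N []"
  by (simp add: in_genealogy_def)

lemma in_genealogy_Cons: "in_genealogy N (i # u) \<longleftrightarrow> i < N [] \<and> in_genealogy (\<lambda>w. N (i # w)) u"
  unfolding in_genealogy_def by (auto simp: All_less_Suc2)

lemma surv_iff:
  "surv j Q N J x \<longleftrightarrow> (\<exists>u. length u = j \<and> in_genealogy N u \<and> (\<forall>i\<le>j. Q i (traj J x u i)))"
proof (induction j arbitrary: Q N J x)
  case (Suc j)
  have "(\<exists>u. length u = Suc j \<and> in_genealogy N u \<and> (\<forall>k\<le>Suc j. Q k (traj J x u k)))
    \<longleftrightarrow> (\<exists>i u. length u = j \<and> in_genealogy N (i # u) \<and> (\<forall>k\<le>Suc j. Q k (traj J x (i # u) k)))"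
    by (auto simp: length_Suc_conv)
  also have "\<dots> \<longleftrightarrow> surv (Suc j) Q N J x"
    by (simp add: Suc in_genealogy_Cons All_less_Suc2 less_Suc_eq_le[symmetric] traj_Cons del: traj.simps(2)) auto
  finally show ?case by simp
qed (auto simp: in_genealogy_Nil)

text \<open>Together with \<open>genealogy_nonempty\<close> this makes the \<open>Min\<close> in
  \<open>min_disp\<close> an attained minimum.\<close>

lemma finite_genealogy: "finite {u. in_genealogy N u \<and> length u = n}"
proof (induction n arbitrary: N)
  case (Suc n)
  have "{u. in_genealogy N u \<and> length u = Suc n} = (\<Union>i<N []. (#) i ` {u. in_genealogy (\<lambda>w. N (i # w)) u \<and> length u = n})"
    by (auto simp: length_Suc_conv in_genealogy_Cons image_iff)
  then show ?case using Suc by auto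
qed simp

lemma genealogy_nonempty: "(\<And>u. 0 < N u) \<Longrightarrow> \<exists>u. in_genealogy N u \<and> length u = n"
  by (rule exI[of _ "replicate n 0"]) (auto simp: in_genealogy_def)

lemma min_disp_le:
  fixes C a :: real
  assumes "surv n (\<lambda>i y. real (length y) \<le> C + a * i) N J []"
  shows "min_disp N J n \<le> C + a * n"
proof -
  obtain u where u: "length u = n" "in_genealogy N u" "real (length (brw_pos_aux J u n)) \<le> C + a * n"
    using assms unfolding surv_iff traj_root by auto
  have "min_disp N J n \<le> length (brw_pos J u)" unfolding min_disp_def
    using u finite_genealogy[of N n] by (intro Min_le) (auto simp: setcompr_eq_image)
  then show ?thesis using u by (simp add: brw_pos_def)
qed

lemma surv_of_min_disp_less:
  assumes "\<And>u. 0 < N u" "min_disp N J n < l"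
  shows "surv n (\<lambda>i y. i < n \<or> length y < l) N J []"
proof -
  have "min_disp N J n \<in> {length (brw_pos J u) | u. in_genealogy N u \<and> length u = n}"
    unfolding min_disp_def using finite_genealogy[of N n] genealogy_nonempty[OF assms(1), where n = n]
    by (intro Min_in) (auto simp: setcompr_eq_image)
  then obtain u where u: "in_genealogy N u" "length u = n" "length (brw_pos_aux J u n) < l"
    using assms(2) by (auto simp: brw_pos_def)
  have "i < n \<or> length (brw_pos_aux J u i) < l" if "i \<le> n" for i
    using that u(3) by (cases "i = n") auto
  with u(1,2) show ?thesis unfolding surv_iff traj_root by blast
qed

section \<open>Killed walks in a fixed environment\<close>

text \<open>Expected \<open>\<beta>\<close>-value at the first visit to level \<open>l\<close>, on the event that it occurs at time \<open>s\<close>, for the killed walk.\<close>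

primrec hit :: "real \<Rightarrow> (nat list \<Rightarrow> nat) \<Rightarrow> nat \<Rightarrow> (nat list \<Rightarrow> real) \<Rightarrow> nat \<Rightarrow> nat list \<Rightarrow> real" where
  "hit lam \<omega> l \<beta> 0 x = (if length x = l then \<beta> x else 0)"
| "hit lam \<omega> l \<beta> (Suc s) x = (if length x < l then step_op False lam \<omega> (hit lam \<omega> l \<beta> s) x else 0)"

text \<open>Probability that the killed walk started at \<open>x\<close> is at the root at time
  \<open>t\<close> without having left the levels up to \<open>H\<close>.\<close>

primrec loop :: "real \<Rightarrow> (nat list \<Rightarrow> nat) \<Rightarrow> nat \<Rightarrow> nat \<Rightarrow> nat list \<Rightarrow> real" where
  "loop lam \<omega> H 0 x = of_bool (x = [])"
| "loop lam \<omega> H (Suc t) x = (if length x \<le> H then step_op False lam \<omega> (loop lam \<omega> H t) x else 0)"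

text \<open>A linear boundary is stable under the two shifts in use: advancing one generation raises
  \<open>C\<close> by \<open>a\<close>, see \<open>slow_Suc\<close>, and entering the subtree at
  \<open>z\<close> raises it by \<open>length z\<close>, see \<open>sv_shift\<close>.\<close>

definition slow :: "real \<Rightarrow> real \<Rightarrow> nat \<Rightarrow> nat list \<Rightarrow> bool" where
  "slow a C i y \<longleftrightarrow> real (length y) \<le> C + a * real i"

lemma slow_Suc: "(\<lambda>k. slow a C (Suc k)) = slow a (C + a)"
  by (auto simp: slow_def fun_eq_iff algebra_simps)

lemma slow_0: "slow a C 0 x \<longleftrightarrow> real (length x) \<le> C"
  by (simp add: slow_def)

lemma hit_nonneg: "0 < lam \<Longrightarrow> (\<And>x. 0 \<le> \<beta> x) \<Longrightarrow> 0 \<le> hit lam \<omega> l \<beta> s x"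
  by (induction s arbitrary: x) (auto intro: step_op_nonneg)

lemma hit_le:
  assumes "0 < lam" "\<And>x. 0 < \<omega> x" "\<And>x. 0 \<le> \<beta> x" "\<And>x. \<beta> x \<le> c"
  shows "hit lam \<omega> l \<beta> s x \<le> c"
proof (induction s arbitrary: x)
  case 0
  show ?case using assms(3,4)[of x] by simp
next
  case (Suc s)
  then show ?case using step_op_bounds(2)[OF assms(1,2), of "hit lam \<omega> l \<beta> s" c] hit_nonneg[of lam \<beta>] assms(1,3)
      order_trans[OF assms(3,4)] by auto
qed

lemma hit_add: "hit lam \<omega> l (\<lambda>x. \<beta> x + \<beta>' x) s x = hit lam \<omega> l \<beta> s x + hit lam \<omega> l \<beta>' s x"
proof (induction s arbitrary: x)
  case (Suc s)
  then have "hit lam \<omega> l (\<lambda>x. \<beta> x + \<beta>' x) s = (\<lambda>x. hit lam \<omega> l \<beta> s x + hit lam \<omega> l \<beta>' s x)" by auto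
  then show ?case by (simp add: step_op_add)
qed simp

lemma hit_cmult: "hit lam \<omega> l (\<lambda>x. c * \<beta> x) s x = c * hit lam \<omega> l \<beta> s x"
proof (induction s arbitrary: x)
  case (Suc s)
  then have "hit lam \<omega> l (\<lambda>x. c * \<beta> x) s = (\<lambda>x. c * hit lam \<omega> l \<beta> s x)" by auto
  then show ?case by (simp add: step_op_cmult)
qed simp

lemma loop_nonneg: "0 < lam \<Longrightarrow> 0 \<le> loop lam \<omega> H t x"
  by (induction t arbitrary: x) (auto intro: step_op_nonneg)

lemma loop_mono: "0 < lam \<Longrightarrow> H \<le> H' \<Longrightarrow> loop lam \<omega> H t x \<le> loop lam \<omega> H' t x"
proof (induction t arbitrary: x)
  case (Suc t)
  then show ?case by (auto intro: step_op_mono step_op_nonneg loop_nonneg)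
qed simp

text \<open>In the subtree the operators can differ only at its root, where the killed one drops the
  step to the parent of \<open>z\<close>, a nonnegative term. In return the left side depends on the
  environment of the subtree alone.\<close>

lemma step_op_shift:
  assumes "0 < lam" "\<And>x. 0 < \<omega> x" "\<And>y. 0 \<le> \<phi> y"
  shows "step_op False lam (\<lambda>w. \<omega> (z @ w)) (\<lambda>w. \<phi> (z @ w)) w \<le> step_op b lam \<omega> \<phi> (z @ w)"
proof -
  have "step_op False lam (\<lambda>w. \<omega> (z @ w)) (\<lambda>w. \<phi> (z @ w)) w \<le> step_op False lam \<omega> \<phi> (z @ w)"
    using assms by (auto simp: step_op_def butlast_append)
  also have "\<dots> \<le> step_op b lam \<omega> \<phi> (z @ w)"
    using assms by (cases b) (auto intro: step_op_kill_le)
  finally show ?thesis .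
qed

lemma hit_shift:
  assumes "0 < lam" "\<And>x. 0 < \<omega> x" "\<And>y. 0 \<le> \<beta> y"
  shows "hit lam (\<lambda>w. \<omega> (i # w)) l (\<lambda>w. \<beta> (i # w)) s w \<le> hit lam \<omega> (Suc l) \<beta> s (i # w)"
proof (induction s arbitrary: w)
  case (Suc s)
  have "step_op False lam (\<lambda>w. \<omega> (i # w)) (hit lam (\<lambda>w. \<omega> (i # w)) l (\<lambda>w. \<beta> (i # w)) s) w
    \<le> step_op False lam (\<lambda>w. \<omega> (i # w)) (\<lambda>w. hit lam \<omega> (Suc l) \<beta> s (i # w)) w"
    using assms Suc by (intro step_op_mono) auto
  also have "\<dots> \<le> step_op False lam \<omega> (hit lam \<omega> (Suc l) \<beta> s) (i # w)"
    using step_op_shift[of lam \<omega> "hit lam \<omega> (Suc l) \<beta> s" "[i]" w False] assms by (simp add: hit_nonneg)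
  finally show ?case by simp
qed simp

text \<open>The factor is the probability of one more step at the end, from \<open>[i]\<close> up to
  the root; it accounts for the extra unit of time and of height.\<close>

lemma loop_shift:
  assumes "0 < lam" "\<And>x. 0 < \<omega> x"
  shows "lam / (lam + \<omega> [i]) * loop lam (\<lambda>w. \<omega> (i # w)) H t w \<le> loop lam \<omega> (Suc H) (Suc t) (i # w)"
proof (induction t arbitrary: w)
  case 0
  show ?case using assms by (auto simp: step_op_def intro!: divide_nonneg_nonneg sum_nonneg mult_nonneg_nonneg add_nonneg_nonneg)
next
  case (Suc t)
  let ?c = "lam / (lam + \<omega> [i])"
  show ?case
  proof (cases "length w \<le> H")
    case True
    have "?c * step_op False lam (\<lambda>w. \<omega> (i # w)) (loop lam (\<lambda>w. \<omega> (i # w)) H t) w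
      = step_op False lam (\<lambda>w. \<omega> (i # w)) (\<lambda>w. ?c * loop lam (\<lambda>w. \<omega> (i # w)) H t w) w"
      by (rule step_op_cmult[symmetric])
    also have "\<dots> \<le> step_op False lam (\<lambda>w. \<omega> (i # w)) (\<lambda>w. loop lam \<omega> (Suc H) (Suc t) (i # w)) w"
      by (intro step_op_mono assms Suc)
    also have "\<dots> \<le> step_op False lam \<omega> (loop lam \<omega> (Suc H) (Suc t)) (i # w)"
      using step_op_shift[of lam \<omega> "loop lam \<omega> (Suc H) (Suc t)" "[i]" w False] assms loop_nonneg[OF assms(1)] by (simp del: loop.simps)
    finally show ?thesis using True by (simp del: loop.simps add: loop.simps(2)[of _ _ _ "Suc t"] loop.simps(2)[of _ "\<lambda>w. \<omega> (i # w)"])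
  next
    case False
    then show ?thesis using loop_nonneg[OF assms(1), of \<omega> "Suc H" "Suc (Suc t)" "i # w"] by (simp del: loop.simps add: loop.simps(2)[of _ "\<lambda>w. \<omega> (i # w)"])
  qed
qed

lemma step_op_root_ge:
  assumes "0 < lam" "0 < \<omega> []" "\<And>y. 0 \<le> \<phi> y" "i < \<omega> []"
  shows "\<phi> [i] / (lam + \<omega> []) \<le> step_op False lam \<omega> \<phi> []"
proof -
  have "\<phi> [i] \<le> (\<Sum>i<\<omega> []. \<phi> [i])" using assms by (intro member_le_sum) auto
  then show ?thesis using assms by (auto simp: step_op_def intro: divide_right_mono)
qed

text \<open>Concatenation of a path from \<open>x\<close> to the root with a hitting path from the
  root. As \<open>H < L\<close>, the first piece does not reach level \<open>L\<close>, so the first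
  visit is not anticipated.\<close>

lemma loop_hit:
  assumes "0 < lam" "\<And>x. 0 < \<omega> x" "\<And>y. 0 \<le> \<beta> y" "H < L"
  shows "loop lam \<omega> H t x * hit lam \<omega> L \<beta> u [] \<le> hit lam \<omega> L \<beta> (t + u) x"
proof (induction t arbitrary: x)
  case 0
  show ?case using assms by (simp add: hit_nonneg)
next
  case (Suc t)
  have "hit lam \<omega> L \<beta> u [] * loop lam \<omega> H t y \<le> hit lam \<omega> L \<beta> (t + u) y" for y
    using Suc[of y] by (simp add: mult.commute)
  then have "hit lam \<omega> L \<beta> u [] * step_op False lam \<omega> (loop lam \<omega> H t) x \<le> step_op False lam \<omega> (hit lam \<omega> L \<beta> (t + u)) x"
    unfolding step_op_cmult[symmetric] by (intro step_op_mono assms)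
  then show ?case using assms by (auto simp: hit_nonneg step_op_nonneg mult.commute)
qed

text \<open>Traps: return probabilities of the killed walk decay no faster than \<open>\<gamma> ^ (2 * k)\<close>, even within the first \<open>H\<close>
  levels. The constant is also \<open>H\<close>, so that the property is monotone in \<open>H\<close>.\<close>

definition recur :: "real \<Rightarrow> real \<Rightarrow> nat \<Rightarrow> (nat list \<Rightarrow> nat) \<Rightarrow> bool" where
  "recur lam \<gamma> H \<omega> \<longleftrightarrow> (\<forall>k. \<gamma> ^ (2 * k) \<le> H * loop lam \<omega> H (2 * k) [])"

lemma recur_mono: "0 < lam \<Longrightarrow> H \<le> H' \<Longrightarrow> recur lam \<gamma> H \<omega> \<Longrightarrow> recur lam \<gamma> H' \<omega>"
  unfolding recur_def using loop_mono loop_nonneg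
  by (meson mult_mono of_nat_0_le_iff of_nat_mono order_trans)

lemma recurI:
  assumes "0 < lam" "0 < c" "\<And>k. c * \<gamma> ^ (2 * k) \<le> loop lam \<omega> H (2 * k) []"
  shows "\<exists>H'. recur lam \<gamma> H' \<omega>"
proof (intro exI)
  let ?H = "max H (nat \<lceil>1 / c\<rceil>)"
  show "recur lam \<gamma> ?H \<omega>"
    unfolding recur_def
  proof
    fix k
    have "\<gamma> ^ (2 * k) = 1 / c * (c * \<gamma> ^ (2 * k))" using assms by simp
    also have "\<dots> \<le> ?H * loop lam \<omega> H (2 * k) []"
    proof (intro mult_mono assms)
      show "1 / c \<le> real ?H" using real_nat_ceiling_ge[of "1 / c"] by linarith
    qed (use assms in \<open>auto simp: zero_le_even_power\<close>)
    also have "\<dots> \<le> ?H * loop lam \<omega> ?H (2 * k) []" using assms by (intro mult_left_mono loop_mono) auto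
    finally show "\<gamma> ^ (2 * k) \<le> ?H * loop lam \<omega> ?H (2 * k) []" .
  qed
qed

text \<open>A loop at the root is made of a step to \<open>[i]\<close>, a loop in the trap there and
  a step back. It is two steps longer than the inner loop, which affects only the constant.\<close>

lemma recur_sub:
  assumes "0 < lam" "\<And>x. 0 < \<omega> x" "i < \<omega> []" "recur lam \<gamma> H (\<lambda>w. \<omega> (i # w))" "0 < \<gamma>" "\<gamma> \<le> 1"
  shows "\<exists>H'. recur lam \<gamma> H' \<omega>"
proof -
  let ?c = "lam / (lam + \<omega> [i])" and ?e = "1 / (lam + \<omega> [])"
  have H: "0 < H" using assms(4) unfolding recur_def by (auto dest: spec[of _ 0] intro: gr0I)
  have c: "0 < ?c" "?c \<le> 1" "0 < ?e" using assms by (auto intro: add_pos_nonneg)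
  \<comment> \<open>The minimum with 1 covers \<open>k = 0\<close>, where there is no room for the
    two additional steps.\<close>
  have e: "min 1 (?e * ?c / H) * \<gamma> ^ (2 * k) \<le> loop lam \<omega> (Suc H) (2 * k) []" for k
  proof (cases k)
    case 0
    then show ?thesis by simp
  next
    case (Suc j)
    have g: "0 \<le> \<gamma> ^ (2 * k)" "\<gamma> ^ (2 * k) \<le> \<gamma> ^ (2 * j)"
      using assms Suc power_decreasing[of "2 * j" "2 * k" \<gamma>] by auto
    have "\<gamma> ^ (2 * j) / H \<le> loop lam (\<lambda>w. \<omega> (i # w)) H (2 * j) []"
      using assms(4) H unfolding recur_def by (simp add: divide_le_eq mult.commute)
    then have "?c * (\<gamma> ^ (2 * j) / H) \<le> ?c * loop lam (\<lambda>w. \<omega> (i # w)) H (2 * j) []"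
      using c by (intro mult_left_mono) auto
    also have "\<dots> \<le> loop lam \<omega> (Suc H) (Suc (2 * j)) [i]" by (rule loop_shift) (use assms in auto)
    finally have "?e * (?c * (\<gamma> ^ (2 * j) / H)) \<le> ?e * loop lam \<omega> (Suc H) (Suc (2 * j)) [i]"
      using c by (intro mult_left_mono) auto
    also have "\<dots> \<le> loop lam \<omega> (Suc H) (Suc (Suc (2 * j))) []"
      using step_op_root_ge[of lam \<omega> "loop lam \<omega> (Suc H) (Suc (2 * j))" i] assms loop_nonneg[OF assms(1)]
      by (subst loop.simps(2)) (simp del: loop.simps)
    finally have 1: "?e * ?c / H * \<gamma> ^ (2 * j) \<le> loop lam \<omega> (Suc H) (2 * k) []" using Suc by (simp del: loop.simps)
    have "min 1 (?e * ?c / H) * \<gamma> ^ (2 * k) \<le> ?e * ?c / H * \<gamma> ^ (2 * j)"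
    proof (intro mult_mono g)
      show "0 \<le> ?e * ?c / H"
        by (intro divide_nonneg_nonneg mult_nonneg_nonneg less_imp_le[OF c(3)] less_imp_le[OF c(1)]) simp
    qed simp
    with 1 show ?thesis by linarith
  qed
  have "0 < ?e * ?c / H" by (intro divide_pos_pos mult_pos_pos c) (use H in simp)
  then have "0 < min 1 (?e * ?c / H)" by simp
  then show ?thesis using recurI[OF assms(1) _ e] by blast
qed

section \<open>Monotonicity and restriction of survival probabilities\<close>

lemma sv_slow_mono:
  assumes "0 < lam" "\<And>x. 0 < \<omega> x" "C \<le> C'"
  shows "sv \<mu> (step_op b lam \<omega>) j (slow a C) x \<le> sv \<mu> (step_op b lam \<omega>) j (slow a C') x"
  using assms(3)
proof (induction j arbitrary: C C' x)
  case (Suc j)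
  let ?K = "step_op b lam \<omega>"
  have B: "0 \<le> ?K (sv \<mu> ?K j (slow a c)) x" "?K (sv \<mu> ?K j (slow a c)) x \<le> 1" for c
    using step_op_bounds[OF assms(1,2), of "sv \<mu> ?K j (slow a c)" 1] sv_bounds[OF assms(1,2)] by auto
  have "?K (sv \<mu> ?K j (slow a (C + a))) x \<le> ?K (sv \<mu> ?K j (slow a (C' + a))) x"
    using Suc by (intro step_op_mono assms) auto
  then have "hit_prob \<mu> (?K (sv \<mu> ?K j (slow a (C + a))) x) \<le> hit_prob \<mu> (?K (sv \<mu> ?K j (slow a (C' + a))) x)"
    using B by (intro hit_prob_mono)
  then show ?case using Suc.prems B hit_prob_bounds by (auto simp: slow_Suc slow_0)
qed (auto simp: slow_0)

lemma sv_decreasing: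
  assumes "0 < lam" "\<And>x. 0 < \<omega> x"
  shows "sv \<mu> (step_op b lam \<omega>) (Suc j) Q x \<le> sv \<mu> (step_op b lam \<omega>) j Q x"
proof (induction j arbitrary: Q x)
  case 0
  show ?case using sv_bounds[OF assms, where j = "Suc 0" and Q = Q and x = x and b = b and \<mu> = \<mu>] by (cases "Q 0 x") auto
next
  case (Suc j)
  let ?K = "step_op b lam \<omega>" and ?Q = "\<lambda>k. Q (Suc k)"
  have B: "0 \<le> ?K (sv \<mu> ?K j ?Q) x" "?K (sv \<mu> ?K j ?Q) x \<le> 1" for j
    using step_op_bounds[OF assms, of "sv \<mu> ?K j ?Q" 1] sv_bounds[OF assms] by auto
  have "?K (sv \<mu> ?K (Suc j) ?Q) x \<le> ?K (sv \<mu> ?K j ?Q) x"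
    by (intro step_op_mono assms Suc)
  then have "hit_prob \<mu> (?K (sv \<mu> ?K (Suc j) ?Q) x) \<le> hit_prob \<mu> (?K (sv \<mu> ?K j ?Q) x)"
    using B by (intro hit_prob_mono)
  then show ?case unfolding sv.simps(2)[of _ _ "Suc j"] sv.simps(2)[of _ _ j Q] by (intro mult_left_mono) auto
qed

lemma sv_antimono:
  assumes "0 < lam" "\<And>x. 0 < \<omega> x" "i \<le> j"
  shows "sv \<mu> (step_op b lam \<omega>) j Q x \<le> sv \<mu> (step_op b lam \<omega>) i Q x"
proof (rule lift_Suc_antimono_le[where f = "\<lambda>j. sv \<mu> (step_op b lam \<omega>) j Q x", OF _ assms(3)])
  show "sv \<mu> (step_op b lam \<omega>) (Suc k) Q x \<le> sv \<mu> (step_op b lam \<omega>) k Q x" for k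
    by (rule sv_decreasing) (use assms in auto)
qed

lemma sv_shift:
  assumes "0 < lam" "\<And>x. 0 < \<omega> x"
  shows "sv \<mu> (step_op False lam (\<lambda>w. \<omega> (z @ w))) j (slow a C) w
    \<le> sv \<mu> (step_op b lam \<omega>) j (slow a (C + length z)) (z @ w)"
proof (induction j arbitrary: C w)
  case (Suc j)
  let ?K = "step_op False lam (\<lambda>w. \<omega> (z @ w))" and ?L = "step_op b lam \<omega>"
  let ?f = "sv \<mu> ?K j (slow a (C + a))" and ?g = "sv \<mu> ?L j (slow a (C + length z + a))"
  have "?K ?f w \<le> ?K (\<lambda>w. ?g (z @ w)) w"
    using Suc[of "C + a"] by (intro step_op_mono assms) (auto simp: algebra_simps)
  also have "\<dots> \<le> ?L ?g (z @ w)"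
    using sv_bounds[OF assms] by (intro step_op_shift assms) auto
  finally have "?K ?f w \<le> ?L ?g (z @ w)" .
  moreover have "0 \<le> ?K ?f w" "?L ?g (z @ w) \<le> 1"
    using step_op_bounds[of lam _ _ ?f 1 False] step_op_bounds[of lam _ _ ?g 1 b] assms
      sv_bounds[of lam "\<lambda>w. \<omega> (z @ w)"] sv_bounds[of lam \<omega>] by auto
  ultimately have "hit_prob \<mu> (?K ?f w) \<le> hit_prob \<mu> (?L ?g (z @ w))" by (intro hit_prob_mono)
  then show ?case by (auto simp: slow_Suc slow_0)
qed (auto simp: slow_0)

section \<open>Reflected and killed walks, traps and blocks\<close>

text \<open>Bookkeeping for arrivals at level \<open>l\<close>: the walk needs time
  \<open>s\<close>, waiting in a trap for the missing time costs \<open>\<gamma> ^ (n - s)\<close>,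
  and \<open>m ^ max n s\<close> is the mean population at the end. Truncated subtraction lets
  arrivals after time \<open>n\<close> pass free of charge.\<close>

definition wgt :: "real \<Rightarrow> (nat list \<Rightarrow> nat) \<Rightarrow> real \<Rightarrow> real \<Rightarrow> nat \<Rightarrow> nat \<Rightarrow> nat \<Rightarrow> (nat list \<Rightarrow> real) \<Rightarrow> real" where
  "wgt lam \<omega> m \<gamma> l n N \<beta> = (\<Sum>s\<le>N. m ^ max n s * \<gamma> ^ (n - s) * hit lam \<omega> l \<beta> s [])"

section \<open>Comparison of the reflected walk with the killed walk\<close>

context biased begin

text \<open>With exactly \<open>d\<close> children everywhere, \<open>1 - (lam / d) ^ Suc n\<close>
  is the gambler's ruin probability of escaping from level \<open>n\<close> before being killed
  above the root. Larger degrees only favour escape.\<close>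

lemma escape_subharmonic:
  "1 - (ratio\<^sup>2) ^ Suc (length x) \<le> step_op False lam \<omega> (\<lambda>y. 1 - (ratio\<^sup>2) ^ Suc (length y)) x"
proof -
  let ?r = "ratio\<^sup>2" and ?k = "real (\<omega> x)"
  have r: "0 < ?r" "?r < 1" using ratio_pos ratio_less by (auto simp: power_less_one_iff)
  have k: "lam \<le> ?k * ?r"
    using deg_ge[of x] lam_pos d_ge by (simp add: ratio_sq field_simps)
  have lk: "0 < lam + ?k" using lam_pos by simp
  show ?thesis
  proof (cases "x = []")
    case True
    have "(1 - ?r) * lam \<le> (1 - ?r) * (?k * ?r)" using k r by (intro mult_left_mono) auto
    then have "(1 - ?r) * (lam + ?k) \<le> ?k * (1 - ?r\<^sup>2)"
      by (simp add: algebra_simps power2_eq_square)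
    then have "1 - ?r \<le> ?k * (1 - ?r\<^sup>2) / (lam + ?k)" using lk by (simp add: pos_le_divide_eq)
    then show ?thesis using True by (simp add: step_op_def power2_eq_square)
  next
    case False
    then obtain n where n: "length x = Suc n" by (cases x) auto
    have "(1 - ?r) * lam \<le> (1 - ?r) * (?k * ?r)" using k r by (intro mult_left_mono) auto
    then have "lam + ?k * ?r\<^sup>2 \<le> (lam + ?k) * ?r"
      by (simp add: algebra_simps power2_eq_square)
    then have "(lam + ?k * ?r\<^sup>2) * ?r ^ Suc n \<le> (lam + ?k) * ?r * ?r ^ Suc n"
      using r by (intro mult_right_mono) auto
    then have "(lam + ?k) * (1 - ?r ^ Suc (Suc n)) \<le> lam * (1 - ?r ^ Suc n) + ?k * (1 - ?r ^ Suc (Suc (Suc n)))"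
      by (simp add: algebra_simps power2_eq_square)
    then have "1 - ?r ^ Suc (Suc n) \<le> (lam * (1 - ?r ^ Suc n) + ?k * (1 - ?r ^ Suc (Suc (Suc n)))) / (lam + ?k)"
      using lk by (simp only: pos_le_divide_eq mult.commute)
    then show ?thesis using False n by (simp add: step_op_def add_divide_distrib del: power_Suc)
  qed
qed

text \<open>Escape requires a visit to level \<open>l\<close>. The last term bounds the chance that
  within \<open>j\<close> steps the walk is neither killed nor at level \<open>l\<close>; it is the
  supersolution, normalised to be at least 1 up to that level.\<close>

lemma escape_le_hit:
  assumes "length x \<le> l"
  shows "1 - (ratio\<^sup>2) ^ Suc (length x) \<le> (\<Sum>s\<le>j. hit lam \<omega> l (\<lambda>_. 1) s x) + rho ^ j * ratio ^ length x / ratio ^ l"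
  using assms
proof (induction j arbitrary: x)
  case 0
  have "1 \<le> ratio ^ length x / ratio ^ l"
    using 0 ratio_pos ratio_less by (simp add: le_divide_eq power_decreasing)
  moreover have "0 \<le> (ratio\<^sup>2) ^ Suc (length x)" by simp
  moreover have "0 \<le> hit lam \<omega> l (\<lambda>_. 1) 0 x" by simp
  moreover have "(\<Sum>s\<le>0. hit lam \<omega> l (\<lambda>_. 1) s x) + rho ^ 0 * ratio ^ length x / ratio ^ l
    = hit lam \<omega> l (\<lambda>_. 1) 0 x + ratio ^ length x / ratio ^ l" by (simp del: hit.simps)
  ultimately show ?case by linarith
next
  case (Suc j)
  let ?A = "\<lambda>s. hit lam \<omega> l (\<lambda>_. 1) s" and ?K = "step_op False lam \<omega>"
  have p: "0 \<le> rho ^ Suc j * ratio ^ length x / ratio ^ l" using rho_pos ratio_pos by simp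
  show ?case
  proof (cases "length x = l")
    case True
    have "1 \<le> (\<Sum>s\<le>Suc j. ?A s x)"
      unfolding sum.atMost_Suc_shift using True by simp
    moreover have "0 \<le> (ratio\<^sup>2) ^ Suc (length x)" by simp
    ultimately show ?thesis using p by linarith
  next
    case False
    with Suc.prems have lt: "length x < l" by simp
    have "1 - (ratio\<^sup>2) ^ Suc (length x) \<le> ?K (\<lambda>y. 1 - (ratio\<^sup>2) ^ Suc (length y)) x"
      by (rule escape_subharmonic)
    also have "\<dots> \<le> ?K (\<lambda>y. (\<Sum>s\<le>j. ?A s y) + (rho ^ j / ratio ^ l) * ratio ^ length y) x"
    proof (rule step_op_mono_level[OF lam_pos])
      fix y :: "nat list" assume "length y \<le> Suc (length x)"
      then show "1 - (ratio\<^sup>2) ^ Suc (length y) \<le> (\<Sum>s\<le>j. ?A s y) + (rho ^ j / ratio ^ l) * ratio ^ length y"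
        using Suc.IH[of y] lt by simp
    qed
    also have "\<dots> = (\<Sum>s\<le>j. ?K (?A s) x) + (rho ^ j / ratio ^ l) * ?K (\<lambda>y. ratio ^ length y) x"
      by (simp only: step_op_add step_op_cmult step_op_sum finite_atMost)
    also have "\<dots> \<le> (\<Sum>s\<le>j. ?A (Suc s) x) + (rho ^ j / ratio ^ l) * (rho * ratio ^ length x)"
      using rho_pos ratio_pos lt by (intro add_mono mult_left_mono step_op_ratio) auto
    also have "\<dots> = (\<Sum>s\<le>Suc j. ?A s x) + rho ^ Suc j * ratio ^ length x / ratio ^ l"
      unfolding sum.atMost_Suc_shift using lt by (simp add: field_simps)
    finally show ?thesis .
  qed
qed

text \<open>The truncated subtraction is intended: there is no discount for hitting times \<open>s > j\<close>. The range grows with \<open>j\<close>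
  so that \<open>Psi_Suc\<close> is an identity.\<close>

definition Psi :: "nat \<Rightarrow> nat \<Rightarrow> nat \<Rightarrow> nat list \<Rightarrow> real" where
  "Psi l M j x = (\<Sum>s\<le>M + j. rho ^ (j - s) * hit lam \<omega> l (\<lambda>_. 1) s x)"

lemma Psi_Suc:
  assumes "length x < l"
  shows "Psi l M (Suc j) x = step_op False lam \<omega> (Psi l M j) x"
proof -
  have "Psi l M (Suc j) x = (\<Sum>s\<le>Suc (M + j). rho ^ (Suc j - s) * hit lam \<omega> l (\<lambda>_. 1) s x)"
    by (simp add: Psi_def)
  also have "\<dots> = (\<Sum>s\<le>M + j. rho ^ (j - s) * step_op False lam \<omega> (hit lam \<omega> l (\<lambda>_. 1) s) x)"
    unfolding sum.atMost_Suc_shift using assms by simp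
  also have "\<dots> = step_op False lam \<omega> (Psi l M j) x"
    unfolding Psi_def by (simp only: step_op_sum[symmetric] step_op_cmult[symmetric] finite_atMost)
  finally show ?thesis .
qed

lemma Psi_nonneg: "0 \<le> Psi l M j x"
  unfolding Psi_def using rho_pos lam_pos by (intro sum_nonneg mult_nonneg_nonneg hit_nonneg) auto

lemma Psi_root_le:
  assumes "j \<le> n"
  shows "Psi l M j [] \<le> Psi l M n [] * rho ^ j / rho ^ n"
proof -
  let ?A = "\<lambda>s. hit lam \<omega> l (\<lambda>_. 1) s []"
  have A: "0 \<le> ?A s" for s using lam_pos by (intro hit_nonneg) auto
  have "rho ^ (n - j) * Psi l M j [] = (\<Sum>s\<le>M + j. rho ^ (n - j + (j - s)) * ?A s)"
    by (simp add: Psi_def sum_distrib_left power_add mult.assoc)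
  also have "\<dots> \<le> (\<Sum>s\<le>M + j. rho ^ (n - s) * ?A s)"
    using A rho_pos rho_less assms by (intro sum_mono mult_right_mono power_decreasing) auto
  also have "\<dots> \<le> Psi l M n []"
    unfolding Psi_def using A rho_pos assms by (intro sum_mono2) auto
  finally have "rho ^ (n - j) * Psi l M j [] \<le> Psi l M n []" .
  moreover have "rho ^ n = rho ^ (n - j) * rho ^ j" using assms by (simp add: power_add[symmetric])
  ultimately show ?thesis using rho_pos by (simp add: field_simps)
qed

text \<open>The last summand is the mass fed in by the visits to the root, where the reflected walk exceeds the killed one.\<close>

lemma stay_le_Psi_aux:
  assumes "j \<le> n" "length x \<le> l" "0 < l"
  shows "(1 - ratio\<^sup>2) * stay l j x \<le> Psi l M j x
    + ratio ^ length x * (rho ^ j * (rho ^ M / ratio ^ l + lam * j * Psi l M n [] / rho ^ n))"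
  using assms(1,2)
proof (induction j arbitrary: x)
  case 0
  \<comment> \<open>A walk still below \<open>l\<close> at the horizon is continued: up to the
    truncation at \<open>M\<close>, the killed walk then climbs to level \<open>l\<close> with
    probability at least \<open>1 - ratio\<^sup>2\<close>. This is why \<open>Psi\<close> contains
    hitting times after the horizon.\<close>
  have "(1 - ratio\<^sup>2) * stay l 0 x \<le> 1 - ratio\<^sup>2"
    using ratio_less ratio_pos by (auto simp: stay_0 power_le_one)
  also have "\<dots> \<le> 1 - (ratio\<^sup>2) ^ Suc (length x)"
    using ratio_less ratio_pos by (simp add: power_le_one mult_left_le)
  also have "\<dots> \<le> Psi l M 0 x + rho ^ M * ratio ^ length x / ratio ^ l"
    using escape_le_hit[OF 0(2), of M] by (simp add: Psi_def)
  finally show ?case by (simp add: mult.commute)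
next
  case (Suc j)
  define B where "B i = rho ^ M / ratio ^ l + lam * real i * Psi l M n [] / rho ^ n" for i
  define e where "e = 1 - ratio\<^sup>2"
  have e: "0 \<le> e" "e \<le> 1" using ratio_pos ratio_less by (auto simp: e_def power_le_one)
  have B0: "0 \<le> B i" for i unfolding B_def using rho_pos ratio_pos lam_pos Psi_nonneg by (intro add_nonneg_nonneg) auto
  have BS: "B (Suc i) = B i + lam * Psi l M n [] / rho ^ n" for i
    by (simp add: B_def algebra_simps add_divide_distrib)
  have Bm: "B j \<le> B (Suc j)" unfolding BS using lam_pos rho_pos Psi_nonneg by simp
  have IH: "e * stay l j y \<le> Psi l M j y + (rho ^ j * B j) * ratio ^ length y" if "length y \<le> l" for y
    using Suc.IH[of y] Suc.prems that by (simp add: e_def B_def mult_ac)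
  have goal: "e * stay l (Suc j) x \<le> Psi l M (Suc j) x + ratio ^ length x * (rho ^ Suc j * B (Suc j))"
  proof (cases "length x = l")
    case True
    \<comment> \<open>Being below \<open>l\<close> again \<open>Suc j\<close> steps after a visit to
      level \<open>l\<close> has probability at most \<open>rho ^ Suc j\<close>; the discount in
      \<open>Psi\<close> comes from here.\<close>
    have "e * stay l (Suc j) x \<le> stay l (Suc j) x" using e stay_bounds by (simp add: mult_left_le_one_le)
    also have "\<dots> \<le> rho ^ Suc j" using stay_le[of l "Suc j" x] ratio_pos True by simp
    also have "\<dots> \<le> Psi l M (Suc j) x"
    proof -
      have "rho ^ Suc j = (\<Sum>s\<in>{0}. rho ^ (Suc j - s) * hit lam \<omega> l (\<lambda>_. 1) s x)" using True by simp
      also have "\<dots> \<le> Psi l M (Suc j) x"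
        unfolding Psi_def using rho_pos lam_pos by (intro sum_mono2 mult_nonneg_nonneg hit_nonneg) auto
      finally show ?thesis .
    qed
    also have "\<dots> \<le> Psi l M (Suc j) x + ratio ^ length x * (rho ^ Suc j * B (Suc j))"
      using B0[of "Suc j"] rho_pos ratio_pos by simp
    finally show ?thesis .
  next
    case False
    with Suc.prems have lt: "length x < l" by simp
    have "e * stay l (Suc j) x = step_op True lam \<omega> (\<lambda>y. e * stay l j y) x"
      by (simp add: stay_Suc step_op_cmult)
    also have "\<dots> \<le> step_op True lam \<omega> (\<lambda>y. Psi l M j y + (rho ^ j * B j) * ratio ^ length y) x"
      using lt by (intro step_op_mono_level lam_pos IH) auto
    also have "\<dots> = step_op True lam \<omega> (Psi l M j) x + (rho ^ j * B j) * step_op True lam \<omega> (\<lambda>y. ratio ^ length y) x"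
      by (simp only: step_op_add step_op_cmult)
    also have "\<dots> \<le> step_op True lam \<omega> (Psi l M j) x + (rho ^ j * B j) * (rho * ratio ^ length x)"
      using rho_pos B0 by (intro add_mono mult_left_mono step_op_ratio) auto
    finally have 1: "e * stay l (Suc j) x \<le> step_op True lam \<omega> (Psi l M j) x + rho ^ Suc j * B j * ratio ^ length x"
      by (simp add: mult_ac)
    show ?thesis
    proof (cases "x = []")
      case False
      then have "step_op True lam \<omega> (Psi l M j) x = Psi l M (Suc j) x"
        using Psi_Suc[OF lt] by (simp add: step_op_def)
      moreover have "rho ^ Suc j * B j * ratio ^ length x \<le> ratio ^ length x * (rho ^ Suc j * B (Suc j))"
        using Bm rho_pos ratio_pos by (simp add: mult_ac mult_left_mono)
      ultimately show ?thesis using 1 by linarith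
    next
      case True
      let ?S = "\<Sum>i<\<omega> []. Psi l M j [i]"
      have S: "0 \<le> ?S" by (intro sum_nonneg Psi_nonneg)
      have k: "1 \<le> real (\<omega> [])" using deg_pos[of "[]"] by linarith
      \<comment> \<open>At the root reflection exceeds killing by a factor of at most
        \<open>1 + lam\<close>, because the degree is at least 1. The excess is absorbed by the
        increment from \<open>B j\<close> to \<open>B (Suc j)\<close>.\<close>
      have "1 / real (\<omega> []) \<le> (1 + lam) / (lam + \<omega> [])"
        using k lam_pos by (intro divide_le_divideI) (auto simp: algebra_simps)
      then have "1 / real (\<omega> []) * ?S \<le> (1 + lam) / (lam + \<omega> []) * ?S"
        using S by (rule mult_right_mono)
      then have "step_op True lam \<omega> (Psi l M j) x \<le> (1 + lam) * step_op False lam \<omega> (Psi l M j) x"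
        using True by (simp add: step_op_def)
      also have "\<dots> = Psi l M (Suc j) x + lam * Psi l M (Suc j) []"
        using Psi_Suc[OF lt] True by (simp add: algebra_simps)
      also have "\<dots> \<le> Psi l M (Suc j) x + lam * (Psi l M n [] * rho ^ Suc j / rho ^ n)"
        using Psi_root_le[OF Suc.prems(1)] lam_pos by (intro add_left_mono mult_left_mono) auto
      finally show ?thesis using 1 True by (simp add: BS algebra_simps)
    qed
  qed
  then show ?case by (simp add: e_def B_def)
qed

text \<open>The cost of passing to the killed walk is polynomial in \<open>n\<close>; the last term
  becomes negligible when \<open>M\<close> is a large multiple of \<open>n\<close>, as in
  \<open>wgt_large\<close>.\<close>

lemma stay_le_Psi:
  assumes "0 < l"
  shows "(1 - ratio\<^sup>2) * stay l n [] \<le> (1 + lam * n) * Psi l M n [] + rho ^ (n + M) / ratio ^ l"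
proof -
  have "rho ^ n * (rho ^ M / ratio ^ l + lam * n * Psi l M n [] / rho ^ n) = rho ^ (n + M) / ratio ^ l + lam * n * Psi l M n []"
    using rho_pos by (simp add: distrib_left power_add)
  then show ?thesis using stay_le_Psi_aux[of n n "[]" l M] assms by (simp add: algebra_simps)
qed

text \<open>Traps are available for rates \<open>\<gamma> < rho\<close>; using
  \<open>\<gamma>\<close> in place of \<open>rho\<close> loses at most
  \<open>(\<gamma> / rho) ^ n\<close> over the whole time.\<close>

lemma wgt_ge_Psi:
  assumes "1 \<le> m" "0 < \<gamma>" "\<gamma> \<le> rho"
  shows "m ^ n * (\<gamma> / rho) ^ n * Psi l M n [] \<le> wgt lam \<omega> m \<gamma> l n (M + n) (\<lambda>_. 1)"
  unfolding Psi_def wgt_def sum_distrib_left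
proof (intro sum_mono)
  fix s
  have "(\<gamma> / rho) ^ n \<le> (\<gamma> / rho) ^ (n - s)"
    using assms rho_pos by (intro power_decreasing) auto
  then have "(\<gamma> / rho) ^ n * rho ^ (n - s) \<le> \<gamma> ^ (n - s)"
    using rho_pos by (simp add: power_divide pos_le_divide_eq)
  moreover have "m ^ n \<le> m ^ max n s" using assms by (intro power_increasing) auto
  ultimately have "m ^ n * ((\<gamma> / rho) ^ n * rho ^ (n - s)) \<le> m ^ max n s * \<gamma> ^ (n - s)"
    using assms rho_pos by (intro mult_mono) auto
  then have "m ^ n * ((\<gamma> / rho) ^ n * rho ^ (n - s)) * hit lam \<omega> l (\<lambda>_. 1) s [] \<le> m ^ max n s * \<gamma> ^ (n - s) * hit lam \<omega> l (\<lambda>_. 1) s []"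
    using lam_pos by (intro mult_right_mono hit_nonneg) auto
  then show "m ^ n * (\<gamma> / rho) ^ n * (rho ^ (n - s) * hit lam \<omega> l (\<lambda>_. 1) s []) \<le> m ^ max n s * \<gamma> ^ (n - s) * hit lam \<omega> l (\<lambda>_. 1) s []"
    by (simp add: mult_ac)
qed

text \<open>Moving up whenever possible has probability at least \<open>lam / (lam + d)\<close> per
  step; at the root, where every child will do, this uses \<open>lam < d\<close>. The parity
  condition makes this path end at the root.\<close>

lemma loop_lower:
  assumes reg: "\<And>w. length w < h \<Longrightarrow> set w \<subseteq> {..<d} \<Longrightarrow> \<omega> w = d" and h: "2 \<le> h"
    and x: "set x \<subseteq> {..<d}" "length x < h" "length x \<le> t" "even (t + length x)"
  shows "(lam / (lam + d)) ^ t \<le> loop lam \<omega> h t x"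
  using x
proof (induction t arbitrary: x)
  case (Suc t)
  let ?e = "lam / (lam + d)" and ?f = "loop lam \<omega> h t"
  have f: "0 \<le> ?f y" for y using lam_pos by (rule loop_nonneg)
  have wx: "\<omega> x = d" using reg Suc.prems by auto
  have "?e ^ Suc t \<le> step_op False lam \<omega> ?f x"
  proof (cases "x = []")
    case False
    have "?e ^ t \<le> ?f (butlast x)"
      using Suc.prems False by (intro Suc.IH) (auto dest: in_set_butlastD)
    then have "?e * ?e ^ t \<le> ?e * ?f (butlast x)" using lam_pos by (intro mult_left_mono) auto
    also have "\<dots> \<le> step_op False lam \<omega> ?f x"
      using False f lam_pos by (simp add: step_op_def wx sum_nonneg)
    finally show ?thesis by simp
  next
    case True
    have "?e ^ t \<le> ?f [i]" if "i < d" for i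
      using Suc.prems True that h by (intro Suc.IH) (auto elim: oddE)
    then have "(\<Sum>i<d. ?e ^ t) \<le> (\<Sum>i<d. ?f [i])" by (intro sum_mono) auto
    then have "d * ?e ^ t / (lam + d) \<le> (\<Sum>i<d. ?f [i]) / (lam + d)"
      using lam_pos by (intro divide_right_mono) auto
    moreover have "?e * ?e ^ t \<le> d * ?e ^ t / (lam + d)"
      using lam_pos lam_less by (simp add: divide_right_mono mult_right_mono)
    ultimately show ?thesis using True wx by (simp add: step_op_def)
  qed
  then show ?case using Suc.prems by simp
qed auto

text \<open>\<open>ratio ^ i * sin ((i + 1) * \<alpha>)\<close> is the Dirichlet eigenfunction of the radial walk on levels \<open>0, ..., h - 1\<close>.
  Parity forces the restriction to \<open>even (h + t + length x)\<close>.\<close>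

lemma loop_eigen:
  fixes \<alpha> :: real
  assumes reg: "\<And>w. length w < h \<Longrightarrow> set w \<subseteq> {..<d} \<Longrightarrow> \<omega> w = d" and h: "2 \<le> h"
  defines "\<alpha> \<equiv> pi / (h + 1)"
  assumes x: "set x \<subseteq> {..<d}" "length x \<le> h" "even (h + t + length x)"
  shows "(lam / (lam + d)) ^ h * (rho * cos \<alpha>) ^ t * (ratio ^ length x * sin ((length x + 1) * \<alpha>)) \<le> loop lam \<omega> h (h + t) x"
  using x
proof (induction t arbitrary: x)
  case 0
  let ?p = "ratio ^ length x * sin ((length x + 1) * \<alpha>)"
  show ?case
  proof (cases "length x = h")
    case True
    then have "sin ((length x + 1) * \<alpha>) = 0" by (simp add: \<alpha>_def add.commute)
    then show ?thesis using loop_nonneg[OF lam_pos] by simp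
  next
    case False
    have "?p \<le> 1 * 1"
    proof (cases "0 \<le> sin ((length x + 1) * \<alpha>)")
      case True
      then show ?thesis using ratio_pos ratio_less by (intro mult_mono power_le_one sin_le_one) auto
    next
      case False
      then have "?p \<le> 0" using ratio_pos by (intro mult_nonneg_nonpos) auto
      then show ?thesis by simp
    qed
    \<comment> \<open>The initial \<open>h\<close> steps serve to dominate the eigenfunction, which
      is at most 1, by the crude bound \<open>loop_lower\<close>.\<close>
    then have "(lam / (lam + d)) ^ h * ?p \<le> (lam / (lam + d)) ^ h * 1"
      using lam_pos by (intro mult_left_mono) auto
    also have "\<dots> \<le> loop lam \<omega> h h x"
      using loop_lower[OF reg h, of x h] 0 False by simp
    finally show ?thesis by simp
  qed
next
  case (Suc t)
  define c where "c = (lam / (lam + d)) ^ h * (rho * cos \<alpha>) ^ t"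
  define \<psi> where "\<psi> i = ratio ^ i * sin ((real i + 1) * \<alpha>)" for i
  let ?f = "loop lam \<omega> h (h + t)"
  have f: "0 \<le> ?f y" for y using lam_pos by (rule loop_nonneg)
  have IH: "c * \<psi> (length y) \<le> ?f y" if "set y \<subseteq> {..<d}" "length y \<le> h" "even (h + t + length y)" for y
    using Suc.IH[OF that] by (simp add: c_def \<psi>_def add.commute)
  show ?case
  proof (cases "length x = h")
    case True
    then have "sin ((length x + 1) * \<alpha>) = 0" by (simp add: \<alpha>_def add.commute)
    then show ?thesis using loop_nonneg[OF lam_pos, of \<omega> h "h + Suc t" x] by (simp del: loop.simps)
  next
    case False
    with Suc.prems have lt: "length x < h" by simp
    have wx: "\<omega> x = d" using reg Suc.prems lt by auto
    have ch: "c * \<psi> (Suc (length x)) \<le> ?f (x @ [i])" if "i < d" for i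
      using IH[of "x @ [i]"] that Suc.prems lt by simp
    have "d * (c * \<psi> (Suc (length x))) = (\<Sum>i<d. c * \<psi> (Suc (length x)))" by simp
    also have "\<dots> \<le> (\<Sum>i<d. ?f (x @ [i]))" using ch by (intro sum_mono) auto
    finally have S: "d * (c * \<psi> (Suc (length x))) / (lam + d) \<le> (\<Sum>i<d. ?f (x @ [i])) / (lam + d)"
      using lam_pos by (intro divide_right_mono) auto
    have dr: "d * ratio\<^sup>2 = lam" using d_ge by (simp add: ratio_sq)
    have rr: "rho * ratio * (lam + d) = 2 * lam" using rho_ratio lam_pos by simp
    \<comment> \<open>Eigenvalue equation, from \<open>sin (y + \<alpha>) + sin (y - \<alpha>) = 2 *
      cos \<alpha> * sin y\<close>. The missing parent term at the root fits because the sine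
      vanishes at level -1; the choice of \<open>\<alpha>\<close> makes it vanish at level
      \<open>h\<close> too.\<close>
    have key: "rho * cos \<alpha> * \<psi> (length x) = (if x = [] then 0 else lam / (lam + d) * \<psi> (length x - 1)) + d * \<psi> (Suc (length x)) / (lam + d)"
    proof -
      have tr: "sin ((real n + 2) * \<alpha>) + sin (real n * \<alpha>) = 2 * cos \<alpha> * sin ((real n + 1) * \<alpha>)" for n
      proof -
        have "(real n + 2) * \<alpha> = (real n + 1) * \<alpha> + \<alpha>" "real n * \<alpha> = (real n + 1) * \<alpha> - \<alpha>" by (simp_all add: algebra_simps)
        then show ?thesis by (simp add: sin_add sin_diff)
      qed
      have lr: "lam = d * ratio * ratio" using dr by (simp add: power2_eq_square)
      have rd: "rho * (lam + d) = 2 * d * ratio"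
      proof -
        have "rho * (lam + d) * ratio = 2 * d * ratio * ratio" using rr lr by (simp add: mult_ac)
        then show ?thesis using ratio_pos by simp
      qed
      show ?thesis
      proof (cases x)
        case Nil
        have "rho * (lam + d) * (cos \<alpha> * sin \<alpha>) = d * (ratio * sin (2 * \<alpha>))"
          unfolding rd sin_double by simp
        then show ?thesis using Nil lam_pos by (simp add: \<psi>_def field_simps)
      next
        case (Cons a y)
        let ?n = "real (length y)"
        have "rho * (lam + d) * (cos \<alpha> * (ratio * sin ((?n + 2) * \<alpha>)))
          = d * ratio * ratio * (2 * cos \<alpha> * sin ((?n + 2) * \<alpha>))" unfolding rd by simp
        also have "\<dots> = d * ratio * ratio * (sin ((?n + 3) * \<alpha>) + sin ((?n + 1) * \<alpha>))"
          using tr[of "Suc (length y)"] by (simp add: add.commute add.left_commute)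
        also have "\<dots> = lam * sin ((?n + 1) * \<alpha>) + d * ratio * ratio * sin ((?n + 3) * \<alpha>)"
          using lr by (simp add: algebra_simps)
        finally have "ratio ^ length y * (rho * (lam + d) * (cos \<alpha> * (ratio * sin ((?n + 2) * \<alpha>))))
          = ratio ^ length y * (lam * sin ((?n + 1) * \<alpha>) + d * ratio * ratio * sin ((?n + 3) * \<alpha>))" by simp
        moreover have "real (length x) + 1 = ?n + 2" "real (length x - 1) + 1 = ?n + 1" "real (Suc (length x)) + 1 = ?n + 3"
          using Cons by simp_all
        ultimately have "rho * cos \<alpha> * \<psi> (length x) * (lam + d) = lam * \<psi> (length x - 1) + d * \<psi> (Suc (length x))"
          using Cons unfolding \<psi>_def by (simp add: algebra_simps)
        then have "rho * cos \<alpha> * \<psi> (length x) = (lam * \<psi> (length x - 1) + d * \<psi> (Suc (length x))) / (lam + d)"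
          using lam_pos by (simp add: eq_divide_eq)
        then show ?thesis using Cons by (simp add: add_divide_distrib)
      qed
    qed
    have "c * (rho * cos \<alpha> * \<psi> (length x)) \<le> step_op False lam \<omega> ?f x"
    proof (cases "x = []")
      case True
      then show ?thesis using S key wx by (simp add: step_op_def mult_ac)
    next
      case False
      have "c * \<psi> (length x - 1) \<le> ?f (butlast x)"
      proof -
        have "set (butlast x) \<subseteq> {..<d}" using Suc.prems(1) by (auto dest: in_set_butlastD)
        moreover obtain n where "length x = Suc n" using False by (cases x) auto
        ultimately show ?thesis using IH[of "butlast x"] Suc.prems by simp
      qed
      then have "lam / (lam + d) * (c * \<psi> (length x - 1)) \<le> lam / (lam + d) * ?f (butlast x)"
        using lam_pos by (intro mult_left_mono) auto
      with S show ?thesis using key wx False by (simp add: step_op_def algebra_simps)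
    qed
    then show ?thesis using lt by (simp add: c_def \<psi>_def mult_ac add.commute)
  qed
qed

lemma recur_of_regular:
  assumes reg: "\<And>w. length w < h \<Longrightarrow> set w \<subseteq> {..<d} \<Longrightarrow> \<omega> w = d" and h: "2 \<le> h"
    and g: "0 \<le> \<gamma>" "\<gamma> \<le> rho * cos (pi / (h + 1))"
  shows "\<exists>H. recur lam \<gamma> H \<omega>"
proof -
  let ?\<alpha> = "pi / (h + 1)" and ?e = "(lam / (lam + d)) ^ h"
  have a: "0 < ?\<alpha>" "?\<alpha> < pi" using h by (auto simp: field_simps)
  then have s: "0 < sin ?\<alpha>" by (rule sin_gt_zero)
  have s1: "sin ?\<alpha> \<le> 1" by simp
  have e: "0 < ?e" "0 \<le> lam / (lam + d)" "lam / (lam + d) \<le> 1" using lam_pos by auto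
  have rc: "rho * cos ?\<alpha> \<le> 1 * 1" using rho_pos rho_less g
    by (intro order_trans[OF mult_left_mono[OF cos_le_one]]) auto
  have g1: "\<gamma> \<le> 1" using rc g by linarith
  show ?thesis
  proof (rule recurI[of lam "?e * sin ?\<alpha>" \<gamma> \<omega> h])
    fix k
    show "?e * sin ?\<alpha> * \<gamma> ^ (2 * k) \<le> loop lam \<omega> h (2 * k) []"
    proof (cases "h \<le> 2 * k")
      case True
      have "\<gamma> ^ (2 * k) \<le> \<gamma> ^ (2 * k - h)" using g g1 by (intro power_decreasing) auto
      also have "\<dots> \<le> (rho * cos ?\<alpha>) ^ (2 * k - h)" using g by (intro power_mono)
      finally have "?e * sin ?\<alpha> * \<gamma> ^ (2 * k) \<le> ?e * sin ?\<alpha> * (rho * cos ?\<alpha>) ^ (2 * k - h)"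
        using e s by (intro mult_left_mono) auto
      also have "\<dots> \<le> loop lam \<omega> h (2 * k) []"
        using loop_eigen[OF reg h, of "[]" "2 * k - h"] True by (simp add: mult_ac add.commute)
      finally show ?thesis .
    next
      case False
      \<comment> \<open>Times below \<open>h\<close> are not covered by \<open>loop_eigen\<close>,
        but there \<open>loop_lower\<close> alone suffices.\<close>
      have "?e * sin ?\<alpha> * \<gamma> ^ (2 * k) \<le> ?e * 1 * 1"
        using e s g g1 by (intro mult_mono power_le_one) auto
      also have "\<dots> \<le> (lam / (lam + d)) ^ (2 * k)"
        using e False by (simp add: power_decreasing)
      also have "\<dots> \<le> loop lam \<omega> h (2 * k) []"
        using loop_lower[OF reg h, of "[]" "2 * k"] h by simp
      finally show ?thesis .
    qed
  qed (use e s lam_pos in auto)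
qed

text \<open>A path first makes loops at the root for the missing time \<open>n - s\<close> (rounded up to an even number), then steps to \<open>i\<close>.\<close>

lemma block_hits:
  assumes H: "recur lam \<gamma> H \<omega>" "H \<le> l" and D: "\<omega> [] \<le> D" and i: "i < \<omega> []"
    and m: "1 \<le> m" and g: "0 < \<gamma>" "\<gamma> \<le> 1" and nN: "n \<le> N" and b: "\<And>x. 0 \<le> \<beta> x"
  shows "\<gamma> / (H * (lam + D) * (N + 1)) * (\<Sum>s\<le>N. m ^ max n s * \<gamma> ^ (n - s) * hit lam (\<lambda>w. \<omega> (i # w)) l (\<lambda>w. \<beta> (i # w)) s [])
    \<le> (\<Sum>t\<in>{n..N + 2}. m ^ t * hit lam \<omega> (Suc l) \<beta> t [])" (is "_ \<le> ?Tot")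
proof -
  let ?h = "\<lambda>s. hit lam (\<lambda>w. \<omega> (i # w)) l (\<lambda>w. \<beta> (i # w)) s []"
  have H0: "0 < H" using H unfolding recur_def by (auto dest: spec[of _ 0] intro: gr0I)
  have h0: "0 \<le> ?h s" for s using lam_pos b by (intro hit_nonneg) auto
  have a0: "0 \<le> hit lam \<omega> (Suc l) \<beta> s x" for s x using lam_pos b by (intro hit_nonneg) auto
  have lD: "0 < lam + D" "lam + \<omega> [] \<le> lam + D" "0 < lam + \<omega> []" using lam_pos D by auto
  have one: "\<gamma> / (H * (lam + D)) * (m ^ max n s * \<gamma> ^ (n - s) * ?h s) \<le> ?Tot" if "s \<le> N" for s
  proof -
    \<comment> \<open>The arrival time \<open>2 * k + Suc s\<close> then lies between
      \<open>max n s + 1\<close> and \<open>max n s + 2\<close>, whence the window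
      \<open>{n..N + 2}\<close>.\<close>
    define k where "k = (n - s + 1) div 2"
    have k: "2 * k \<le> n - s + 1" "n - s \<le> 2 * k" unfolding k_def by linarith+
    have "?h s / (lam + D) \<le> hit lam \<omega> (Suc l) \<beta> s [i] / (lam + \<omega> [])"
      using hit_shift[of lam \<omega> \<beta> i l s "[]"] lam_pos deg_pos b lD h0[of s] a0 by (intro frac_le) auto
    also have "\<dots> \<le> step_op False lam \<omega> (hit lam \<omega> (Suc l) \<beta> s) []"
      using lam_pos deg_pos i a0 by (intro step_op_root_ge) auto
    also have "\<dots> = hit lam \<omega> (Suc l) \<beta> (Suc s) []" by simp
    finally have 1: "?h s / (lam + D) \<le> hit lam \<omega> (Suc l) \<beta> (Suc s) []" .
    have "\<gamma> * \<gamma> ^ (n - s) \<le> \<gamma> ^ (2 * k)"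
      using g k by (subst power_Suc[symmetric], intro power_decreasing) auto
    also have "\<dots> \<le> H * loop lam \<omega> H (2 * k) []" using H unfolding recur_def by blast
    finally have 2: "\<gamma> * \<gamma> ^ (n - s) / H \<le> loop lam \<omega> H (2 * k) []" using H0 by (simp add: divide_le_eq mult.commute)
    have "(\<gamma> * \<gamma> ^ (n - s) / H) * (?h s / (lam + D)) \<le> loop lam \<omega> H (2 * k) [] * hit lam \<omega> (Suc l) \<beta> (Suc s) []"
      using 1 2 h0 lD loop_nonneg[OF lam_pos] by (intro mult_mono) auto
    also have "\<dots> \<le> hit lam \<omega> (Suc l) \<beta> (2 * k + Suc s) []"
      using lam_pos deg_pos b H by (intro loop_hit) auto
    finally have 3: "(\<gamma> * \<gamma> ^ (n - s) / H) * (?h s / (lam + D)) \<le> hit lam \<omega> (Suc l) \<beta> (2 * k + Suc s) []" .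
    have "m ^ max n s * ((\<gamma> * \<gamma> ^ (n - s) / H) * (?h s / (lam + D))) \<le> m ^ (2 * k + Suc s) * hit lam \<omega> (Suc l) \<beta> (2 * k + Suc s) []"
      using 3 m k g h0 lD by (intro mult_mono power_increasing) auto
    also have "\<dots> \<le> ?Tot"
      using k that nN m a0 by (intro member_le_sum) auto
    finally show ?thesis by (simp add: field_simps)
  qed
  \<comment> \<open>Different \<open>s\<close> may lead to the same arrival time, so each summand is
    compared with all of \<open>?Tot\<close>, at the price of a factor \<open>N + 1\<close>.\<close>
  have "(\<Sum>s\<le>N. \<gamma> / (H * (lam + D)) * (m ^ max n s * \<gamma> ^ (n - s) * ?h s)) \<le> (\<Sum>s\<le>N. ?Tot)"
    using one by (intro sum_mono) auto
  then have "\<gamma> / (H * (lam + D)) * (\<Sum>s\<le>N. m ^ max n s * \<gamma> ^ (n - s) * ?h s) \<le> (N + 1) * ?Tot"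
    by (simp add: sum_distrib_left)
  then have "\<gamma> / (H * (lam + D)) * (\<Sum>s\<le>N. m ^ max n s * \<gamma> ^ (n - s) * ?h s) / (N + 1) \<le> ?Tot"
    by (subst pos_divide_le_eq) (auto simp: mult.commute)
  then show ?thesis by (simp add: field_simps)
qed

end

text \<open>While all values stay below \<open>q0\<close>, the linear evolution with factor \<open>m\<close> is a subsolution of the
  nonlinear recursion for \<open>sv\<close>.\<close>

lemma (in quenched) sv_ge_hits:
  fixes \<beta> :: "nat list \<Rightarrow> real"
  assumes lin: "\<And>q. 0 \<le> q \<Longrightarrow> q \<le> q0 \<Longrightarrow> m * q \<le> hit_prob \<mu> q" and m: "1 \<le> m"
    and b: "\<And>x. 0 \<le> \<beta> x" "\<And>x. \<beta> x \<le> \<theta>" and small: "(N + 1) * m ^ N * \<theta> \<le> q0" "q0 \<le> 1"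
    and good: "\<And>z. length z = L \<Longrightarrow> \<beta> z \<le> sv \<mu> (step_op False lam \<omega>) j (slow a (C + L)) z"
    and n: "0 < n" "L \<le> a * n" and C: "L \<le> C"
  shows "(\<Sum>t\<in>{n..N}. m ^ t * hit lam \<omega> L \<beta> t []) \<le> sv \<mu> (step_op False lam \<omega>) (Suc j) (slow a C) []"
proof -
  let ?K = "step_op False lam \<omega>"
  \<comment> \<open>Mean weight of the arrivals from time \<open>i\<close> on, as seen by a particle
    at \<open>x\<close> in generation \<open>i\<close>; only arrival times in \<open>{n..N}\<close>
    count.\<close>
  define P where "P i x = (\<Sum>t\<in>{max n i..N}. m ^ (t - i) * hit lam \<omega> L \<beta> (t - i) x)" for i x
  have a: "0 \<le> a"
  proof (rule ccontr)
    assume "\<not> 0 \<le> a"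
    then have "a * n < 0" using n by (simp add: mult_neg_pos)
    then show False using n by simp
  qed
  have h0: "0 \<le> hit lam \<omega> L \<beta> t x" and h1: "hit lam \<omega> L \<beta> t x \<le> \<theta>" for t x
    using lam_pos b deg_pos by (auto intro: hit_nonneg hit_le)
  have th: "0 \<le> \<theta>" using b(1)[of undefined] b(2)[of undefined] by linarith
  have P0: "0 \<le> P i x" for i x unfolding P_def using h0 m by (intro sum_nonneg mult_nonneg_nonneg) auto
  have P1: "P i x \<le> q0" for i x
  proof -
    have "P i x \<le> (\<Sum>t\<in>{max n i..N}. m ^ N * \<theta>)"
      unfolding P_def using h0 h1 m th by (intro sum_mono mult_mono power_increasing) auto
    also have "\<dots> = real (card {max n i..N}) * (m ^ N * \<theta>)" by simp
    also have "\<dots> \<le> (N + 1) * (m ^ N * \<theta>)"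
      using m th by (intro mult_right_mono mult_nonneg_nonneg) auto
    also have "\<dots> \<le> q0" using small by (simp add: mult.assoc)
    finally show ?thesis .
  qed
  have PK: "P i x = m * ?K (P (Suc i)) x" if "length x < L" for i x
  proof -
    have "P i x = (\<Sum>t\<in>{max n (Suc i)..N}. m ^ (t - i) * hit lam \<omega> L \<beta> (t - i) x)"
      unfolding P_def using that by (intro sum.mono_neutral_right) (auto simp: not_le less_Suc_eq_le)
    also have "\<dots> = (\<Sum>t\<in>{max n (Suc i)..N}. m * (m ^ (t - Suc i) * ?K (hit lam \<omega> L \<beta> (t - Suc i)) x))"
    proof (intro sum.cong refl)
      fix t assume "t \<in> {max n (Suc i)..N}"
      then have "t - i = Suc (t - Suc i)" by auto
      then show "m ^ (t - i) * hit lam \<omega> L \<beta> (t - i) x = m * (m ^ (t - Suc i) * ?K (hit lam \<omega> L \<beta> (t - Suc i)) x)"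
        using that by simp
    qed
    also have "\<dots> = m * ?K (P (Suc i)) x"
      unfolding P_def by (simp only: step_op_sum finite_atLeastAtMost step_op_cmult sum_distrib_left)
    finally show ?thesis .
  qed
  have main: "P i x \<le> sv \<mu> ?K k (slow a (C + a * i)) x" if "length x \<le> L" "i + k \<le> Suc j" for i k x
    using that
  proof (induction k arbitrary: i x)
    case 0
    have "real (length x) \<le> C + a * i" using 0 C a by (simp add: add_increasing2 order_trans)
    then show ?case using P1[of i x] small by (simp add: slow_0)
  next
    case (Suc k)
    show ?case
    proof (cases "length x = L")
      case True
      show ?thesis
      proof (cases "n \<le> i \<and> i \<le> N")
        case True
        have "P i x = (\<Sum>t\<in>{i}. m ^ (t - i) * hit lam \<omega> L \<beta> (t - i) x)"
          unfolding P_def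
        proof (intro sum.mono_neutral_right ballI)
          fix t assume "t \<in> {max n i..N} - {i}"
          then have "t - i = Suc (t - Suc i)" using True by auto
          then show "m ^ (t - i) * hit lam \<omega> L \<beta> (t - i) x = 0" using \<open>length x = L\<close> by simp
        qed (use True in auto)
        also have "\<dots> = \<beta> x" using \<open>length x = L\<close> by simp
        also have "\<dots> \<le> sv \<mu> ?K j (slow a (C + L)) x" by (rule good[OF \<open>length x = L\<close>])
        \<comment> \<open>The arrival has used up at least \<open>n > 0\<close> generations, so
          horizon \<open>j\<close> at the arrival point is enough for horizon \<open>Suc j\<close>
          at the root.\<close>
        also have "\<dots> \<le> sv \<mu> ?K (Suc k) (slow a (C + L)) x"
          using Suc.prems True n by (intro sv_antimono lam_pos deg_pos) auto
        also have "\<dots> \<le> sv \<mu> ?K (Suc k) (slow a (C + a * i)) x"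
        proof (intro sv_slow_mono lam_pos deg_pos)
          \<comment> \<open>In \<open>n\<close> generations the boundary rises by at least
            \<open>L\<close>, which pays for starting afresh at level \<open>L\<close>.\<close>
          have "a * n \<le> a * i" using True a by (intro mult_left_mono) auto
          then show "C + L \<le> C + a * i" using n by simp
        qed
        finally show ?thesis .
      next
        case False
        have "P i x = 0" unfolding P_def
        proof (intro sum.neutral ballI)
          fix t assume "t \<in> {max n i..N}"
          then have "t - i = Suc (t - Suc i)" using False by auto
          then show "m ^ (t - i) * hit lam \<omega> L \<beta> (t - i) x = 0" using \<open>length x = L\<close> by simp
        qed
        then show ?thesis using sv_bounds[OF lam_pos deg_pos, where \<mu> = \<mu> and b = False and j = "Suc k" and Q = "slow a (C + a * i)" and x = x] by simp
      qed
    next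
      case False
      with Suc.prems have lt: "length x < L" by simp
      let ?s = "sv \<mu> ?K k (slow a (C + a * i + a))"
      have "P (Suc i) y \<le> ?s y" if "length y \<le> L" for y
        using Suc.IH[of y "Suc i"] Suc.prems that by (simp add: algebra_simps)
      then have 1: "?K (P (Suc i)) x \<le> ?K ?s x"
        using lt by (intro step_op_mono_level lam_pos) auto
      have 2: "0 \<le> ?K (P (Suc i)) x" "?K (P (Suc i)) x \<le> q0"
        using step_op_bounds[OF lam_pos deg_pos, of "P (Suc i)" q0] P0 P1 by auto
      have 3: "?K ?s x \<le> 1"
        using step_op_bounds[OF lam_pos deg_pos, of ?s 1] sv_bounds[OF lam_pos deg_pos] by auto
      have "P i x = m * ?K (P (Suc i)) x" using PK[OF lt] .
      also have "\<dots> \<le> hit_prob \<mu> (?K (P (Suc i)) x)" using lin 2 by blast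
      also have "\<dots> \<le> hit_prob \<mu> (?K ?s x)" using 1 2 3 by (intro hit_prob_mono)
      finally have 4: "P i x \<le> hit_prob \<mu> (?K ?s x)" .
      have "real (length x) \<le> C + a * i" using lt C a by (simp add: add_increasing2 order_trans)
      then show ?thesis using 4 by (simp add: slow_0 slow_Suc)
    qed
  qed
  show ?thesis using main[of "[]" 0 "Suc j"] n by (simp add: P_def)
qed

section \<open>Random environments\<close>

lemma measurable_hit [measurable (raw)]:
  assumes "\<And>x. (\<lambda>z. w z x) \<in> measurable M (count_space UNIV)" "\<And>x. (\<lambda>z. \<beta> z x) \<in> borel_measurable M"
  shows "(\<lambda>z. hit lam (w z) l (\<beta> z) s x) \<in> borel_measurable M"
  using assms by (induction s arbitrary: x) (auto intro!: measurable_step_op)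

lemma measurable_loop [measurable (raw)]:
  assumes "\<And>x. (\<lambda>z. w z x) \<in> measurable M (count_space UNIV)"
  shows "(\<lambda>z. loop lam (w z) H t x) \<in> borel_measurable M"
  using assms by (induction t arbitrary: x) (auto intro!: measurable_step_op)

lemma measurable_sv [measurable (raw)]:
  assumes "\<And>x. (\<lambda>z. w z x) \<in> measurable M (count_space UNIV)"
  shows "(\<lambda>z. sv \<mu> (step_op b lam (w z)) j Q x) \<in> borel_measurable M"
  using assms
proof (induction j arbitrary: Q x)
  case (Suc j)
  have "(\<lambda>z. step_op b lam (w z) (sv \<mu> (step_op b lam (w z)) j (\<lambda>k. Q (Suc k))) x) \<in> borel_measurable M"
    using Suc by (intro measurable_step_op) auto
  then show ?case by simp
qed simp

lemma measurable_recur [measurable (raw)]: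
  assumes "\<And>x. (\<lambda>z. w z x) \<in> measurable M (count_space UNIV)"
  shows "Measurable.pred M (\<lambda>z. recur lam \<gamma> H (w z))"
  using measurable_loop[OF assms] unfolding recur_def by measurable

lemma step_op_cong:
  assumes "\<omega> x = \<omega>' x" "\<And>y. length y \<le> Suc (length x) \<Longrightarrow> \<phi> y = \<psi> y"
  shows "step_op b lam \<omega> \<phi> x = step_op b lam \<omega>' \<psi> x"
  using assms by (cases "x = []") (simp_all add: step_op_def)

lemma hit_cong:
  assumes "\<And>w. length w < l \<Longrightarrow> \<omega> w = \<omega>' w" "\<And>w. length w = l \<Longrightarrow> \<beta> w = \<beta>' w"
  shows "hit lam \<omega> l \<beta> s x = hit lam \<omega>' l \<beta>' s x"
  by (induction s arbitrary: x) (auto simp: assms intro!: step_op_cong)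

lemma hit_mono: "0 < lam \<Longrightarrow> (\<And>x. \<beta> x \<le> \<beta>' x) \<Longrightarrow> hit lam \<omega> l \<beta> s x \<le> hit lam \<omega> l \<beta>' s x"
  by (induction s arbitrary: x) (auto intro: step_op_mono)

lemma integral_hit:
  assumes "\<And>y. integrable M (\<lambda>z. \<beta> z y)"
  shows "integrable M (\<lambda>z. hit lam \<omega> l (\<beta> z) s x)"
    "(\<integral>z. hit lam \<omega> l (\<beta> z) s x \<partial>M) = hit lam \<omega> l (\<lambda>y. \<integral>z. \<beta> z y \<partial>M) s x"
proof -
  have "integrable M (\<lambda>z. hit lam \<omega> l (\<beta> z) s x) \<and>
    (\<integral>z. hit lam \<omega> l (\<beta> z) s x \<partial>M) = hit lam \<omega> l (\<lambda>y. \<integral>z. \<beta> z y \<partial>M) s x"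
  proof (induction s arbitrary: x)
    case (Suc s)
    then show ?case
      using integral_step_op[of M "\<lambda>z. hit lam \<omega> l (\<beta> z) s" False lam \<omega> x] by auto
  qed (use assms in auto)
  then show "integrable M (\<lambda>z. hit lam \<omega> l (\<beta> z) s x)"
    "(\<integral>z. hit lam \<omega> l (\<beta> z) s x \<partial>M) = hit lam \<omega> l (\<lambda>y. \<integral>z. \<beta> z y \<partial>M) s x" by auto
qed

lemma wgt_add: "wgt lam \<omega> m \<gamma> l n N (\<lambda>x. \<beta> x + \<beta>' x) = wgt lam \<omega> m \<gamma> l n N \<beta> + wgt lam \<omega> m \<gamma> l n N \<beta>'"
  by (simp add: wgt_def hit_add sum.distrib algebra_simps)

lemma wgt_cmult: "wgt lam \<omega> m \<gamma> l n N (\<lambda>x. c * \<beta> x) = c * wgt lam \<omega> m \<gamma> l n N \<beta>"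
  by (simp add: wgt_def hit_cmult sum_distrib_left algebra_simps)

lemma wgt_cong:
  assumes "\<And>w. length w < l \<Longrightarrow> \<omega> w = \<omega>' w" "\<And>w. length w = l \<Longrightarrow> \<beta> w = \<beta>' w"
  shows "wgt lam \<omega> m \<gamma> l n N \<beta> = wgt lam \<omega>' m \<gamma> l n N \<beta>'"
  unfolding wgt_def using hit_cong[of l \<omega> \<omega>' \<beta> \<beta>' lam] assms by simp

lemma wgt_nonneg: "0 < lam \<Longrightarrow> 0 \<le> m \<Longrightarrow> 0 \<le> \<gamma> \<Longrightarrow> (\<And>x. 0 \<le> \<beta> x) \<Longrightarrow> 0 \<le> wgt lam \<omega> m \<gamma> l n N \<beta>"
  unfolding wgt_def by (intro sum_nonneg mult_nonneg_nonneg hit_nonneg) auto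

lemma wgt_mono: "0 < lam \<Longrightarrow> 0 \<le> m \<Longrightarrow> 0 \<le> \<gamma> \<Longrightarrow> (\<And>x. \<beta> x \<le> \<beta>' x) \<Longrightarrow> wgt lam \<omega> m \<gamma> l n N \<beta> \<le> wgt lam \<omega> m \<gamma> l n N \<beta>'"
  unfolding wgt_def by (intro sum_mono mult_left_mono hit_mono) auto

lemma measurable_wgt [measurable (raw)]:
  assumes "\<And>x. (\<lambda>z. w z x) \<in> measurable M (count_space UNIV)" "\<And>x. (\<lambda>z. \<beta> z x) \<in> borel_measurable M"
  shows "(\<lambda>z. wgt lam (w z) m \<gamma> l n N (\<beta> z)) \<in> borel_measurable M"
  unfolding wgt_def using measurable_hit[OF assms] by measurable

lemma integral_wgt:
  assumes "\<And>y. integrable M (\<lambda>z. \<beta> z y)"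
  shows "integrable M (\<lambda>z. wgt lam \<omega> m \<gamma> l n N (\<beta> z))"
    "(\<integral>z. wgt lam \<omega> m \<gamma> l n N (\<beta> z) \<partial>M) = wgt lam \<omega> m \<gamma> l n N (\<lambda>y. \<integral>z. \<beta> z y \<partial>M)"
  using integral_hit[of M \<beta> lam \<omega> l _ "[]"] assms unfolding wgt_def by simp_all

text \<open>Turns an almost sure statement with a random threshold into a deterministic threshold
  that works with probability close to one.\<close>

lemma (in prob_space) eventually_AE_tail:
  assumes [measurable]: "\<And>n. Measurable.pred M (P n)" and ev: "AE x in M. eventually (\<lambda>n. P n x) sequentially"
  shows "(\<lambda>n. prob {x \<in> space M. \<not> P n x}) \<longlonglongrightarrow> 0"
proof -
  have "(\<lambda>n. \<integral>x. (of_bool (\<not> P n x) :: real) \<partial>M) \<longlonglongrightarrow> (\<integral>x. 0 \<partial>M)"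
  proof (rule integral_dominated_convergence[where w = "\<lambda>_. 1"])
    show "AE x in M. (\<lambda>n. of_bool (\<not> P n x) :: real) \<longlonglongrightarrow> 0"
      using ev
    proof eventually_elim
      case (elim x)
      have "eventually (\<lambda>n. of_bool (\<not> P n x) = (0::real)) sequentially"
        using elim by eventually_elim simp
      then show ?case by (rule tendsto_eventually)
    qed
  qed auto
  moreover have "(\<integral>x. (of_bool (\<not> P n x) :: real) \<partial>M) = prob {x \<in> space M. \<not> P n x}" for n
  proof -
    have "(\<integral>x. (of_bool (\<not> P n x) :: real) \<partial>M) = (\<integral>x. indicator {x \<in> space M. \<not> P n x} x \<partial>M)"
      by (intro Bochner_Integration.integral_cong) (auto simp: indicator_def)
    then show ?thesis by simp
  qed
  ultimately show ?thesis by simp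
qed

locale environment =
  fixes p :: "nat pmf" and d :: nat and lam :: real
  assumes set_p: "set_pmf p \<subseteq> {d..}" and p_d: "0 < pmf p d" and lam0: "0 < lam" and lam_d: "lam < d" and d2: "2 \<le> d"
begin

abbreviation "E \<equiv> ppm (\<lambda>_ :: nat list. p)"

sublocale E: prob_space E by (rule prob_space_ppm)

abbreviation "\<rho> \<equiv> biased.rho lam d"
abbreviation "\<sigma> \<equiv> biased.ratio lam d"

lemma AE_biased: "AE \<omega> in E. biased lam \<omega> d"
proof -
  have "AE \<omega> in E. \<forall>x. d \<le> \<omega> x"
    unfolding AE_all_countable using set_p by (intro allI AE_coord) auto
  then show ?thesis
  proof eventually_elim
    case (elim \<omega>)
    then show ?case using lam0 lam_d d2 by unfold_locales (auto intro: less_le_trans[of 0 d])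
  qed
qed

lemma biased_const: "biased lam (\<lambda>_. d) d"
  using lam0 lam_d d2 by unfold_locales auto

lemmas rho_pos = biased.rho_pos[OF biased_const] and rho_less = biased.rho_less[OF biased_const]
  and ratio_pos = biased.ratio_pos[OF biased_const] and ratio_less = biased.ratio_less[OF biased_const]

lemma prob_eq_integral:
  assumes "Measurable.pred coords P"
  shows "measure E {\<omega>. P \<omega>} = (\<integral>\<omega>. of_bool (P \<omega>) \<partial>E)"
proof -
  have "(\<integral>\<omega>. of_bool (P \<omega>) \<partial>E) = (\<integral>\<omega>. (indicator {\<omega>. P \<omega>} \<omega> :: real) \<partial>E)"
    by (intro Bochner_Integration.integral_cong) (auto simp: indicator_def)
  then show ?thesis by simp
qed

lemma prob_regular_pos:
  assumes "finite F"
  shows "0 < measure E {\<omega>. \<forall>w\<in>F. \<omega> w = d}"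
proof -
  have "measure E {\<omega>. \<forall>w\<in>F. \<omega> w = d} = (\<integral>\<omega>. of_bool (\<forall>w\<in>F. \<omega> w = d) \<partial>E)"
    using assms by (intro prob_eq_integral) measurable
  also have "\<dots> = (\<integral>\<omega>. (\<Prod>w\<in>F. of_bool (\<omega> w = d)) \<partial>E)"
  proof (intro Bochner_Integration.integral_cong refl)
    show "of_bool (\<forall>w\<in>F. \<omega> w = d) = (\<Prod>w\<in>F. of_bool (\<omega> w = d) :: real)" for \<omega>
    proof (cases "\<forall>w\<in>F. \<omega> w = d")
      case False
      then have "(\<Prod>w\<in>F. of_bool (\<omega> w = d)) = (0 :: real)" using assms by (intro prod_zero) auto
      with False show ?thesis by simp
    qed simp
  qed
  also have "\<dots> = (\<Prod>w\<in>F. \<integral>\<omega>. of_bool (\<omega> w = d) \<partial>E)"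
    using assms by (intro integral_prod_independent[where A = "\<lambda>w. {w}"]) (auto simp: depends_on_def disjoint_family_on_def)
  also have "\<dots> = (\<Prod>w\<in>F. pmf p d)"
  proof (intro prod.cong refl)
    fix w
    have "(\<integral>\<omega>. of_bool (\<omega> w = d) \<partial>E) = measure_pmf.expectation p (\<lambda>k. of_bool (k = d) :: real)"
      by (rule integral_coord)
    also have "\<dots> = pmf p d" by (subst integral_measure_pmf_real[where A = "{d}"]) auto
    finally show "(\<integral>\<omega>. of_bool (\<omega> w = d) \<partial>E) = pmf p d" .
  qed
  also have "0 < \<dots>" using p_d by (simp add: prod_pos)
  finally show ?thesis .
qed

text \<open>A trap below a child yields a trap below the root, so the probability \<open>\<pi>\<close> of having none satisfies \<open>\<pi> \<le> \<pi> * \<pi>\<close>.\<close>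

lemma AE_recur:
  assumes g: "0 < \<gamma>" "\<gamma> < \<rho>"
  shows "AE \<omega> in E. \<exists>H. recur lam \<gamma> H \<omega>"
proof -
  let ?Z = "\<lambda>\<omega>. \<exists>H. recur lam \<gamma> H \<omega>"
  have m [measurable]: "Measurable.pred coords ?Z" by measurable
  have m' [measurable]: "Measurable.pred coords (\<lambda>\<omega>. ?Z (\<lambda>w. \<omega> (i # w)))" for i
    by (rule measurable_compose[OF measurable_reindex m])
  define \<pi> where "\<pi> = (\<integral>\<omega>. (of_bool (\<not> ?Z \<omega>) :: real) \<partial>E)"
  have sub: "(\<integral>\<omega>. of_bool (\<not> ?Z (\<lambda>w. \<omega> (i # w))) \<partial>E) = \<pi>" for i
    unfolding \<pi>_def using integral_reindex[of "(#) i" "\<lambda>\<omega>. of_bool (\<not> ?Z \<omega>)" "\<lambda>_. p"] by (simp add: inj_def)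
  have "\<pi> \<le> (\<integral>\<omega>. of_bool (\<not> ?Z (\<lambda>w. \<omega> (0 # w))) * of_bool (\<not> ?Z (\<lambda>w. \<omega> (1 # w))) \<partial>E)"
    unfolding \<pi>_def
  proof (rule integral_mono_AE)
    show "integrable E (\<lambda>\<omega>. of_bool (\<not> ?Z \<omega>) :: real)"
      "integrable E (\<lambda>\<omega>. of_bool (\<not> ?Z (\<lambda>w. \<omega> (0 # w))) * of_bool (\<not> ?Z (\<lambda>w. \<omega> (1 # w))) :: real)"
      by (rule integrable_ppm[of _ 1]; simp)+
    show "AE \<omega> in E. of_bool (\<not> ?Z \<omega>) \<le> of_bool (\<not> ?Z (\<lambda>w. \<omega> (0 # w))) * (of_bool (\<not> ?Z (\<lambda>w. \<omega> (1 # w))) :: real)"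
      using AE_biased
    proof eventually_elim
      case (elim \<omega>)
      then interpret biased lam \<omega> d .
      have "?Z \<omega>" if "?Z (\<lambda>w. \<omega> (i # w))" "i < 2" for i
        using that recur_sub[OF lam0 deg_pos, where i = i and \<gamma> = \<gamma>] deg_ge[of "[]"] d2 g rho_less by auto
      then show ?case by auto
    qed
  qed
  also have "\<dots> = \<pi> * \<pi>"
    by (subst integral_mult_independent[where A = "range ((#) 0)" and A' = "range ((#) 1)" and B = 1 and C = 1])
       (use sub[of 0] sub[of 1] in \<open>auto simp: depends_on_def\<close>)
  finally have le: "\<pi> \<le> \<pi> * \<pi>" .
  \<comment> \<open>A regular piece of height \<open>h\<close> is a trap of rate
    \<open>\<rho> * cos (pi / (h + 1))\<close>, which exceeds \<open>\<gamma>\<close> for large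
    \<open>h\<close>. The piece involves finitely many vertices and so has positive probability,
    which yields \<open>\<pi> < 1\<close>.\<close>
  have "(\<lambda>h. \<rho> * cos (pi / (real h + 1))) \<longlonglongrightarrow> \<rho> * cos 0"
    by (intro tendsto_intros) (auto intro!: tendsto_divide_0[OF tendsto_const] filterlim_at_top_imp_at_infinity filterlim_tendsto_add_at_top[OF tendsto_const, of _ _ 1, unfolded add.commute[of 1]] filterlim_real_sequentially)
  then have "eventually (\<lambda>h. \<gamma> < \<rho> * cos (pi / (real h + 1))) sequentially"
    using g by (intro order_tendstoD(1)) auto
  moreover have "eventually (\<lambda>h::nat. 2 \<le> h) sequentially" by (rule eventually_ge_at_top)
  ultimately have "eventually (\<lambda>h. \<gamma> < \<rho> * cos (pi / (real h + 1)) \<and> 2 \<le> h) sequentially" by eventually_elim auto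
  then obtain h where h: "\<gamma> < \<rho> * cos (pi / (real h + 1))" "2 \<le> h" by (auto simp: eventually_sequentially)
  define F where "F = {w :: nat list. length w < h \<and> set w \<subseteq> {..<d}}"
  have "finite {w :: nat list. set w \<subseteq> {..<d} \<and> length w \<le> h}" by (rule finite_lists_length_le) simp
  then have F: "finite F" unfolding F_def by (rule finite_subset[rotated]) auto
  have "0 < measure E {\<omega>. \<forall>w\<in>F. \<omega> w = d}" using F by (rule prob_regular_pos)
  also have "\<dots> \<le> measure E {\<omega>. ?Z \<omega>}"
  proof (rule E.finite_measure_mono_AE)
    show "AE \<omega> in E. \<omega> \<in> {\<omega>. \<forall>w\<in>F. \<omega> w = d} \<longrightarrow> \<omega> \<in> {\<omega>. ?Z \<omega>}"
      using AE_biased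
    proof eventually_elim
      case (elim \<omega>)
      then interpret biased lam \<omega> d .
      show ?case using recur_of_regular[of h \<gamma>] h g by (auto simp: F_def add.commute)
    qed
    show "{\<omega>. ?Z \<omega>} \<in> E.events" using measurable_sets[OF m, of "{True}"] by (simp add: vimage_def space_PiM)
  qed
  also have "\<dots> = (\<integral>\<omega>. 1 - of_bool (\<not> ?Z \<omega>) \<partial>E)"
    unfolding prob_eq_integral[OF m] by (intro Bochner_Integration.integral_cong) auto
  also have "\<dots> = 1 - \<pi>"
    unfolding \<pi>_def using E.prob_space integrable_ppm[of "\<lambda>\<omega>. of_bool (\<not> ?Z \<omega>)" 1 "\<lambda>_. p"] by simp
  finally have "\<pi> < 1" by simp
  moreover have "0 \<le> \<pi>" unfolding \<pi>_def by simp
  ultimately have "\<pi> = 0" using le by (metis less_le mult_less_cancel_left2 not_less)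
  then have "AE \<omega> in E. of_bool (\<not> ?Z \<omega>) = (0::real)"
    unfolding \<pi>_def by (subst (asm) integral_nonneg_eq_0_iff_AE) (auto intro: integrable_ppm[of _ 1])
  then show ?thesis by eventually_elim (simp split: if_splits)
qed

text \<open>\<open>x\<close> bounds the exponential decay of the slow event, and
  \<open>x * m * \<gamma> / \<rho>\<close> is the net growth rate of the weight. The linear factor
  with arbitrary \<open>K\<close> is what \<open>block_hits\<close> consumes; its constant involves
  \<open>H\<close> and \<open>D\<close>.\<close>

lemma wgt_large:
  fixes a x m \<gamma> :: real
  assumes a: "0 < a" and x: "0 < x" "AE \<omega> in E. eventually (\<lambda>n. x ^ n \<le> quenched.stay lam \<omega> (nat \<lceil>a * n\<rceil>) n []) sequentially"
    and m: "1 \<le> m" and g: "0 < \<gamma>" "\<gamma> \<le> \<rho>" "1 < x * m * \<gamma> / \<rho>"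
  obtains c :: nat where "AE \<omega> in E. \<forall>K::real. eventually (\<lambda>n. K * (c * n + n + 1) \<le> wgt lam \<omega> m \<gamma> (nat \<lceil>a * n\<rceil>) n (c * n + n) (\<lambda>_. 1)) sequentially"
proof -
  define s where "s = 1 / \<sigma>"
  have s1: "1 < s" using ratio_pos ratio_less by (simp add: s_def)
  have "(\<lambda>c. \<rho> ^ c) \<longlonglongrightarrow> 0" using rho_pos rho_less by (intro LIMSEQ_power_zero) auto
  moreover have "0 < x / s powr a" using x(1) s1 by (intro divide_pos_pos) auto
  ultimately have "eventually (\<lambda>c. \<rho> ^ c < x / s powr a) sequentially" by (intro order_tendstoD(2)) auto
  \<comment> \<open>With \<open>M = c * n\<close> the last term of \<open>stay_le_Psi\<close> is of
    order \<open>(\<rho> ^ (c + 1) * s powr a) ^ n\<close>, negligible against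
    \<open>x ^ n\<close>.\<close>
  then obtain c where c: "\<rho> ^ c < x / s powr a" by (auto simp: eventually_sequentially)
  define y where "y = \<rho> ^ (c + 1) * s powr a / x"
  have y: "0 \<le> y" "y < 1"
  proof -
    show "0 \<le> y" unfolding y_def using rho_pos x s1 by simp
    have "\<rho> ^ c * s powr a < x" using c s1 by (simp add: pos_less_divide_eq)
    then have "\<rho> * (\<rho> ^ c * s powr a) < 1 * x" using rho_pos rho_less s1
      by (intro mult_strict_mono) auto
    then show "y < 1" unfolding y_def using x by simp
  qed
  define z where "z = x * m * \<gamma> / \<rho>"
  define e where "e = 1 - \<sigma>\<^sup>2"
  have e: "0 < e" unfolding e_def using ratio_pos ratio_less by (simp add: power_less_one_iff)
  show thesis
  proof (rule that[of c])
    show "AE \<omega> in E. \<forall>K::real. eventually (\<lambda>n. K * (c * n + n + 1) \<le> wgt lam \<omega> m \<gamma> (nat \<lceil>a * n\<rceil>) n (c * n + n) (\<lambda>_. 1)) sequentially"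
      using x(2) AE_biased
    proof eventually_elim
      case (elim \<omega>)
      then interpret biased lam \<omega> d by simp
      show ?case
      proof
        fix K :: real
        have "(\<lambda>n. s * y ^ n) \<longlonglongrightarrow> s * 0" using y by (intro tendsto_mult tendsto_const LIMSEQ_power_zero) auto
        then have ev1: "eventually (\<lambda>n. s * y ^ n < e / 2) sequentially"
          using e by (intro order_tendstoD(2)) auto
        have "(\<lambda>n. K * (real c * n + n + 1) * (1 + lam * n) / z ^ n) \<longlonglongrightarrow> 0"
          using g unfolding z_def[symmetric] by real_asymp
        then have ev2: "eventually (\<lambda>n. K * (real c * n + n + 1) * (1 + lam * n) / z ^ n < e / 2) sequentially"
          using e by (intro order_tendstoD(2)) auto
        show "eventually (\<lambda>n. K * (c * n + n + 1) \<le> wgt lam \<omega> m \<gamma> (nat \<lceil>a * n\<rceil>) n (c * n + n) (\<lambda>_. 1)) sequentially"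
          using elim(1) ev1 ev2 eventually_gt_at_top[of 0]
        proof eventually_elim
          case (elim n)
          let ?l = "nat \<lceil>a * n\<rceil>"
          have l: "0 < ?l" using a elim by simp
          have "\<rho> ^ (n + c * n) / \<sigma> ^ ?l = \<rho> ^ (n + c * n) * s ^ ?l" by (simp add: s_def power_divide)
          also have "s ^ ?l = s powr real ?l" using s1 by (simp add: powr_realpow)
          also have "\<dots> \<le> s powr (a * n + 1)" using s1 a by (intro powr_mono) (auto, linarith?)
          also have "\<dots> = (s powr a) ^ n * s" using s1 by (simp add: powr_add powr_powr[symmetric] powr_realpow)
          finally have "\<rho> ^ (n + c * n) / \<sigma> ^ ?l \<le> \<rho> ^ (n + c * n) * ((s powr a) ^ n * s)"
            using rho_pos by (simp add: mult_left_mono)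
          also have "\<dots> = x ^ n * (s * y ^ n)"
            using x unfolding y_def by (simp add: power_divide power_mult_distrib power_add power_mult[symmetric] mult_ac)
          also have "\<dots> \<le> x ^ n * (e / 2)" using elim x by (intro mult_left_mono) auto
          finally have A: "\<rho> ^ (n + c * n) / \<sigma> ^ ?l \<le> x ^ n * (e / 2)" .
          have "e * x ^ n \<le> e * stay ?l n []" using elim e by (intro mult_left_mono) auto
          also have "\<dots> \<le> (1 + lam * n) * Psi ?l (c * n) n [] + \<rho> ^ (n + c * n) / \<sigma> ^ ?l"
            unfolding e_def by (rule stay_le_Psi[OF l])
          finally have B: "x ^ n * (e / 2) \<le> (1 + lam * n) * Psi ?l (c * n) n []"
            using A by (simp add: algebra_simps)
          have pos: "0 < 1 + lam * n" using lam0 by (simp add: add_pos_nonneg)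
          have zp: "z ^ n = x ^ n * (m ^ n * (\<gamma> / \<rho>) ^ n)"
            unfolding z_def by (simp add: power_mult_distrib power_divide)
          have z0: "0 < z" using x m g rho_pos unfolding z_def by simp
          have "K * (real c * n + n + 1) * (1 + lam * n) / z ^ n * z ^ n \<le> e / 2 * z ^ n"
            using elim z0 by (intro mult_right_mono) auto
          moreover have "K * (real c * n + n + 1) * (1 + lam * n) / z ^ n * z ^ n = K * (real c * n + n + 1) * (1 + lam * n)"
            using z0 by simp
          ultimately have "K * (real c * n + n + 1) * (1 + lam * n) \<le> (m ^ n * (\<gamma> / \<rho>) ^ n) * (x ^ n * (e / 2))"
            by (simp only: zp mult_ac)
          also have "\<dots> \<le> (m ^ n * (\<gamma> / \<rho>) ^ n) * ((1 + lam * n) * Psi ?l (c * n) n [])"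
            using B m g rho_pos by (intro mult_left_mono) auto
          also have "\<dots> \<le> wgt lam \<omega> m \<gamma> ?l n (c * n + n) (\<lambda>_. 1) * (1 + lam * n)"
            using mult_right_mono[OF wgt_ge_Psi[OF m g(1,2), of n ?l "c * n"], of "1 + lam * n"] pos by (simp add: mult_ac)
          finally have "K * (real c * n + n + 1) \<le> wgt lam \<omega> m \<gamma> ?l n (c * n + n) (\<lambda>_. 1)"
            using pos by simp
          then show ?case by (simp add: add.commute)
        qed
      qed
    qed
  qed
qed

end

section \<open>Good subtrees have probability close to one\<close>

locale branching_environment = environment +
  fixes \<mu> :: "nat pmf" and m :: real
  assumes mu0: "pmf \<mu> 0 = 0" and mu1: "pmf \<mu> 1 < 1"
    and mu_mean: "summable (\<lambda>k. real k * pmf \<mu> k)" and m_def: "m = (\<Sum>k. real k * pmf \<mu> k)"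
begin

text \<open>Stated for the killed walk, so that the quality of a subtree is a function of its own
  environment.\<close>

definition good :: "real \<Rightarrow> real \<Rightarrow> real \<Rightarrow> nat \<Rightarrow> (nat list \<Rightarrow> nat) \<Rightarrow> bool" where
  "good a C \<theta> j \<omega> \<longleftrightarrow> \<theta> \<le> sv \<mu> (step_op False lam \<omega>) j (slow a C) []"

lemma measurable_good: "Measurable.pred coords (good a C \<theta> j)"
  unfolding good_def by measurable

lemma measurable_good_shift [measurable]: "Measurable.pred coords (\<lambda>\<omega>. good a C \<theta> j (\<lambda>w. \<omega> (h w)))"
  by (rule measurable_compose[OF measurable_reindex measurable_good])

text \<open>What a block needs apart from good subtrees at its exit level: a trap, a bound on the
  root degree so that stepping to a chosen child is not too unlikely, and enough weight below each
  of two children.\<close>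

definition nice :: "real \<Rightarrow> real \<Rightarrow> nat \<Rightarrow> nat \<Rightarrow> real \<Rightarrow> nat \<Rightarrow> nat \<Rightarrow> nat \<Rightarrow> (nat list \<Rightarrow> nat) \<Rightarrow> bool" where
  "nice m' \<gamma> H D W l n N \<omega> \<longleftrightarrow> recur lam \<gamma> H \<omega> \<and> \<omega> [] \<le> D \<and>
     (\<forall>i<2. W \<le> wgt lam (\<lambda>w. \<omega> (i # w)) m' \<gamma> l n N (\<lambda>_. 1))"

lemma measurable_nice: "Measurable.pred coords (nice m' \<gamma> H D W l n N)"
  unfolding nice_def by measurable

text \<open>\<open>W\<close> is twice the loss in \<open>block_hits\<close>, so half of it suffices
  to reproduce the value \<open>\<theta>\<close> at the root. \<open>\<theta>\<close> is so small
  that all means stay below \<open>q0\<close>, where the linear comparison in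
  \<open>sv_ge_hits\<close> is valid.\<close>

lemma good_step:
  fixes a m' \<gamma> W \<theta> q0 :: real and H D l n N j i :: nat
  assumes "biased lam \<omega> d" and nice: "nice m' \<gamma> H D W l n N \<omega>" and H: "H \<le> l"
    and lin: "\<And>q. 0 \<le> q \<Longrightarrow> q \<le> q0 \<Longrightarrow> m' * q \<le> hit_prob \<mu> q" and q0: "0 < q0" "q0 \<le> 1"
    and m': "1 \<le> m'" and g: "0 < \<gamma>" "\<gamma> \<le> 1" and nN: "0 < n" "n \<le> N" "Suc l \<le> a * n"
    and W: "W = 2 * real H * (lam + D) * (real N + 1) / \<gamma>" and th: "\<theta> = q0 / ((real N + 3) * m' ^ (N + 2))"
    and i: "i < 2" and w: "W / 2 \<le> wgt lam (\<lambda>w. \<omega> (i # w)) m' \<gamma> l n N (\<lambda>w. of_bool (good a (Suc l) \<theta> j (\<lambda>v. \<omega> (i # w @ v))))"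
  shows "good a (Suc l) \<theta> (Suc j) \<omega>"
proof -
  interpret biased lam \<omega> d by fact
  have H0: "0 < H" using nice unfolding nice_def recur_def by (auto dest: spec[of _ 0] intro: gr0I)
  have th0: "0 < \<theta>" unfolding th using q0 m' by simp
  define \<beta> where "\<beta> z = \<theta> * of_bool (good a (Suc l) \<theta> j (\<lambda>v. \<omega> (z @ v)))" for z
  have c: "0 < \<gamma> / (H * (lam + D) * (real N + 1))" using g H0 lam0 by (intro divide_pos_pos mult_pos_pos) (auto intro: add_pos_nonneg)
  have one: "\<gamma> / (H * (lam + D) * (real N + 1)) * (W / 2) = 1"
    unfolding W using g H0 lam0 by (simp add: field_simps add_pos_nonneg less_imp_neq[symmetric])
  have "\<theta> = \<theta> * (\<gamma> / (H * (lam + D) * (real N + 1)) * (W / 2))" unfolding one by simp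
  also have "\<dots> = \<gamma> / (H * (lam + D) * (real N + 1)) * (\<theta> * (W / 2))" by (rule mult.left_commute)
  also have "\<dots> \<le> \<gamma> / (H * (lam + D) * (real N + 1)) * (\<theta> * wgt lam (\<lambda>w. \<omega> (i # w)) m' \<gamma> l n N (\<lambda>w. of_bool (good a (Suc l) \<theta> j (\<lambda>v. \<omega> (i # w @ v)))))"
    using w c th0 by (intro mult_left_mono) auto
  also have "\<dots> = \<gamma> / (H * (lam + D) * (real N + 1)) * (\<Sum>s\<le>N. m' ^ max n s * \<gamma> ^ (n - s) * hit lam (\<lambda>w. \<omega> (i # w)) l (\<lambda>w. \<beta> (i # w)) s [])"
    unfolding wgt_cmult[where c = \<theta>, symmetric] by (simp add: wgt_def \<beta>_def)
  also have "\<dots> \<le> (\<Sum>t\<in>{n..N + 2}. m' ^ t * hit lam \<omega> (Suc l) \<beta> t [])"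
  proof (rule block_hits)
    show "recur lam \<gamma> H \<omega>" "\<omega> [] \<le> D" using nice by (auto simp: nice_def)
    show "i < \<omega> []" using i deg_ge[of "[]"] d2 by simp
    show "0 \<le> \<beta> x" for x using th0 by (simp add: \<beta>_def)
  qed (use H m' g nN in auto)
  also have "\<dots> \<le> sv \<mu> (step_op False lam \<omega>) (Suc j) (slow a (Suc l)) []"
  proof (rule sv_ge_hits[where \<theta> = \<theta> and ?q0.0 = q0])
    show "m' * q \<le> hit_prob \<mu> q" if "0 \<le> q" "q \<le> q0" for q using that by (rule lin)
    show "0 \<le> \<beta> x" "\<beta> x \<le> \<theta>" for x using th0 by (auto simp: \<beta>_def)
    show "real (N + 2 + 1) * m' ^ (N + 2) * \<theta> \<le> q0"
      unfolding th using m' by (simp add: add.commute)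
    show "\<beta> z \<le> sv \<mu> (step_op False lam \<omega>) j (slow a (real (Suc l) + real (Suc l))) z" if "length z = Suc l" for z
    proof -
      have "sv \<mu> (step_op False lam (\<lambda>w. \<omega> (z @ w))) j (slow a (Suc l)) [] \<le> sv \<mu> (step_op False lam \<omega>) j (slow a (real (Suc l) + length z)) (z @ [])"
        by (rule sv_shift) (auto simp: lam0 deg_pos)
      moreover have "0 \<le> sv \<mu> (step_op False lam \<omega>) j (slow a (real (Suc l) + real (Suc l))) z"
        using sv_bounds[of lam \<omega>] lam_pos deg_pos by blast
      ultimately show ?thesis using that unfolding \<beta>_def good_def by (auto simp: that)
    qed
  qed (use m' q0 nN in auto)
  finally show ?thesis unfolding good_def .
qed

section \<open>The quadratic recursion for bad subtrees\<close>

definition miss :: "real \<Rightarrow> real \<Rightarrow> real \<Rightarrow> nat \<Rightarrow> real" where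
  "miss a C \<theta> j = measure E {\<omega>. \<not> good a C \<theta> j \<omega>}"

lemma integral_not_good:
  assumes "inj h"
  shows "(\<integral>\<omega>. of_bool (\<not> good a C \<theta> j (\<lambda>w. \<omega> (h w))) \<partial>E) = miss a C \<theta> j"
proof -
  have [measurable]: "Measurable.pred coords (good a C \<theta> j)" by (rule measurable_good)
  have "(\<integral>\<omega>. of_bool (\<not> good a C \<theta> j (\<lambda>w. \<omega> (h w))) \<partial>E) = (\<integral>\<omega>. (of_bool (\<not> good a C \<theta> j \<omega>) :: real) \<partial>E)"
    using integral_reindex[OF assms, of "\<lambda>\<omega>. of_bool (\<not> good a C \<theta> j \<omega>)" "\<lambda>_. p"] by simp
  then show ?thesis unfolding miss_def by (subst prob_eq_integral) auto
qed

lemma integrable_not_good: "integrable E (\<lambda>\<omega>. of_bool (\<not> good a C \<theta> j (\<lambda>w. \<omega> (h w))) :: real)"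
  by (rule integrable_ppm[of _ 1]) auto

text \<open>\<open>\<Lambda>\<close> is linear in its boundary values, so the mean of the product
  reduces to pairs of exit vertices below different children. Their subtrees are disjoint, hence
  both are bad with probability the square of \<open>miss\<close>.\<close>

lemma integral_wgt_pair:
  fixes a C \<theta> m' \<gamma> :: real and \<omega> :: "nat list \<Rightarrow> nat" and j l n N i i' :: nat
  assumes mg: "0 \<le> m'" "0 \<le> \<gamma>"
  defines "B \<equiv> \<lambda>i (\<omega>' :: nat list \<Rightarrow> nat) z. of_bool (\<not> good a C \<theta> j (\<lambda>v. \<omega>' (i # z @ v))) :: real"
  defines "\<Lambda> \<equiv> \<lambda>i. wgt lam (\<lambda>w. \<omega> (i # w)) m' \<gamma> l n N"
  assumes ij: "i \<noteq> i'"
  shows "(\<integral>\<omega>'. \<Lambda> i (B i \<omega>') * \<Lambda> i' (B i' \<omega>') \<partial>E) = (miss a C \<theta> j)\<^sup>2 * (\<Lambda> i (\<lambda>_. 1) * \<Lambda> i' (\<lambda>_. 1))"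
proof -
  have lin: "\<Lambda> k (\<lambda>z. c * \<beta> z) = c * \<Lambda> k \<beta>" for k c \<beta> unfolding \<Lambda>_def by (rule wgt_cmult)
  have Bm [measurable]: "(\<lambda>\<omega>'. B k \<omega>' z) \<in> borel_measurable coords" for k z
    unfolding B_def by measurable
  have BB: "(\<integral>\<omega>'. B i \<omega>' z * B i' \<omega>' z' \<partial>E) = (miss a C \<theta> j)\<^sup>2" for z z'
  proof -
    have "(\<integral>\<omega>'. B i \<omega>' z * B i' \<omega>' z' \<partial>E) = (\<integral>\<omega>'. B i \<omega>' z \<partial>E) * (\<integral>\<omega>'. B i' \<omega>' z' \<partial>E)"
    proof (rule integral_mult_independent[where A = "range (\<lambda>v. i # z @ v)" and A' = "range (\<lambda>v. i' # z' @ v)" and B = 1 and C = 1])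
      show "depends_on (\<lambda>\<omega>'. B i \<omega>' z) (range (\<lambda>v. i # z @ v))" "depends_on (\<lambda>\<omega>'. B i' \<omega>' z') (range (\<lambda>v. i' # z' @ v))"
        by (auto simp: depends_on_def B_def)
    qed (use ij in \<open>auto simp: B_def\<close>)
    then show ?thesis unfolding B_def
      by (simp add: integral_not_good[of "\<lambda>v. i # z @ v"] integral_not_good[of "\<lambda>v. i' # z' @ v"] inj_def power2_eq_square)
  qed
  have int2: "integrable E (\<lambda>\<omega>'. B i \<omega>' z * B i' \<omega>' z')" for z z'
    by (rule integrable_ppm[of _ 1]) (auto simp: B_def)
  have 1: "integrable E (\<lambda>\<omega>'. \<Lambda> i' (\<lambda>z'. B i \<omega>' z * B i' \<omega>' z'))"
    "(\<integral>\<omega>'. \<Lambda> i' (\<lambda>z'. B i \<omega>' z * B i' \<omega>' z') \<partial>E) = (miss a C \<theta> j)\<^sup>2 * \<Lambda> i' (\<lambda>_. 1)" for z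
    using integral_wgt[of E "\<lambda>\<omega>' z'. B i \<omega>' z * B i' \<omega>' z'", OF int2] lin[of i' "(miss a C \<theta> j)\<^sup>2" "\<lambda>_. 1"]
    unfolding \<Lambda>_def by (simp_all add: BB)
  have "(\<integral>\<omega>'. \<Lambda> i (B i \<omega>') * \<Lambda> i' (B i' \<omega>') \<partial>E) = (\<integral>\<omega>'. \<Lambda> i (\<lambda>z. \<Lambda> i' (\<lambda>z'. B i \<omega>' z * B i' \<omega>' z')) \<partial>E)"
  proof (intro Bochner_Integration.integral_cong refl)
    fix \<omega>'
    have "\<Lambda> i (\<lambda>z. \<Lambda> i' (\<lambda>z'. B i \<omega>' z * B i' \<omega>' z')) = \<Lambda> i (\<lambda>z. \<Lambda> i' (B i' \<omega>') * B i \<omega>' z)"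
      by (simp add: lin mult.commute)
    then show "\<Lambda> i (B i \<omega>') * \<Lambda> i' (B i' \<omega>') = \<Lambda> i (\<lambda>z. \<Lambda> i' (\<lambda>z'. B i \<omega>' z * B i' \<omega>' z'))"
      unfolding lin by simp
  qed
  also have "\<dots> = \<Lambda> i (\<lambda>z. (\<integral>\<omega>'. \<Lambda> i' (\<lambda>z'. B i \<omega>' z * B i' \<omega>' z') \<partial>E))"
    using integral_wgt(2)[of E "\<lambda>\<omega>' z. \<Lambda> i' (\<lambda>z'. B i \<omega>' z * B i' \<omega>' z')", OF 1(1)] unfolding \<Lambda>_def by simp
  also have "\<dots> = (miss a C \<theta> j)\<^sup>2 * (\<Lambda> i (\<lambda>_. 1) * \<Lambda> i' (\<lambda>_. 1))"
    using lin[of i "(miss a C \<theta> j)\<^sup>2 * \<Lambda> i' (\<lambda>_. 1)" "\<lambda>_. 1"] by (simp add: 1(2))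
  finally show ?thesis .
qed

text \<open>\<open>\<Phi>\<close> is the Markov bound for the event that, below both children, more than half of the weight at level
  \<open>Suc l\<close> sits at roots of bad subtrees.\<close>

lemma miss_Suc:
  fixes a m' \<gamma> W \<theta> q0 :: real and H D l n N j :: nat
  assumes lin: "\<And>q. 0 \<le> q \<Longrightarrow> q \<le> q0 \<Longrightarrow> m' * q \<le> hit_prob \<mu> q" and q0: "0 < q0" "q0 \<le> 1"
    and m': "1 \<le> m'" and g: "0 < \<gamma>" "\<gamma> \<le> 1" and nN: "0 < n" "n \<le> N" "Suc l \<le> a * n" and H: "0 < H" "H \<le> l"
    and W: "W = 2 * real H * (lam + D) * (real N + 1) / \<gamma>" and th: "\<theta> = q0 / ((real N + 3) * m' ^ (N + 2))"
  shows "miss a (Suc l) \<theta> (Suc j) \<le> measure E {\<omega>. \<not> nice m' \<gamma> H D W l n N \<omega>} + 4 * (miss a (Suc l) \<theta> j)\<^sup>2"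
proof -
  let ?nice = "nice m' \<gamma> H D W l n N"
  define B where "B i \<omega>' z = (of_bool (\<not> good a (Suc l) \<theta> j (\<lambda>v. \<omega>' (i # z @ v))) :: real)" for i \<omega>' z
  define \<Lambda> where "\<Lambda> i \<omega> = wgt lam (\<lambda>w. \<omega> (i # w)) m' \<gamma> l n N" for i :: nat and \<omega> :: "nat list \<Rightarrow> nat"
  \<comment> \<open>Division by zero gives \<open>\<Phi> \<omega> = 0\<close> when a weight
    vanishes. This is harmless: on \<open>nice\<close> both weights are at least
    \<open>W > 0\<close>.\<close>
  define \<Phi> where "\<Phi> \<omega> = 4 / (\<Lambda> 0 \<omega> (\<lambda>_. 1) * \<Lambda> 1 \<omega> (\<lambda>_. 1)) * (\<Lambda> 0 \<omega> (B 0 \<omega>) * \<Lambda> 1 \<omega> (B 1 \<omega>))" for \<omega>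
  have W0: "0 < W" unfolding W using H g lam0 by (auto intro!: divide_pos_pos mult_pos_pos add_pos_nonneg)
  have Bb: "0 \<le> B i \<omega> z" "B i \<omega> z \<le> 1" for i \<omega> z by (auto simp: B_def)
  have L0: "0 \<le> \<Lambda> i \<omega> \<beta>" if "\<And>z. 0 \<le> \<beta> z" for i \<omega> \<beta>
    unfolding \<Lambda>_def using that lam0 m' g by (intro wgt_nonneg) auto
  have LB: "\<Lambda> i \<omega> (B i \<omega>') \<le> \<Lambda> i \<omega> (\<lambda>_. 1)" for i \<omega> \<omega>'
    unfolding \<Lambda>_def using lam0 m' g Bb by (intro wgt_mono) auto
  have Bm [measurable]: "(\<lambda>\<omega>. B i \<omega> z) \<in> borel_measurable coords" for i z
    unfolding B_def by measurable
  have Lm [measurable]: "(\<lambda>\<omega>. \<Lambda> i \<omega> (\<lambda>_. 1)) \<in> borel_measurable coords" "(\<lambda>\<omega>. \<Lambda> i \<omega> (B i \<omega>)) \<in> borel_measurable coords" for i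
    unfolding \<Lambda>_def by measurable
  have \<Phi>m [measurable]: "\<Phi> \<in> borel_measurable coords" unfolding \<Phi>_def by measurable
  have ratio: "0 \<le> 4 / (x * y) * (u * v)" "4 / (x * y) * (u * v) \<le> 4" if "0 \<le> u" "u \<le> x" "0 \<le> v" "v \<le> y" for u v x y :: real
  proof -
    show "0 \<le> 4 / (x * y) * (u * v)" using that by simp
    have "u * v \<le> x * y" using that by (intro mult_mono) auto
    then show "4 / (x * y) * (u * v) \<le> 4" using that by (cases "x * y = 0") (auto simp: divide_le_eq zero_less_mult_iff less_le)
  qed
  have \<Phi>b: "0 \<le> \<Phi> \<omega>" "\<Phi> \<omega> \<le> 4" for \<omega>
    unfolding \<Phi>_def by (intro ratio L0 LB Bb)+
  have nm [measurable]: "Measurable.pred coords ?nice" by (rule measurable_nice)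
  have gm [measurable]: "Measurable.pred coords (good a (Suc l) \<theta> (Suc j))" by (rule measurable_good)
  have AE: "AE \<omega> in E. (of_bool (\<not> good a (Suc l) \<theta> (Suc j) \<omega>) :: real) \<le> of_bool (\<not> ?nice \<omega>) + \<Phi> \<omega>"
    using AE_biased
  proof eventually_elim
    case (elim \<omega>)
    show ?case
    proof (cases "good a (Suc l) \<theta> (Suc j) \<omega> \<or> \<not> ?nice \<omega>")
      case True
      then show ?thesis using \<Phi>b(1)[of \<omega>] by auto
    next
      case False
      then have ni: "?nice \<omega>" by simp
      have half: "\<Lambda> i \<omega> (\<lambda>_. 1) \<le> 2 * \<Lambda> i \<omega> (B i \<omega>)" "W \<le> \<Lambda> i \<omega> (\<lambda>_. 1)" if "i < 2" for i
      proof -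
        let ?G = "\<lambda>w. of_bool (good a (Suc l) \<theta> j (\<lambda>v. \<omega> (i # w @ v)))"
        have "\<not> W / 2 \<le> \<Lambda> i \<omega> ?G"
          using good_step[OF elim ni H(2) lin q0 m' g nN W th that, of j] False unfolding \<Lambda>_def by blast
        moreover have "\<Lambda> i \<omega> (\<lambda>_. 1) = \<Lambda> i \<omega> ?G + \<Lambda> i \<omega> (B i \<omega>)"
          unfolding \<Lambda>_def wgt_add[symmetric] by (intro wgt_cong) (auto simp: B_def)
        moreover show W: "W \<le> \<Lambda> i \<omega> (\<lambda>_. 1)" using ni that unfolding nice_def \<Lambda>_def by auto
        ultimately show "\<Lambda> i \<omega> (\<lambda>_. 1) \<le> 2 * \<Lambda> i \<omega> (B i \<omega>)" by linarith
      qed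
      have p: "0 < \<Lambda> 0 \<omega> (\<lambda>_. 1)" "0 < \<Lambda> 1 \<omega> (\<lambda>_. 1)" using half(2)[of 0] half(2)[of 1] W0 by auto
      have "\<Lambda> 0 \<omega> (\<lambda>_. 1) * \<Lambda> 1 \<omega> (\<lambda>_. 1) \<le> (2 * \<Lambda> 0 \<omega> (B 0 \<omega>)) * (2 * \<Lambda> 1 \<omega> (B 1 \<omega>))"
        using half(1)[of 0] half(1)[of 1] p L0[of "B 0 \<omega>"] Bb by (intro mult_mono) auto
      then have "1 \<le> \<Phi> \<omega>" using p unfolding \<Phi>_def by (simp add: pos_le_divide_eq)
      then show ?thesis by auto
    qed
  qed
  have i1: "integrable E (\<lambda>\<omega>. of_bool (\<not> good a (Suc l) \<theta> (Suc j) \<omega>) :: real)" "integrable E (\<lambda>\<omega>. of_bool (\<not> ?nice \<omega>) :: real)"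
    by (rule integrable_ppm[of _ 1]; simp)+
  have i2: "integrable E \<Phi>" using \<Phi>b by (intro integrable_ppm[of _ 4]) (auto simp: abs_le_iff intro: order_trans[of _ 0])
  \<comment> \<open>The coefficients in the weights read levels up to \<open>l\<close> only, and the
    relevant indicators \<open>B\<close> read levels from \<open>Suc l\<close> on, so the latter are
    averaged first.\<close>
  have "(\<integral>\<omega>. \<Phi> \<omega> \<partial>E) = (\<integral>\<omega>. (\<integral>\<omega>'. \<Phi> (mix {w. length w \<le> l} \<omega> \<omega>') \<partial>E) \<partial>E)"
    using \<Phi>b by (intro integral_mix[where B = 4]) (auto simp: abs_le_iff intro: order_trans[of _ 0])
  also have "\<dots> = (\<integral>\<omega>. 4 / (\<Lambda> 0 \<omega> (\<lambda>_. 1) * \<Lambda> 1 \<omega> (\<lambda>_. 1)) * ((miss a (Suc l) \<theta> j)\<^sup>2 * (\<Lambda> 0 \<omega> (\<lambda>_. 1) * \<Lambda> 1 \<omega> (\<lambda>_. 1))) \<partial>E)"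
  proof (intro Bochner_Integration.integral_cong refl)
    fix \<omega>
    have 1: "\<Lambda> i (mix {w. length w \<le> l} \<omega> \<omega>') (\<lambda>_. 1) = \<Lambda> i \<omega> (\<lambda>_. 1)" for i \<omega>'
      unfolding \<Lambda>_def by (intro wgt_cong) (auto simp: mix_def)
    have 2: "\<Lambda> i (mix {w. length w \<le> l} \<omega> \<omega>') (B i (mix {w. length w \<le> l} \<omega> \<omega>')) = \<Lambda> i \<omega> (B i \<omega>')" for i \<omega>'
      unfolding \<Lambda>_def by (intro wgt_cong) (auto simp: mix_def B_def)
    have "(\<integral>\<omega>'. \<Phi> (mix {w. length w \<le> l} \<omega> \<omega>') \<partial>E)
       = 4 / (\<Lambda> 0 \<omega> (\<lambda>_. 1) * \<Lambda> 1 \<omega> (\<lambda>_. 1)) * (\<integral>\<omega>'. \<Lambda> 0 \<omega> (B 0 \<omega>') * \<Lambda> 1 \<omega> (B 1 \<omega>') \<partial>E)"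
      unfolding \<Phi>_def 1 2 by (rule integral_mult_right_zero)
    also have "(\<integral>\<omega>'. \<Lambda> 0 \<omega> (B 0 \<omega>') * \<Lambda> 1 \<omega> (B 1 \<omega>') \<partial>E) = (miss a (Suc l) \<theta> j)\<^sup>2 * (\<Lambda> 0 \<omega> (\<lambda>_. 1) * \<Lambda> 1 \<omega> (\<lambda>_. 1))"
      unfolding B_def \<Lambda>_def using m' g by (intro integral_wgt_pair) auto
    finally show "(\<integral>\<omega>'. \<Phi> (mix {w. length w \<le> l} \<omega> \<omega>') \<partial>E) = 4 / (\<Lambda> 0 \<omega> (\<lambda>_. 1) * \<Lambda> 1 \<omega> (\<lambda>_. 1)) * ((miss a (Suc l) \<theta> j)\<^sup>2 * (\<Lambda> 0 \<omega> (\<lambda>_. 1) * \<Lambda> 1 \<omega> (\<lambda>_. 1)))" .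
  qed
  also have "\<dots> \<le> 4 * (miss a (Suc l) \<theta> j)\<^sup>2"
  proof (rule integral_ppm_bounds(2))
    show "(\<lambda>\<omega>. 4 / (\<Lambda> 0 \<omega> (\<lambda>_. 1) * \<Lambda> 1 \<omega> (\<lambda>_. 1)) * ((miss a (Suc l) \<theta> j)\<^sup>2 * (\<Lambda> 0 \<omega> (\<lambda>_. 1) * \<Lambda> 1 \<omega> (\<lambda>_. 1)))) \<in> borel_measurable coords"
      by measurable
    fix \<omega>
    have L: "0 \<le> \<Lambda> 0 \<omega> (\<lambda>_. 1)" "0 \<le> \<Lambda> 1 \<omega> (\<lambda>_. 1)" by (intro L0; simp)+
    then show "0 \<le> 4 / (\<Lambda> 0 \<omega> (\<lambda>_. 1) * \<Lambda> 1 \<omega> (\<lambda>_. 1)) * ((miss a (Suc l) \<theta> j)\<^sup>2 * (\<Lambda> 0 \<omega> (\<lambda>_. 1) * \<Lambda> 1 \<omega> (\<lambda>_. 1)))" by simp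
    show "4 / (\<Lambda> 0 \<omega> (\<lambda>_. 1) * \<Lambda> 1 \<omega> (\<lambda>_. 1)) * ((miss a (Suc l) \<theta> j)\<^sup>2 * (\<Lambda> 0 \<omega> (\<lambda>_. 1) * \<Lambda> 1 \<omega> (\<lambda>_. 1))) \<le> 4 * (miss a (Suc l) \<theta> j)\<^sup>2"
      by (cases "\<Lambda> 0 \<omega> (\<lambda>_. 1) * \<Lambda> 1 \<omega> (\<lambda>_. 1) = 0") auto
  qed
  finally have P: "(\<integral>\<omega>. \<Phi> \<omega> \<partial>E) \<le> 4 * (miss a (Suc l) \<theta> j)\<^sup>2" .
  have "miss a (Suc l) \<theta> (Suc j) = (\<integral>\<omega>. of_bool (\<not> good a (Suc l) \<theta> (Suc j) \<omega>) \<partial>E)"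
    unfolding miss_def by (rule prob_eq_integral) simp
  also have "\<dots> \<le> (\<integral>\<omega>. of_bool (\<not> ?nice \<omega>) + \<Phi> \<omega> \<partial>E)"
    using i1 i2 AE by (intro integral_mono_AE) auto
  also have "\<dots> = measure E {\<omega>. \<not> ?nice \<omega>} + (\<integral>\<omega>. \<Phi> \<omega> \<partial>E)"
    using i1 i2 by (subst prob_eq_integral) auto
  finally show ?thesis using P by linarith
qed

text \<open>Each of four bad events gets \<open>\<eta> / 4\<close>. \<open>H\<close> and
  \<open>D\<close> are fixed before \<open>n\<close>, since they determine the weight that has to be
  exceeded. The gap between \<open>a\<close> and \<open>a'\<close> pays for rounding and for the
  additional level.\<close>

lemma nice_exists:
  fixes a a' x m' \<gamma> \<eta> :: real
  assumes a: "0 < a" "a < a'" and x: "0 < x" "AE \<omega> in E. eventually (\<lambda>n. x ^ n \<le> quenched.stay lam \<omega> (nat \<lceil>a * n\<rceil>) n []) sequentially"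
    and m': "1 \<le> m'" and g: "0 < \<gamma>" "\<gamma> < \<rho>" "1 < x * m' * \<gamma> / \<rho>" and e: "0 < \<eta>"
  obtains H D l n N where "0 < H" "H \<le> l" "0 < n" "n \<le> N" "Suc l \<le> a' * n"
    "measure E {\<omega>. \<not> nice m' \<gamma> H D (2 * real H * (lam + D) * (real N + 1) / \<gamma>) l n N \<omega>} \<le> \<eta>"
proof -
  have lim: "\<exists>n0. \<forall>n\<ge>n0. measure E {\<omega>. \<not> P n \<omega>} < \<eta> / 4"
    if "\<And>n. Measurable.pred E (P n)" "AE \<omega> in E. eventually (\<lambda>n. P n \<omega>) sequentially" for P :: "nat \<Rightarrow> (nat list \<Rightarrow> nat) \<Rightarrow> bool"
  proof -
    have "(\<lambda>n. measure E {\<omega> \<in> space E. \<not> P n \<omega>}) \<longlonglongrightarrow> 0" by (rule E.eventually_AE_tail[OF that])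
    then have "eventually (\<lambda>n. measure E {\<omega>. \<not> P n \<omega>} < \<eta> / 4) sequentially"
      using e by (intro order_tendstoD(2)) auto
    then show ?thesis by (simp add: eventually_sequentially)
  qed
  have "\<exists>n0. \<forall>H\<ge>n0. measure E {\<omega>. \<not> recur lam \<gamma> H \<omega>} < \<eta> / 4"
  proof (rule lim)
    show "AE \<omega> in E. eventually (\<lambda>H. recur lam \<gamma> H \<omega>) sequentially"
      using AE_recur[OF g(1,2)]
    proof eventually_elim
      case (elim \<omega>)
      then obtain H where "recur lam \<gamma> H \<omega>" by blast
      then show ?case unfolding eventually_sequentially using recur_mono[OF lam0] by blast
    qed
  qed measurable
  then obtain H0 where H0: "\<And>H. H \<ge> H0 \<Longrightarrow> measure E {\<omega>. \<not> recur lam \<gamma> H \<omega>} < \<eta> / 4" by blast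
  define H where "H = max 1 H0"
  have H: "0 < H" "measure E {\<omega>. \<not> recur lam \<gamma> H \<omega>} < \<eta> / 4" using H0[of H] by (auto simp: H_def)
  have "\<exists>n0. \<forall>D\<ge>n0. measure E {\<omega>. \<not> \<omega> [] \<le> D} < \<eta> / 4"
    by (rule lim) (auto simp: eventually_sequentially)
  then obtain D where D: "measure E {\<omega>. \<not> \<omega> [] \<le> D} < \<eta> / 4" by blast
  obtain c :: nat where c: "AE \<omega> in E. \<forall>K::real. eventually (\<lambda>n. K * (c * n + n + 1) \<le> wgt lam \<omega> m' \<gamma> (nat \<lceil>a * n\<rceil>) n (c * n + n) (\<lambda>_. 1)) sequentially"
    using wgt_large[OF a(1) x m' g(1) less_imp_le[OF g(2)] g(3)] by blast
  define K where "K = 2 * real H * (lam + D) / \<gamma>"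
  have ex: "\<exists>n0. \<forall>n\<ge>n0. measure E {\<omega>. \<not> (K * (real c * n + n + 1) \<le> wgt lam (\<lambda>w. \<omega> (i # w)) m' \<gamma> (nat \<lceil>a * n\<rceil>) n (c * n + n) (\<lambda>_. 1))} < \<eta> / 4" for i
  proof (rule lim)
    show "AE \<omega> in E. eventually (\<lambda>n. K * (real c * n + n + 1) \<le> wgt lam (\<lambda>w. \<omega> (i # w)) m' \<gamma> (nat \<lceil>a * n\<rceil>) n (c * n + n) (\<lambda>_. 1)) sequentially"
    proof (rule AE_reindex[where h = "(#) i" and P = "\<lambda>\<omega>. eventually (\<lambda>n. K * (real c * n + n + 1) \<le> wgt lam \<omega> m' \<gamma> (nat \<lceil>a * n\<rceil>) n (c * n + n) (\<lambda>_. 1)) sequentially"])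
      show "AE \<omega> in E. eventually (\<lambda>n. K * (real c * n + n + 1) \<le> wgt lam \<omega> m' \<gamma> (nat \<lceil>a * n\<rceil>) n (c * n + n) (\<lambda>_. 1)) sequentially"
        using c
      proof eventually_elim
        case (elim \<omega>)
        then show ?case by (auto dest!: spec[of _ K] simp: add_ac)
      qed
    qed (simp add: inj_def)
  qed measurable
  obtain n0 where n0: "\<And>n. n \<ge> n0 \<Longrightarrow> measure E {\<omega>. \<not> (K * (real c * n + n + 1) \<le> wgt lam (\<lambda>w. \<omega> (0 # w)) m' \<gamma> (nat \<lceil>a * n\<rceil>) n (c * n + n) (\<lambda>_. 1))} < \<eta> / 4"
    using ex[of 0] by blast
  obtain n1 where n1: "\<And>n. n \<ge> n1 \<Longrightarrow> measure E {\<omega>. \<not> (K * (real c * n + n + 1) \<le> wgt lam (\<lambda>w. \<omega> (1 # w)) m' \<gamma> (nat \<lceil>a * n\<rceil>) n (c * n + n) (\<lambda>_. 1))} < \<eta> / 4"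
    using ex[of 1] by blast
  obtain n where n: "n0 \<le> n" "n1 \<le> n" "0 < n" "H / a \<le> n" "2 / (a' - a) \<le> n"
  proof -
    let ?n = "Max {n0, n1, 1, nat \<lceil>H / a\<rceil>, nat \<lceil>2 / (a' - a)\<rceil>}"
    have "y \<le> ?n" if "y \<in> {n0, n1, 1, nat \<lceil>H / a\<rceil>, nat \<lceil>2 / (a' - a)\<rceil>}" for y using that by (intro Max_ge) auto
    then have "n0 \<le> ?n" "n1 \<le> ?n" "1 \<le> ?n" "nat \<lceil>H / a\<rceil> \<le> ?n" "nat \<lceil>2 / (a' - a)\<rceil> \<le> ?n" by blast+
    then show thesis by (intro that[of ?n]) linarith+
  qed
  define l N where "l = nat \<lceil>a * n\<rceil>" and "N = c * n + n"
  have l: "H \<le> l" "Suc l \<le> a' * n"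
  proof -
    have "H \<le> a * n" using n a by (simp add: divide_le_eq mult.commute)
    then show "H \<le> l" unfolding l_def by linarith
    have "2 \<le> (a' - a) * n" using n a by (simp add: divide_le_eq mult.commute)
    then have "a * n + 2 \<le> a' * n" by (simp add: algebra_simps)
    moreover have "0 \<le> a * n" using a by simp
    ultimately show "Suc l \<le> a' * n" unfolding l_def by linarith
  qed
  let ?W = "2 * real H * (lam + D) * (real N + 1) / \<gamma>"
  have W: "?W = K * (real c * n + n + 1)" by (simp add: K_def N_def)
  let ?A = "{\<omega>. \<not> recur lam \<gamma> H \<omega>}" and ?B = "{\<omega>. \<not> \<omega> [] \<le> D}"
    and ?C = "\<lambda>i. {\<omega>. \<not> (K * (real c * n + n + 1) \<le> wgt lam (\<lambda>w. \<omega> (i # w)) m' \<gamma> l n N (\<lambda>_. 1))}"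
  have C: "measure E (?C 0) < \<eta> / 4" "measure E (?C 1) < \<eta> / 4"
    using n0[OF n(1)] n1[OF n(2)] unfolding l_def N_def by simp_all
  have ev: "Measurable.pred coords P \<Longrightarrow> {\<omega>. P \<omega>} \<in> E.events" for P
    using measurable_sets[of P coords "count_space UNIV" "{True}"] by (simp add: vimage_def space_PiM)
  have sets: "?A \<in> E.events" "?B \<in> E.events" "?C i \<in> E.events" for i
    by (rule ev; measurable)+
  have sub: "{\<omega>. \<not> nice m' \<gamma> H D ?W l n N \<omega>} \<subseteq> (?A \<union> ?B) \<union> (?C 0 \<union> ?C 1)"
    unfolding nice_def W by (auto simp: less_2_cases_iff)
  have "measure E {\<omega>. \<not> nice m' \<gamma> H D ?W l n N \<omega>} \<le> measure E ((?A \<union> ?B) \<union> (?C 0 \<union> ?C 1))"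
    using sub sets by (intro E.finite_measure_mono) auto
  also have "\<dots> \<le> measure E (?A \<union> ?B) + measure E (?C 0 \<union> ?C 1)"
    using sets by (intro measure_Un_le) auto
  also have "\<dots> \<le> (measure E ?A + measure E ?B) + (measure E (?C 0) + measure E (?C 1))"
    using sets by (intro add_mono measure_Un_le) auto
  also have "\<dots> \<le> \<eta>" using H D C by linarith
  finally have fin: "measure E {\<omega>. \<not> nice m' \<gamma> H D ?W l n N \<omega>} \<le> \<eta>" .
  have nN: "n \<le> N" by (simp add: N_def)
  show thesis by (rule that[OF H(1) l(1) n(3) nN l(2) fin])
qed

lemma miss_small:
  fixes a a' x \<epsilon> :: real
  assumes a: "0 < a" "a < a'" and x: "0 < x" "AE \<omega> in E. eventually (\<lambda>n. x ^ n \<le> quenched.stay lam \<omega> (nat \<lceil>a * n\<rceil>) n []) sequentially"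
    and xm: "1 < x * m" and m1: "1 < m" and e: "0 < \<epsilon>"
  obtains C \<theta> where "0 \<le> C" "0 < \<theta>" "\<theta> \<le> 1" "\<And>j. miss a' C \<theta> j \<le> \<epsilon>"
proof -
  \<comment> \<open>A value above 1 and \<open>1 / x\<close> but below \<open>m\<close>: the gap to
    \<open>m\<close> is needed for the linear lower bound on \<open>hit_prob\<close>, the gap to
    \<open>1 / x\<close> for growth of the weight.\<close>
  define m' where "m' = max ((1 + m) / 2) ((m + 1 / x) / 2)"
  have m': "1 \<le> m'" "m' < m" "1 < x * m'"
  proof -
    have xm': "1 / x < m" using xm x by (simp add: divide_less_eq mult.commute)
    show "1 \<le> m'" "m' < m" using m1 xm' by (auto simp: m'_def le_max_iff_disj)
    have "1 / x < m'" using xm' by (auto simp: m'_def less_max_iff_disj)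
    then show "1 < x * m'" using x by (simp add: divide_less_eq mult.commute)
  qed
  \<comment> \<open>This makes \<open>x * m' * \<gamma> / \<rho>\<close> the midpoint of 1 and
    \<open>x * m'\<close>.\<close>
  define \<gamma> where "\<gamma> = \<rho> * ((1 + 1 / (x * m')) / 2)"
  have g: "0 < \<gamma>" "\<gamma> < \<rho>" "1 < x * m' * \<gamma> / \<rho>"
  proof -
    have t: "1 / (x * m') < 1" "0 < 1 / (x * m')" using m' x by auto
    have "0 < 1 + 1 / (x * m')" using t(2) by linarith
    then show "0 < \<gamma>" unfolding \<gamma>_def using rho_pos by simp
    show "\<gamma> < \<rho>" unfolding \<gamma>_def using rho_pos t by auto
    have "x * m' * \<gamma> / \<rho> = (x * m' + 1) / 2" unfolding \<gamma>_def using rho_pos x m' by (simp add: field_simps)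
    moreover have "1 < (x * m' + 1) / 2" using m' by simp
    ultimately show "1 < x * m' * \<gamma> / \<rho>" by (simp only:)
  qed
  obtain q0 where q0: "0 < q0" "q0 \<le> 1" "\<And>q. 0 \<le> q \<Longrightarrow> q \<le> q0 \<Longrightarrow> m' * q \<le> hit_prob \<mu> q"
    using hit_prob_ge_linear[OF mu_mean, of m'] m' m_def by metis
  \<comment> \<open>For \<open>\<eta> \<le> 1 / 16\<close> the bound \<open>2 * \<eta>\<close> is
    preserved by the recursion, as
    \<open>\<eta> + 4 * (2 * \<eta>)\<^sup>2 \<le> 2 * \<eta>\<close>. It holds initially because
    every subtree is good at horizon 0.\<close>
  define \<eta> where "\<eta> = min (1 / 16) (\<epsilon> / 2)"
  have eta: "0 < \<eta>" "\<eta> \<le> 1 / 16" "2 * \<eta> \<le> \<epsilon>" using e by (auto simp: \<eta>_def)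
  obtain H D l n N where B: "0 < H" "H \<le> l" "0 < n" "n \<le> N" "Suc l \<le> a' * n"
    "measure E {\<omega>. \<not> nice m' \<gamma> H D (2 * real H * (lam + D) * (real N + 1) / \<gamma>) l n N \<omega>} \<le> \<eta>"
    by (rule nice_exists[OF a x m'(1) g eta(1)])
  define \<theta> where "\<theta> = q0 / ((real N + 3) * m' ^ (N + 2))"
  have th: "0 < \<theta>" "\<theta> \<le> 1"
  proof -
    have "1 \<le> m' ^ (N + 2)" using m' by (intro one_le_power) auto
    then have "1 * 1 \<le> (real N + 3) * m' ^ (N + 2)" by (intro mult_mono) auto
    then show "0 < \<theta>" "\<theta> \<le> 1" unfolding \<theta>_def using q0 by (auto simp: divide_le_eq intro!: divide_pos_pos mult_pos_pos)
  qed
  have "miss a' (Suc l) \<theta> j \<le> 2 * \<eta>" for j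
  proof (induction j)
    case 0
    have "{\<omega>. \<not> good a' (Suc l) \<theta> 0 \<omega>} = {}" using th by (auto simp: good_def slow_0)
    then show ?case using eta by (simp add: miss_def)
  next
    case (Suc j)
    have "miss a' (Suc l) \<theta> (Suc j) \<le> \<eta> + 4 * (miss a' (Suc l) \<theta> j)\<^sup>2"
    proof -
      have "\<gamma> \<le> 1" using g(2) rho_less by linarith
      from miss_Suc[where D = D, OF q0(3,1,2) m'(1) g(1) this B(3,4,5,1,2) refl \<theta>_def, of j] B(6)
      show ?thesis by linarith
    qed
    also have "(miss a' (Suc l) \<theta> j)\<^sup>2 \<le> (2 * \<eta>)\<^sup>2"
      using Suc by (intro power_mono) (auto simp: miss_def)
    also have "\<eta> + 4 * (2 * \<eta>)\<^sup>2 = \<eta> + (16 * \<eta>) * \<eta>" by (simp add: power2_eq_square)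
    also have "\<dots> \<le> \<eta> + 1 * \<eta>" using eta by (intro add_left_mono mult_right_mono) auto
    finally show ?case by simp
  qed
  then show thesis using that[of "real (Suc l)" \<theta>] th eta by (auto intro: order_trans)
qed

end

section \<open>From good subtrees to almost sure survival of slow lines\<close>

text \<open>Expectation of \<open>\<beta>\<close> at the first visit to level \<open>k\<close>, with the value 1 if it does not occur within \<open>T\<close> steps.\<close>

primrec exit_mean :: "real \<Rightarrow> (nat list \<Rightarrow> nat) \<Rightarrow> nat \<Rightarrow> (nat list \<Rightarrow> real) \<Rightarrow> nat \<Rightarrow> nat list \<Rightarrow> real" where
  "exit_mean lam \<omega> k \<beta> 0 x = (if length x = k then \<beta> x else 1)"
| "exit_mean lam \<omega> k \<beta> (Suc T) x = (if length x = k then \<beta> x else step_op True lam \<omega> (exit_mean lam \<omega> k \<beta> T) x)"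

text \<open>Degree 0 is included, so that \<open>exit_mean\<close> is bounded, hence integrable, in
  every environment and not only in almost every one.\<close>

lemma step_op_bounds_any:
  assumes "0 < lam" "\<And>y. 0 \<le> \<phi> y" "\<And>y. \<phi> y \<le> c"
  shows "0 \<le> step_op b lam \<omega> \<phi> x \<and> step_op b lam \<omega> \<phi> x \<le> c"
proof (cases "\<omega> x = 0")
  case True
  have "0 \<le> c" using assms(2,3)[of x] by simp
  then show ?thesis using True assms by (simp add: step_op_def)
qed (use assms step_op_bounds[of lam \<omega> x \<phi> c b] in auto)

lemma exit_mean_bounds:
  assumes "0 < lam" "\<And>x. 0 \<le> \<beta> x" "\<And>x. \<beta> x \<le> 1"
  shows "0 \<le> exit_mean lam \<omega> k \<beta> T x \<and> exit_mean lam \<omega> k \<beta> T x \<le> 1"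
proof (induction T arbitrary: x)
  case (Suc T)
  then show ?case using assms step_op_bounds_any[OF assms(1), of "exit_mean lam \<omega> k \<beta> T" 1] by auto
qed (use assms in auto)

lemma exit_mean_mono:
  assumes "0 < lam" "\<And>x. \<beta> x \<le> \<beta>' x"
  shows "exit_mean lam \<omega> k \<beta> T x \<le> exit_mean lam \<omega> k \<beta>' T x"
  using assms by (induction T arbitrary: x) (auto intro: step_op_mono)

lemma exit_mean_cong:
  assumes "\<And>w. length w < k \<Longrightarrow> \<omega> w = \<omega>' w" "\<And>w. length w = k \<Longrightarrow> \<beta> w = \<beta>' w" "length x \<le> k"
  shows "exit_mean lam \<omega> k \<beta> T x = exit_mean lam \<omega>' k \<beta>' T x"
  using assms(3)
proof (induction T arbitrary: x)
  case (Suc T)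
  show ?case
  proof (cases "length x = k")
    case False
    then have "step_op True lam \<omega> (exit_mean lam \<omega> k \<beta> T) x = step_op True lam \<omega>' (exit_mean lam \<omega>' k \<beta>' T) x"
      using Suc assms(1) by (intro step_op_cong) auto
    then show ?thesis using False by simp
  qed (simp add: assms(2))
qed (simp add: assms(2))

lemma measurable_exit_mean [measurable (raw)]:
  assumes "\<And>x. (\<lambda>z. w z x) \<in> measurable M (count_space UNIV)" "\<And>x. (\<lambda>z. \<beta> z x) \<in> borel_measurable M"
  shows "(\<lambda>z. exit_mean lam (w z) k (\<beta> z) T x) \<in> borel_measurable M"
  using assms by (induction T arbitrary: x) (auto intro!: measurable_step_op)

lemma integral_exit_mean:
  assumes "prob_space M" "\<And>y. integrable M (\<lambda>z. \<beta> z y)"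
  shows "integrable M (\<lambda>z. exit_mean lam \<omega> k (\<beta> z) T x) \<and>
    (\<integral>z. exit_mean lam \<omega> k (\<beta> z) T x \<partial>M) = exit_mean lam \<omega> k (\<lambda>y. \<integral>z. \<beta> z y \<partial>M) T x"
proof (induction T arbitrary: x)
  case 0
  interpret prob_space M by fact
  show ?case using assms prob_space by auto
next
  case (Suc T)
  then show ?case
    using assms integral_step_op[of M "\<lambda>z. exit_mean lam \<omega> k (\<beta> z) T" True lam \<omega> x] by auto
qed

context branching_environment begin

lemma gfun_le: "0 \<le> q \<Longrightarrow> q \<le> 1 \<Longrightarrow> gfun \<mu> q \<le> q"
proof -
  assume q: "0 \<le> q" "q \<le> 1"
  have "(1 - pmf \<mu> 1) * q\<^sup>2 \<le> (1 - pmf \<mu> 1) * q"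
    using q by (intro mult_left_mono) (auto simp: power2_eq_square mult_left_le pmf_le_1)
  then show "gfun \<mu> q \<le> q" using gfun_le_quadratic[OF mu0 q] by (simp add: algebra_simps)
qed

lemma gfun_iter_bounds:
  assumes "0 \<le> q" "q \<le> 1"
  shows "0 \<le> (gfun \<mu> ^^ i) q \<and> (gfun \<mu> ^^ i) q \<le> 1"
  using assms by (induction i) (auto intro: gfun_bounds)

lemma gfun_iter_antimono:
  assumes "0 \<le> q" "q \<le> 1" "i \<le> j"
  shows "(gfun \<mu> ^^ j) q \<le> (gfun \<mu> ^^ i) q"
  by (rule lift_Suc_antimono_le[where f = "\<lambda>i. (gfun \<mu> ^^ i) q", OF _ assms(3)])
     (use gfun_iter_bounds[OF assms(1,2)] gfun_le in auto)

text \<open>Jensen's inequality is applied at each step; the default value 1 in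
  \<open>exit_mean\<close> does no harm, being a fixed point of \<open>gfun \<mu>\<close>.\<close>

lemma exit_mean_jensen:
  assumes "biased lam \<omega> d" "\<And>x. 0 \<le> \<beta> x" "\<And>x. \<beta> x \<le> 1"
  shows "gfun \<mu> (exit_mean lam \<omega> k \<beta> T x) \<le> exit_mean lam \<omega> k (\<lambda>z. gfun \<mu> (\<beta> z)) T x"
proof -
  interpret biased lam \<omega> d by fact
  show ?thesis
  proof (induction T arbitrary: x)
    case (Suc T)
    let ?U = "exit_mean lam \<omega> k \<beta> T"
    have "gfun \<mu> (step_op True lam \<omega> ?U x) \<le> step_op True lam \<omega> (\<lambda>y. gfun \<mu> (?U y)) x"
      using exit_mean_bounds[OF lam0 assms(2,3)] by (intro gfun_jensen) auto
    also have "\<dots> \<le> step_op True lam \<omega> (exit_mean lam \<omega> k (\<lambda>z. gfun \<mu> (\<beta> z)) T) x"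
      using Suc by (intro step_op_mono lam_pos) auto
    finally show ?case by simp
  qed (simp add: gfun_one)
qed

text \<open>The error term is the supersolution bound for not reaching level \<open>k\<close> within
  \<open>T\<close> steps.\<close>

lemma exit_mean_const:
  assumes "biased lam \<omega> d" "0 \<le> c" "length x \<le> k"
  shows "exit_mean lam \<omega> k (\<lambda>_. c) T x \<le> c + \<rho> ^ T * \<sigma> ^ length x / \<sigma> ^ k"
  using assms(3)
proof (induction T arbitrary: x)
  case 0
  have "1 \<le> \<sigma> ^ length x / \<sigma> ^ k"
    using 0 ratio_pos ratio_less by (simp add: le_divide_eq power_decreasing)
  then show ?case using assms by auto
next
  case (Suc T)
  interpret biased lam \<omega> d by fact
  show ?case
  proof (cases "length x = k")
    case True
    then show ?thesis using rho_pos ratio_pos by simp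
  next
    case False
    have "step_op True lam \<omega> (exit_mean lam \<omega> k (\<lambda>_. c) T) x \<le> step_op True lam \<omega> (\<lambda>y. c + (rho ^ T / ratio ^ k) * ratio ^ length y) x"
    proof (rule step_op_mono_level[OF lam_pos])
      fix y :: "nat list" assume "length y \<le> Suc (length x)"
      then show "exit_mean lam \<omega> k (\<lambda>_. c) T y \<le> c + (rho ^ T / ratio ^ k) * ratio ^ length y"
        using Suc.IH[of y] Suc.prems False by simp
    qed
    also have "\<dots> = c + (rho ^ T / ratio ^ k) * step_op True lam \<omega> (\<lambda>y. ratio ^ length y) x"
      unfolding step_op_add step_op_cmult by (simp add: step_op_const lam_pos deg_pos)
    also have "\<dots> \<le> c + (rho ^ T / ratio ^ k) * (rho * ratio ^ length x)"
      using rho_pos ratio_pos by (intro add_left_mono mult_left_mono step_op_ratio) auto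
    finally show ?thesis using False by (simp add: mult_ac)
  qed
qed

text \<open>The failure probability \<open>e\<close> satisfies \<open>e = g (K e)\<close>, and reaching level \<open>k\<close> from \<open>x\<close> takes at least
  \<open>k - length x\<close> steps, each of which contributes one application of \<open>g\<close> by Jensen's inequality.\<close>

lemma fail_le_exit_mean:
  fixes a C C' \<theta> :: real and \<omega> :: "nat list \<Rightarrow> nat" and i j k T :: nat
  assumes b: "biased lam \<omega> d" and th: "0 \<le> \<theta>" "\<theta> \<le> 1" and C: "0 \<le> C" and a: "0 \<le> a"
  defines "\<beta> \<equiv> \<lambda>z. 1 - \<theta> * of_bool (good a C \<theta> j (\<lambda>w. \<omega> (z @ w)))"
  assumes x: "length x \<le> k" "i \<le> j" "C + k \<le> C'"
  shows "1 - sv \<mu> (step_op True lam \<omega>) i (slow a C') x \<le> exit_mean lam \<omega> k (\<lambda>z. (gfun \<mu> ^^ (k - length x)) (\<beta> z)) T x"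
  using x
proof (induction T arbitrary: x i C')
  case 0
  interpret biased lam \<omega> d by fact
  show ?case
  proof (cases "length x = k")
    case True
    have "sv \<mu> (step_op False lam (\<lambda>w. \<omega> (x @ w))) j (slow a C) [] \<le> sv \<mu> (step_op True lam \<omega>) j (slow a (C + length x)) (x @ [])"
      by (rule sv_shift) (auto simp: lam0 deg_pos)
    also have "\<dots> \<le> sv \<mu> (step_op True lam \<omega>) j (slow a C') x"
      using 0 True by (simp, intro sv_slow_mono) (auto simp: lam0 deg_pos)
    also have "\<dots> \<le> sv \<mu> (step_op True lam \<omega>) i (slow a C') x"
      using 0 by (intro sv_antimono) (auto simp: lam0 deg_pos)
    finally have "1 - sv \<mu> (step_op True lam \<omega>) i (slow a C') x \<le> \<beta> x"
      using sv_bounds[of lam \<omega> \<mu> True i "slow a C'" x] lam0 deg_pos unfolding \<beta>_def good_def by auto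
    then show ?thesis using True by simp
  next
    case False
    then show ?thesis using sv_bounds[of lam \<omega> \<mu> True i "slow a C'" x] lam0 deg_pos by simp
  qed
next
  case (Suc T)
  interpret biased lam \<omega> d by fact
  have \<beta>: "0 \<le> \<beta> z" "\<beta> z \<le> 1" for z unfolding \<beta>_def using th by auto
  show ?case
  proof (cases "length x = k")
    case True
    then show ?thesis using Suc.IH[OF Suc.prems]
      by (cases T) simp_all
  next
    case False
    with Suc.prems have lt: "length x < k" by simp
    then have Cx: "real (length x) \<le> C'" using Suc.prems C by linarith
    let ?R = "exit_mean lam \<omega> k (\<lambda>z. (gfun \<mu> ^^ (k - length x)) (\<beta> z)) (Suc T) x"
    show ?thesis
    proof (cases i)
      case 0
      have "0 \<le> ?R"
        using exit_mean_bounds[OF lam0, of "\<lambda>z. (gfun \<mu> ^^ (k - length x)) (\<beta> z)" \<omega> k "Suc T" x] gfun_iter_bounds[OF \<beta>] by blast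
      then show ?thesis using 0 Cx by (simp add: slow_0)
    next
      case (Suc i')
      let ?s = "sv \<mu> (step_op True lam \<omega>) i' (slow a (C' + a))"
      define r where "r = k - length x - 1"
      have r: "k - length x = Suc r" using lt by (simp add: r_def)
      let ?U = "exit_mean lam \<omega> k (\<lambda>z. (gfun \<mu> ^^ r) (\<beta> z)) T"
      have s: "0 \<le> ?s y" "?s y \<le> 1" for y using sv_bounds[of lam \<omega>] lam0 deg_pos by auto
      have U: "0 \<le> ?U y" "?U y \<le> 1" for y
        using exit_mean_bounds[OF lam0, of "\<lambda>z. (gfun \<mu> ^^ r) (\<beta> z)" \<omega> k T y] gfun_iter_bounds[OF \<beta>] by auto
      have le: "1 - ?s y \<le> ?U y" if "length y \<le> Suc (length x)" for y
      proof -
        have "1 - ?s y \<le> exit_mean lam \<omega> k (\<lambda>z. (gfun \<mu> ^^ (k - length y)) (\<beta> z)) T y"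
          using Suc Suc.prems that lt a by (intro Suc.IH) auto
        \<comment> \<open>One step approaches level \<open>k\<close> by at most one, so at least
          \<open>r\<close> applications of \<open>g\<close> remain from \<open>y\<close>; further
          ones only lower the value.\<close>
        also have "\<dots> \<le> ?U y"
          using that lt by (intro exit_mean_mono lam0 gfun_iter_antimono \<beta>) (auto simp: r_def)
        finally show ?thesis .
      qed
      have "1 - sv \<mu> (step_op True lam \<omega>) i (slow a C') x = gfun \<mu> (1 - step_op True lam \<omega> ?s x)"
        using Suc Cx by (simp add: slow_0 slow_Suc hit_prob_def)
      also have "1 - step_op True lam \<omega> ?s x = step_op True lam \<omega> (\<lambda>y. 1 - ?s y) x"
        by (simp add: step_op_diff step_op_const lam_pos deg_pos)
      also have "gfun \<mu> \<dots> \<le> gfun \<mu> (step_op True lam \<omega> ?U x)"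
      proof (rule gfun_mono)
        show "0 \<le> step_op True lam \<omega> (\<lambda>y. 1 - ?s y) x" using s by (intro step_op_nonneg lam_pos) auto
        show "step_op True lam \<omega> (\<lambda>y. 1 - ?s y) x \<le> step_op True lam \<omega> ?U x"
          by (intro step_op_mono_level lam_pos le)
        show "step_op True lam \<omega> ?U x \<le> 1" using step_op_bounds_any[where \<phi> = ?U and c = 1 and b = True and \<omega> = \<omega> and x = x, OF lam0 U] by blast
      qed
      also have "\<dots> \<le> step_op True lam \<omega> (\<lambda>y. gfun \<mu> (?U y)) x" by (intro gfun_jensen U)
      also have "\<dots> \<le> step_op True lam \<omega> (exit_mean lam \<omega> k (\<lambda>z. gfun \<mu> ((gfun \<mu> ^^ r) (\<beta> z))) T) x"
        using gfun_iter_bounds[OF \<beta>] by (intro step_op_mono lam_pos exit_mean_jensen b) auto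
      also have "\<dots> = ?R" using False by (simp add: r)
      finally show ?thesis .
    qed
  qed
qed

definition fail :: "real \<Rightarrow> real \<Rightarrow> nat \<Rightarrow> (nat list \<Rightarrow> nat) \<Rightarrow> real" where
  "fail a C j \<omega> = 1 - sv \<mu> (step_op True lam \<omega>) j (slow a C) []"

lemma measurable_fail [measurable]: "fail a C j \<in> borel_measurable coords"
  unfolding fail_def by measurable

lemma fail_bounds: "biased lam \<omega> d \<Longrightarrow> 0 \<le> fail a C j \<omega> \<and> fail a C j \<omega> \<le> 1"
  unfolding fail_def biased_def quenched_def using sv_bounds[of lam \<omega> \<mu> True j "slow a C" "[]"] by auto

lemma integrable_fail: "integrable E (fail a C j)"
proof (rule E.integrable_const_bound[of _ 1])
  show "AE \<omega> in E. norm (fail a C j \<omega>) \<le> 1"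
    using AE_biased by eventually_elim (use fail_bounds in \<open>auto simp: abs_le_iff intro: order_trans[of _ 0]\<close>)
qed measurable

text \<open>\<open>\<theta>\<close> is fixed before \<open>k\<close>, so however small it is, the
  \<open>k\<close>-th iterate of \<open>g\<close> at \<open>1 - \<theta>\<close> can be brought
  below \<open>\<epsilon> / 2\<close>. A bad subtree at the exit vertex costs at most 1, but has
  probability at most \<open>\<epsilon> / 2\<close>.\<close>

lemma mean_fail_small:
  fixes a a' x \<epsilon> :: real
  assumes a: "0 < a" "a < a'" and x: "0 < x" "AE \<omega> in E. eventually (\<lambda>n. x ^ n \<le> quenched.stay lam \<omega> (nat \<lceil>a * n\<rceil>) n []) sequentially"
    and xm: "1 < x * m" and m1: "1 < m" and e: "0 < \<epsilon>"
  obtains C where "\<And>j. (\<integral>\<omega>. fail a' C j \<omega> \<partial>E) \<le> \<epsilon>"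
proof -
  obtain C \<theta> where C: "0 \<le> C" and th: "0 < \<theta>" "\<theta> \<le> 1" and miss: "\<And>j. miss a' C \<theta> j \<le> \<epsilon> / 2"
    by (rule miss_small[OF a x xm m1, of "\<epsilon> / 2"]) (use e in auto)
  have "(\<lambda>k. (gfun \<mu> ^^ k) (1 - \<theta>)) \<longlonglongrightarrow> 0" using th by (intro gfun_iterates_tendsto mu0 mu1) auto
  then have "eventually (\<lambda>k. (gfun \<mu> ^^ k) (1 - \<theta>) < \<epsilon> / 2) sequentially" using e by (intro order_tendstoD(2)) auto
  then obtain k where k: "(gfun \<mu> ^^ k) (1 - \<theta>) < \<epsilon> / 2" by (auto simp: eventually_sequentially)
  define c where "c = (gfun \<mu> ^^ k) (1 - \<theta>)"
  have c: "0 \<le> c" "c \<le> 1" "c < \<epsilon> / 2" using gfun_iter_bounds[of "1 - \<theta>" k] th k by (auto simp: c_def)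
  have main: "(\<integral>\<omega>. fail a' (C + k) j \<omega> \<partial>E) \<le> \<epsilon> + \<rho> ^ T / \<sigma> ^ k" for j T
  proof -
    \<comment> \<open>The \<open>k\<close>-th iterate of \<open>g\<close> at
      \<open>1 - \<theta>\<close> or at 1, according to the quality of the subtree at
      \<open>z\<close>.\<close>
    define \<beta> where "\<beta> \<omega> z = c + (1 - c) * of_bool (\<not> good a' C \<theta> j (\<lambda>w. \<omega> (z @ w)))" for \<omega> z
    have \<beta>: "0 \<le> \<beta> \<omega> z" "\<beta> \<omega> z \<le> 1" for \<omega> z unfolding \<beta>_def using c by auto
    have \<beta>m [measurable]: "(\<lambda>\<omega>. \<beta> \<omega> z) \<in> borel_measurable coords" for z unfolding \<beta>_def by measurable
    have U: "0 \<le> exit_mean lam \<omega> k (\<beta> \<omega>') T x" "exit_mean lam \<omega> k (\<beta> \<omega>') T x \<le> 1" for \<omega> \<omega>' x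
      using exit_mean_bounds[OF lam0 \<beta>] by auto
    have one: "(gfun \<mu> ^^ i) 1 = 1" for i by (induction i) (auto simp: gfun_one)
    have Um [measurable]: "(\<lambda>\<omega>. exit_mean lam \<omega> k (\<beta> \<omega>) T []) \<in> borel_measurable coords" by measurable
    have int: "integrable E (\<lambda>\<omega>'. \<beta> \<omega>' z)" for z
      using \<beta> by (intro integrable_ppm[of _ 1]) (auto simp: abs_le_iff intro: order_trans[of _ 0])
    have mean: "(\<integral>\<omega>'. \<beta> \<omega>' z \<partial>E) \<le> \<epsilon>" for z
    proof -
      have "(\<integral>\<omega>'. \<beta> \<omega>' z \<partial>E) = c + (1 - c) * miss a' C \<theta> j"
        unfolding \<beta>_def using integrable_not_good[of a' C \<theta> j "(@) z"] integral_not_good[of "(@) z" a' C \<theta> j] E.prob_space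
        by (simp add: inj_def)
      also have "\<dots> \<le> c + 1 * (\<epsilon> / 2)" using c miss[of j] e by (intro add_left_mono mult_mono) (auto simp: miss_def)
      also have "\<dots> \<le> \<epsilon>" using c by simp
      finally show ?thesis .
    qed
    have "(\<integral>\<omega>. fail a' (C + k) j \<omega> \<partial>E) \<le> (\<integral>\<omega>. exit_mean lam \<omega> k (\<beta> \<omega>) T [] \<partial>E)"
    proof (rule integral_mono_AE)
      show "integrable E (\<lambda>\<omega>. exit_mean lam \<omega> k (\<beta> \<omega>) T [])"
        using U by (intro integrable_ppm[of _ 1]) (auto simp: abs_le_iff intro: order_trans[of _ 0])
      show "AE \<omega> in E. fail a' (C + k) j \<omega> \<le> exit_mean lam \<omega> k (\<beta> \<omega>) T []"
        using AE_biased
      proof eventually_elim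
        case (elim \<omega>)
        have "fail a' (C + k) j \<omega> \<le> exit_mean lam \<omega> k (\<lambda>z. (gfun \<mu> ^^ (k - length ([] :: nat list))) (1 - \<theta> * of_bool (good a' C \<theta> j (\<lambda>w. \<omega> (z @ w))))) T []"
          unfolding fail_def using th C a by (intro fail_le_exit_mean elim) auto
        also have "\<dots> = exit_mean lam \<omega> k (\<beta> \<omega>) T []"
          by (intro exit_mean_cong) (auto simp: \<beta>_def c_def one of_bool_def)
        finally show ?case .
      qed
    qed (rule integrable_fail)
    \<comment> \<open>The law of the first vertex visited at level \<open>k\<close> depends on
      levels smaller than \<open>k\<close>, whereas \<open>\<beta>\<close> at that vertex reads
      levels from \<open>k\<close> on.\<close>
    also have "\<dots> = (\<integral>\<omega>. (\<integral>\<omega>'. exit_mean lam (mix {w. length w < k} \<omega> \<omega>') k (\<beta> (mix {w. length w < k} \<omega> \<omega>')) T [] \<partial>E) \<partial>E)"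
      using U by (intro integral_mix[where B = 1]) (auto simp: abs_le_iff intro: order_trans[of _ 0])
    also have "\<dots> = (\<integral>\<omega>. exit_mean lam \<omega> k (\<lambda>z. \<integral>\<omega>'. \<beta> \<omega>' z \<partial>E) T [] \<partial>E)"
    proof (intro Bochner_Integration.integral_cong refl)
      fix \<omega>
      have "exit_mean lam (mix {w. length w < k} \<omega> \<omega>') k (\<beta> (mix {w. length w < k} \<omega> \<omega>')) T [] = exit_mean lam \<omega> k (\<beta> \<omega>') T []" for \<omega>'
        by (intro exit_mean_cong) (auto simp: mix_def \<beta>_def)
      then show "(\<integral>\<omega>'. exit_mean lam (mix {w. length w < k} \<omega> \<omega>') k (\<beta> (mix {w. length w < k} \<omega> \<omega>')) T [] \<partial>E)
        = exit_mean lam \<omega> k (\<lambda>z. \<integral>\<omega>'. \<beta> \<omega>' z \<partial>E) T []"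
        using integral_exit_mean[OF E.prob_space_axioms int] by simp
    qed
    also have "\<dots> \<le> \<epsilon> + \<rho> ^ T / \<sigma> ^ k"
    proof (rule E.integral_le_const)
      show "AE \<omega> in E. exit_mean lam \<omega> k (\<lambda>z. \<integral>\<omega>'. \<beta> \<omega>' z \<partial>E) T [] \<le> \<epsilon> + \<rho> ^ T / \<sigma> ^ k"
        using AE_biased
      proof eventually_elim
        case (elim \<omega>)
        have "exit_mean lam \<omega> k (\<lambda>z. \<integral>\<omega>'. \<beta> \<omega>' z \<partial>E) T [] \<le> exit_mean lam \<omega> k (\<lambda>_. \<epsilon>) T []"
          by (intro exit_mean_mono lam0 mean)
        also have "\<dots> \<le> \<epsilon> + \<rho> ^ T / \<sigma> ^ k" using exit_mean_const[OF elim, of \<epsilon> "[]" k T] e by simp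
        finally show ?case .
      qed
      have M: "0 \<le> (\<integral>\<omega>'. \<beta> \<omega>' z \<partial>E)" "(\<integral>\<omega>'. \<beta> \<omega>' z \<partial>E) \<le> 1" for z
        using integral_ppm_bounds[where f = "\<lambda>\<omega>. \<beta> \<omega> z" and B = 1 and q = "\<lambda>_. p", OF \<beta>m \<beta>] by auto
      show "integrable E (\<lambda>\<omega>. exit_mean lam \<omega> k (\<lambda>z. \<integral>\<omega>'. \<beta> \<omega>' z \<partial>E) T [])"
        using exit_mean_bounds[OF lam0 M]
        by (intro integrable_ppm[of _ 1]) (auto simp: abs_le_iff intro: order_trans[of _ 0])
    qed
    finally show ?thesis .
  qed
  have "(\<integral>\<omega>. fail a' (C + k) j \<omega> \<partial>E) \<le> \<epsilon>" for j
  proof (rule LIMSEQ_le_const)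
    have "(\<lambda>T. \<epsilon> + \<rho> ^ T / \<sigma> ^ k) \<longlonglongrightarrow> \<epsilon> + 0 / \<sigma> ^ k"
      using rho_pos rho_less ratio_pos by (intro tendsto_intros LIMSEQ_power_zero) auto
    then show "(\<lambda>T. \<epsilon> + \<rho> ^ T / \<sigma> ^ k) \<longlonglongrightarrow> \<epsilon>" by simp
  qed (use main in blast)
  then show thesis by (rule that)
qed

text \<open>Markov's inequality treats one horizon at a time. As \<open>fail\<close> increases with
  the horizon, the bad events up to horizon \<open>j\<close> are contained in a single one at
  \<open>j\<close>, so their increasing union over all \<open>j\<close> obeys the same
  bound.\<close>

lemma AE_fail_small:
  fixes a a' x :: real
  assumes a: "0 < a" "a < a'" and x: "0 < x" "AE \<omega> in E. eventually (\<lambda>n. x ^ n \<le> quenched.stay lam \<omega> (nat \<lceil>a * n\<rceil>) n []) sequentially"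
    and xm: "1 < x * m" and m1: "1 < m"
  shows "AE \<omega> in E. \<forall>i. \<exists>C::nat. \<forall>j. fail a' C j \<omega> \<le> 1 / Suc i"
  unfolding AE_all_countable
proof
  fix i
  define \<delta> where "\<delta> = 1 / real (Suc i)"
  have \<delta>: "0 < \<delta>" by (simp add: \<delta>_def)
  let ?Bad = "{\<omega>. \<forall>C::nat. \<exists>j. \<delta> < fail a' C j \<omega>}"
  have ev: "Measurable.pred coords P \<Longrightarrow> {\<omega>. P \<omega>} \<in> E.events" for P
    using measurable_sets[of P coords "count_space UNIV" "{True}"] by (simp add: vimage_def space_PiM)
  have Bs: "?Bad \<in> E.events" by (rule ev) measurable
  have "measure E ?Bad \<le> \<epsilon>" if \<epsilon>: "0 < \<epsilon>" for \<epsilon>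
  proof -
    obtain C where C: "\<And>j. (\<integral>\<omega>. fail a' C j \<omega> \<partial>E) \<le> \<epsilon> * \<delta>"
      by (rule mean_fail_small[OF a x xm m1, of "\<epsilon> * \<delta>"]) (use \<epsilon> \<delta> in auto)
    let ?n = "nat \<lceil>C\<rceil>"
    define A where "A j = {\<omega>. \<exists>i\<le>j. \<delta> < fail a' ?n i \<omega>}" for j :: nat
    have As: "A j \<in> E.events" for j unfolding A_def by (rule ev) measurable
    have Ab: "measure E (A j) \<le> \<epsilon>" for j
    proof -
      have "measure E (A j) \<le> measure E {\<omega>. \<delta> \<le> fail a' C j \<omega>}"
      proof (rule E.finite_measure_mono_AE)
        show "AE \<omega> in E. \<omega> \<in> A j \<longrightarrow> \<omega> \<in> {\<omega>. \<delta> \<le> fail a' C j \<omega>}"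
          using AE_biased
        proof eventually_elim
          case (elim \<omega>)
          then interpret biased lam \<omega> d .
          have "fail a' ?n i \<omega> \<le> fail a' C j \<omega>" if "i \<le> j" for i
          proof -
            have "sv \<mu> (step_op True lam \<omega>) j (slow a' C) [] \<le> sv \<mu> (step_op True lam \<omega>) j (slow a' ?n) []"
              by (intro sv_slow_mono) (auto simp: lam0 deg_pos real_nat_ceiling_ge)
            also have "\<dots> \<le> sv \<mu> (step_op True lam \<omega>) i (slow a' ?n) []"
              using that by (intro sv_antimono) (auto simp: lam0 deg_pos)
            finally show ?thesis by (simp add: fail_def)
          qed
          then show ?case unfolding A_def by (auto intro: less_imp_le less_le_trans)
        qed
        show "{\<omega>. \<delta> \<le> fail a' C j \<omega>} \<in> E.events" by (rule ev) measurable
      qed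
      also have "\<dots> \<le> (\<integral>\<omega>. fail a' C j \<omega> \<partial>E) / \<delta>"
      proof -
        have "AE \<omega> in E. 0 \<le> fail a' C j \<omega>" using AE_biased by eventually_elim (use fail_bounds in auto)
        from integral_Markov_inequality_measure[OF integrable_fail _ this \<delta>, of UNIV] show ?thesis
          using sets.top[of E] by simp
      qed
      also have "\<dots> \<le> \<epsilon>" using C[of j] \<delta> by (simp add: divide_le_eq)
      finally show ?thesis .
    qed
    have "incseq A" unfolding A_def by (auto simp: incseq_def intro: order_trans)
    then have "(\<lambda>j. measure E (A j)) \<longlonglongrightarrow> measure E (\<Union>j. A j)"
      using As by (intro E.finite_Lim_measure_incseq) auto
    then have "measure E (\<Union>j. A j) \<le> \<epsilon>" by (rule LIMSEQ_le_const2) (use Ab in auto)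
    moreover have "measure E ?Bad \<le> measure E (\<Union>j. A j)"
    proof (rule E.finite_measure_mono)
      show "?Bad \<subseteq> (\<Union>j. A j)"
      proof
        fix \<omega> assume "\<omega> \<in> ?Bad"
        then obtain j where "\<delta> < fail a' ?n j \<omega>" by blast
        then show "\<omega> \<in> (\<Union>j. A j)" unfolding A_def by blast
      qed
    qed (use As in auto)
    ultimately show ?thesis by simp
  qed
  then have "measure E ?Bad \<le> 0" by (rule field_le_epsilon[of _ 0, simplified])
  then have "measure E ?Bad = 0" by (simp add: measure_le_0_iff)
  then have "AE \<omega> in E. \<omega> \<notin> ?Bad"
    using Bs by (intro AE_not_in null_setsI) (auto simp: E.emeasure_eq_measure)
  then show "AE \<omega> in E. \<exists>C::nat. \<forall>j. fail a' C j \<omega> \<le> 1 / Suc i"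
    by eventually_elim (auto simp: \<delta>_def not_less)
qed

end

section \<open>Almost sure statements in a fixed environment\<close>

lemma surv_Suc_imp: "surv (Suc j) Q N J x \<Longrightarrow> surv j Q N J x"
proof (induction j arbitrary: Q N J x)
  case (Suc j)
  then obtain i where "Q 0 x" and "i < N []" and "surv (Suc j) (\<lambda>k. Q (Suc k)) (\<lambda>u. N (i # u)) (\<lambda>z. J (i # fst z, snd z)) (J ([i], x))"
    unfolding surv.simps(2)[of "Suc j"] by blast
  moreover from this(3) have "surv j (\<lambda>k. Q (Suc k)) (\<lambda>u. N (i # u)) (\<lambda>z. J (i # fst z, snd z)) (J ([i], x))"
    by (rule Suc.IH)
  ultimately show ?case by (subst surv.simps(2)) (intro conjI exI[of _ i])
qed simp

context quenched begin

text \<open>A fixed \<open>C\<close> is only known to work with probability close to one, uniformly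
  in the horizon; continuity from above passes to all horizons at once, and letting \<open>C\<close>
  depend on the realisation gives probability one.\<close>

lemma AE_slow_line:
  assumes "\<And>i. \<exists>C::nat. \<forall>j. 1 - sv \<mu> (step_op True lam \<omega>) j (slow a C) [] \<le> 1 / Suc i"
  shows "AE NJ in brw_space \<mu> lam \<omega>. \<exists>C::nat. \<forall>j. surv j (slow a C) (fst NJ) (snd NJ) []"
proof -
  interpret B: prob_space "brw_space \<mu> lam \<omega>" by (rule prob_space_brw)
  define S where "S C j = {NJ. surv j (slow a (real C)) (fst NJ) (snd NJ) []}" for C j :: nat
  have Ss: "S C j \<in> B.events" for C j unfolding S_def by (rule surv_sets)
  have Ps: "measure (brw_space \<mu> lam \<omega>) (S C j) = sv \<mu> (step_op True lam \<omega>) j (slow a C) []" for C j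
    unfolding S_def by (rule prob_surv)
  let ?G = "\<Union>C. \<Inter>j. S C j"
  have Gs: "?G \<in> B.events" using Ss by auto
  have ge: "1 - 1 / Suc i \<le> B.prob ?G" for i
  proof -
    obtain C :: nat where C: "\<And>j. 1 - sv \<mu> (step_op True lam \<omega>) j (slow a C) [] \<le> 1 / Suc i" using assms by blast
    have "decseq (S C)" unfolding decseq_Suc_iff S_def using surv_Suc_imp by blast
    then have "(\<lambda>j. B.prob (S C j)) \<longlonglongrightarrow> B.prob (\<Inter>j. S C j)"
      using Ss by (intro B.finite_Lim_measure_decseq) auto
    then have "1 - 1 / Suc i \<le> B.prob (\<Inter>j. S C j)"
    proof (rule LIMSEQ_le_const)
      have "1 - 1 / Suc i \<le> B.prob (S C j)" for j using C[of j] by (simp add: Ps)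
      then show "\<exists>n0. \<forall>n\<ge>n0. 1 - 1 / Suc i \<le> B.prob (S C n)" by blast
    qed
    also have "\<dots> \<le> B.prob ?G" using Ss Gs by (intro B.finite_measure_mono) auto
    finally show ?thesis .
  qed
  have "(\<lambda>i. 1 - 1 / real (Suc i)) \<longlonglongrightarrow> 1 - 0" by (intro tendsto_intros LIMSEQ_Suc[OF lim_1_over_n])
  then have "1 \<le> B.prob ?G" by (intro LIMSEQ_le_const2[of "\<lambda>i. 1 - 1 / real (Suc i)" 1]) (use ge in auto)
  then have "B.prob ?G = 1" using B.prob_le_1[of ?G] by linarith
  then have "AE NJ in brw_space \<mu> lam \<omega>. NJ \<in> ?G" using Gs by (simp add: B.prob_eq_1)
  then show ?thesis by eventually_elim (auto simp: S_def)
qed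

lemma AE_offspring_pos:
  assumes "pmf \<mu> 0 = 0"
  shows "AE NJ in brw_space \<mu> lam \<omega>. \<forall>u. 0 < fst NJ u"
proof -
  interpret A: prob_space "ppm (\<lambda>_::nat list. \<mu>)" by (rule prob_space_ppm)
  interpret B: prob_space steps by (rule prob_space_ppm)
  interpret C: pair_prob_space "ppm (\<lambda>_::nat list. \<mu>)" steps by unfold_locales
  have "AE N in ppm (\<lambda>_::nat list. \<mu>). \<forall>u. 0 < N u"
    unfolding AE_all_countable
  proof (intro allI AE_coord)
    fix k assume "k \<in> set_pmf \<mu>"
    then show "0 < k" using assms by (metis gr0I set_pmf_iff)
  qed
  then show ?thesis unfolding brw_space_eq
  proof (intro C.AE_pair_measure)
    have "(\<lambda>z. fst z u) \<in> measurable (ppm (\<lambda>_::nat list. \<mu>) \<Otimes>\<^sub>M steps) (count_space UNIV)" for u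
      by (rule measurable_compose[OF measurable_fst]) measurable
    then show "{z \<in> space (ppm (\<lambda>_::nat list. \<mu>) \<Otimes>\<^sub>M steps). \<forall>u. 0 < fst z u} \<in> sets (ppm (\<lambda>_::nat list. \<mu>) \<Otimes>\<^sub>M steps)"
      by measurable
  qed auto
qed

lemma AE_min_disp_ge:
  assumes mu0: "pmf \<mu> 0 = 0" and mean: "summable (\<lambda>k. real k * pmf \<mu> k)" "m = (\<Sum>k. real k * pmf \<mu> k)" and m: "1 < m"
    and rate: "(\<lambda>n. ln (qprob lam \<omega> n 0 a) / real n) \<longlonglongrightarrow> - r" and r: "ln m < r"
  shows "AE NJ in brw_space \<mu> lam \<omega>. eventually (\<lambda>n. a \<le> real (min_disp (fst NJ) (snd NJ) n) / real n) sequentially"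
proof -
  interpret B: prob_space "brw_space \<mu> lam \<omega>" by (rule prob_space_brw)
  define A where "A n = {NJ. surv n (\<lambda>i y. i < n \<or> length y < nat \<lceil>a * n\<rceil>) (fst NJ) (snd NJ) []}" for n :: nat
  have As: "A n \<in> B.events" for n unfolding A_def by (rule surv_sets)
  \<comment> \<open>Strictly between \<open>ln m\<close> and \<open>r\<close>: the first moments are
    then eventually at most \<open>(m * exp (- c)) ^ n\<close>, which is summable, and the
    Borel-Cantelli lemma applies.\<close>
  define c where "c = (r + ln m) / 2"
  have c: "ln m < c" "c < r" using r by (auto simp: c_def)
  have "eventually (\<lambda>n. ln (qprob lam \<omega> n 0 a) / real n < - c) sequentially"
    using rate c by (intro order_tendstoD(2)) auto
  then have "eventually (\<lambda>n. B.prob (A n) \<le> (m * exp (- c)) ^ n) sequentially"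
    using eventually_gt_at_top[of 0]
  proof eventually_elim
    case (elim n)
    let ?q = "qprob lam \<omega> n 0 a"
    have "?q \<le> exp (- c) ^ n"
    proof (cases "0 < ?q")
      case True
      have "ln ?q < - c * n" using elim by (simp add: divide_less_eq)
      then have "exp (ln ?q) \<le> exp (- c * n)" by (subst exp_le_cancel_iff) simp
      then show ?thesis using True by (simp add: exp_of_nat_mult[symmetric] mult.commute)
    next
      case False
      then show ?thesis by (meson exp_ge_zero not_less order_trans zero_le_power)
    qed
    then have "m ^ n * ?q \<le> m ^ n * exp (- c) ^ n" using m by (intro mult_left_mono) auto
    moreover have "B.prob (A n) \<le> m ^ n * ?q"
      unfolding A_def prob_surv qprob_eq_stay[OF elim(2)] mean(2) by (rule sv_last_le[OF mean(1)])
    ultimately show ?case by (simp add: power_mult_distrib)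
  qed
  moreover have "summable (\<lambda>n. (m * exp (- c)) ^ n)"
  proof (rule summable_geometric)
    have "m < exp c" using c m by (metis exp_less_cancel_iff exp_ln less_trans zero_less_one)
    then show "norm (m * exp (- c)) < 1" using m by (simp add: exp_minus field_simps)
  qed
  ultimately have "summable (\<lambda>n. B.prob (A n))"
    by (intro summable_comparison_test_ev[of "\<lambda>n. B.prob (A n)"]) (auto elim: eventually_mono)
  then have "AE NJ in brw_space \<mu> lam \<omega>. eventually (\<lambda>n. NJ \<in> space (brw_space \<mu> lam \<omega>) - A n) sequentially"
    using As by (intro borel_cantelli_AE1) (auto simp: B.emeasure_eq_measure)
  then show ?thesis using AE_offspring_pos[OF mu0]
  proof eventually_elim
    case (elim NJ)
    show ?case using elim(1) eventually_gt_at_top[of 0]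
    proof eventually_elim
      case (elim n)
      then have "\<not> min_disp (fst NJ) (snd NJ) n < nat \<lceil>a * n\<rceil>"
        using surv_of_min_disp_less[of "fst NJ" "snd NJ" n] \<open>\<forall>u. 0 < fst NJ u\<close> by (auto simp: A_def)
      then have "a * n \<le> real (min_disp (fst NJ) (snd NJ) n)" by (simp add: less_nat_ceiling_iff)
      then show ?case using elim by (simp add: le_divide_eq)
    qed
  qed
qed

lemma eventually_stay_ge:
  assumes rate: "(\<lambda>n. ln (qprob lam \<omega> n 0 a) / real n) \<longlonglongrightarrow> - r" and c: "r < c" and a: "0 < a"
  shows "eventually (\<lambda>n. exp (- c) ^ n \<le> stay (nat \<lceil>a * n\<rceil>) n []) sequentially"
proof -
  have "eventually (\<lambda>n. - c < ln (qprob lam \<omega> n 0 a) / real n) sequentially"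
    using rate c by (intro order_tendstoD(1)) auto
  moreover have "eventually (\<lambda>n. nat \<lceil>1 / a\<rceil> < n) sequentially" by (rule eventually_gt_at_top)
  ultimately show ?thesis
  proof eventually_elim
    case (elim n)
    have "1 / a < n" using elim by linarith
    then have "1 < a * n" using a by (simp add: divide_less_eq mult.commute)
    then have l: "2 \<le> nat \<lceil>a * n\<rceil>" by linarith
    have n: "0 < n" using elim by simp
    let ?s = "stay (nat \<lceil>a * n\<rceil>) n []"
    have s: "0 < ?s" using stay_pos[OF l, of "[]" n] by simp
    have "- c < ln ?s / n" using elim(1) by (simp add: qprob_eq_stay[OF n])
    then have "- c * n < ln ?s" using n by (simp add: less_divide_eq)
    then have "exp (- c * n) < exp (ln ?s)" by (subst exp_less_cancel_iff)
    then show ?case using s by (simp add: exp_of_nat_mult[symmetric] mult.commute)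
  qed
qed

end

section \<open>The level set of the rate function and the limit\<close>

lemma bgw_eq: "bgw p = ppm (\<lambda>_. p)"
  by (simp add: bgw_def ppm_def)

theorem theorem1p3:
  fixes p \<mu> :: "nat pmf" and lam m v :: real and I :: "real \<Rightarrow> real" and dmin :: nat
  assumes p0: "pmf p 0 = 0" and p1: "pmf p 1 < 1"
    and p_mean: "summable (\<lambda>k. real k * pmf p k)"
    and dmin_def: "dmin = (LEAST k. pmf p k > 0)"
    and dmin2: "dmin \<ge> 2"
    and lam_pos: "lam > 0"
    and mu0: "pmf \<mu> 0 = 0" and mu1: "pmf \<mu> 1 < 1"
    and mu_mean: "summable (\<lambda>k. real k * pmf \<mu> k)"
    and m_def: "m = (\<Sum>k. real k * pmf \<mu> k)"
    and m_gt1: "m > 1"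
    and lam_lt: "lam < real dmin"
    and m_le: "m \<le> (real dmin + lam) / (2 * sqrt (lam * real dmin))"
    and speed: "is_speed p lam v"
    and rate: "is_slowdown_rate p lam v I"
  shows "0 \<le> Inf {a \<in> {0..v}. I a \<le> ln m} \<and> Inf {a \<in> {0..v}. I a \<le> ln m} < v \<and>
         (AE \<omega> in bgw p. AE NJ in brw_space \<mu> lam \<omega>.
            (\<lambda>n. real (min_disp (fst NJ) (snd NJ) n) / real n)
              \<longlonglongrightarrow> Inf {a \<in> {0..v}. I a \<le> ln m})"
proof -
  have ex: "\<exists>k. pmf p k > 0"
    using set_pmf_not_empty[of p] by (metis all_not_in_conv pmf_positive)
  interpret branching_environment p dmin lam \<mu> m
  proof
    show "set_pmf p \<subseteq> {dmin..}" unfolding dmin_def by (auto intro!: Least_le pmf_positive)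
    show "0 < pmf p dmin" unfolding dmin_def using ex by (rule LeastI_ex)
  qed (use assms in auto)
  \<comment> \<open>Positivity of the speed comes from the supersolution; it keeps the interval
    \<open>{0..v}\<close> from degenerating and is the basis of \<open>t < v\<close>.\<close>
  have "AE \<omega> in E. AE J in walk_space lam \<omega>. (\<lambda>n. real (length (walk J n)) / real n) \<longlonglongrightarrow> v"
    using speed unfolding is_speed_def bgw_eq .
  with AE_biased have "AE \<omega> in E. 0 < v"
  proof eventually_elim
    case (elim \<omega>)
    then interpret biased lam \<omega> dmin by simp
    show ?case using elim(2) by (rule speed_pos)
  qed
  then have v: "0 < v" by (simp add: E.AE_const)
  have cont: "continuous_on {0..v} I" and conv: "convex_on {0..v} I" and anti: "antimono_on {0..v} I" and Iv: "I v = 0"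
    and ld: "\<And>a. 0 < a \<Longrightarrow> a < v \<Longrightarrow> AE \<omega> in E. (\<lambda>n. ln (qprob lam \<omega> n 0 a) / real n) \<longlonglongrightarrow> - I a"
    using rate unfolding is_slowdown_rate_def bgw_eq by auto
  have lnm: "0 < ln m" using m_gt1 by simp
  let ?S = "{a \<in> {0..v}. I a \<le> ln m}"
  define t where "t = Inf ?S"
  have bdd: "bdd_below ?S" by (rule bdd_belowI[of _ 0]) auto
  have vS: "v \<in> ?S" using v Iv lnm by auto
  have t0: "0 \<le> t" unfolding t_def using vS by (intro cInf_greatest) auto
  \<comment> \<open>Continuity at \<open>v\<close>, where \<open>I v = 0 < ln m\<close>, puts points
    to the left of \<open>v\<close> into \<open>?S\<close>.\<close>
  have tv: "t < v"
  proof -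
    have "(I \<longlongrightarrow> I v) (at v within {0..v})" using cont v by (auto simp: continuous_on_def)
    then have "eventually (\<lambda>a. I a < ln m) (at v within {0..v})" using lnm Iv by (intro order_tendstoD(2)) auto
    then obtain \<delta> where \<delta>: "0 < \<delta>" "\<And>a. a \<in> {0..v} \<Longrightarrow> a \<noteq> v \<Longrightarrow> dist a v < \<delta> \<Longrightarrow> I a < ln m"
      by (auto simp: eventually_at)
    define a where "a = max 0 (v - \<delta> / 2)"
    have a: "a \<in> {0..v}" "a < v" "dist a v < \<delta>" using \<delta> v by (auto simp: a_def dist_real_def)
    then have "a \<in> ?S" using \<delta>(2)[of a] by auto
    then have "t \<le> a" unfolding t_def using bdd by (rule cInf_lower)
    then show ?thesis using a by simp
  qed
  have above: "ln m < I a" if "0 \<le> a" "a < t" for a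
  proof (rule ccontr)
    assume "\<not> ln m < I a"
    then have "a \<in> ?S" using that tv by auto
    then have "t \<le> a" unfolding t_def using bdd by (rule cInf_lower)
    then show False using that by simp
  qed
  \<comment> \<open>Convexity between a point \<open>b\<close> of the level set and \<open>v\<close>
    makes the inequality strict, since \<open>I v = 0\<close> pulls the value below
    \<open>ln m\<close>.\<close>
  have below: "I a < ln m" if "t < a" "a < v" for a
  proof -
    have "\<exists>b\<in>?S. b < a" by (rule cInf_lessD) (use vS that(1) t_def in auto)
    then obtain b where b: "b \<in> ?S" "b < a" by (elim bexE)
    define s where "s = (a - b) / (v - b)"
    have "s * (v - b) = a - b" using b that by (simp add: s_def)
    then have "a = (1 - s) * b + s * v" by (simp add: algebra_simps)
    moreover have "0 < s" "s \<le> 1" using b that by (auto simp: s_def)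
    ultimately have s: "0 < s" "s \<le> 1" "a = (1 - s) * b + s * v" by auto
    have "I a \<le> (1 - s) * I b + s * I v"
      using convex_onD[OF conv, of s b v] s b v by auto
    also have "\<dots> \<le> (1 - s) * ln m" using b s Iv by (auto intro: mult_left_mono)
    also have "\<dots> < ln m" using s lnm by (simp add: algebra_simps)
    finally show ?thesis .
  qed
  have lower: "AE \<omega> in E. \<forall>i. AE NJ in brw_space \<mu> lam \<omega>.
      eventually (\<lambda>n. t - 1 / Suc i \<le> real (min_disp (fst NJ) (snd NJ) n) / real n) sequentially"
    unfolding AE_all_countable
  proof
    fix i
    define a where "a = t - 1 / real (Suc i)"
    show "AE \<omega> in E. AE NJ in brw_space \<mu> lam \<omega>. eventually (\<lambda>n. t - 1 / Suc i \<le> real (min_disp (fst NJ) (snd NJ) n) / real n) sequentially"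
    proof (cases "0 < a")
      case True
      have at: "a < t" by (simp add: a_def)
      show ?thesis
        using ld[OF True less_trans[OF at tv]] AE_biased
      proof eventually_elim
        case (elim \<omega>)
        then interpret biased lam \<omega> dmin by simp
        show ?case using AE_min_disp_ge[OF mu0 mu_mean m_def m_gt1 elim(1) above] True at by (simp add: a_def)
      qed
    next
      case False
      then have "t - 1 / Suc i \<le> real k / real n" for k n :: nat
        by (simp add: a_def order_trans[of _ 0])
      then show ?thesis by simp
    qed
  qed
  have upper: "AE \<omega> in E. \<forall>i. \<forall>l. \<exists>C::nat. \<forall>j. fail (t + 1 / Suc i) C j \<omega> \<le> 1 / Suc l"
    unfolding AE_all_countable[where P = "\<lambda>i \<omega>. \<forall>l. \<exists>C::nat. \<forall>j. fail (t + 1 / Suc i) C j \<omega> \<le> 1 / Suc l"]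
  proof
    fix i
    \<comment> \<open>A slope strictly between \<open>t\<close> and \<open>t + 1 / Suc i\<close>
      that also stays below \<open>v\<close>, where the large deviation limit is given.\<close>
    define a where "a = min ((t + v) / 2) (t + 1 / (2 * real (Suc i)))"
    have "t < a" "a < v" "a < t + 1 / Suc i" using tv by (auto simp: a_def min_less_iff_disj field_simps)
    moreover from this(1) have "0 < a" using t0 by simp
    ultimately have a: "t < a" "a < v" "a < t + 1 / Suc i" "0 < a" by auto
    define c where "c = (I a + ln m) / 2"
    have c: "I a < c" "c < ln m" using below[OF a(1,2)] by (auto simp: c_def)
    show "AE \<omega> in E. \<forall>l. \<exists>C::nat. \<forall>j. fail (t + 1 / Suc i) C j \<omega> \<le> 1 / Suc l"
    proof (rule AE_fail_small[OF a(4,3)])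
      show "0 < exp (- c)" by simp
      show "AE \<omega> in E. eventually (\<lambda>n. exp (- c) ^ n \<le> quenched.stay lam \<omega> (nat \<lceil>a * n\<rceil>) n []) sequentially"
        using ld[OF a(4,2)] AE_biased
      proof eventually_elim
        case (elim \<omega>)
        then interpret biased lam \<omega> dmin by simp
        show ?case by (rule eventually_stay_ge[OF elim(1) c(1) a(4)])
      qed
      have "exp c < m" using c m_gt1 by (metis exp_less_cancel_iff exp_ln less_trans zero_less_one)
      then show "1 < exp (- c) * m" by (simp add: exp_minus field_simps)
    qed (rule m_gt1)
  qed
  have "AE \<omega> in E. AE NJ in brw_space \<mu> lam \<omega>. (\<lambda>n. real (min_disp (fst NJ) (snd NJ) n) / real n) \<longlonglongrightarrow> t"
    using lower upper AE_biased
  proof eventually_elim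
    case (elim \<omega>)
    then interpret biased lam \<omega> dmin by simp
    have "AE NJ in brw_space \<mu> lam \<omega>. \<forall>i. eventually (\<lambda>n. t - 1 / Suc i \<le> real (min_disp (fst NJ) (snd NJ) n) / real n) sequentially"
      using elim(1) by (simp add: AE_all_countable)
    moreover have "AE NJ in brw_space \<mu> lam \<omega>. \<forall>i. \<exists>C::nat. \<forall>j. surv j (slow (t + 1 / Suc i) C) (fst NJ) (snd NJ) []"
      unfolding AE_all_countable using elim(2) by (intro allI AE_slow_line) (auto simp: fail_def)
    ultimately show ?case
    proof eventually_elim
      case (elim NJ)
      let ?D = "\<lambda>n. real (min_disp (fst NJ) (snd NJ) n)"
      show ?case
      proof (rule LIMSEQ_I)
        fix e :: real assume e: "0 < e"
        then obtain i where i: "1 / real (Suc i) < e / 2" using nat_approx_posE[of "e / 2"] by auto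
        obtain C :: nat where C: "\<And>j. surv j (slow (t + 1 / Suc i) C) (fst NJ) (snd NJ) []" using elim(2) by blast
        have "?D n \<le> C + (t + 1 / Suc i) * n" for n
          using min_disp_le[of n C "t + 1 / Suc i"] C[of n] by (simp add: slow_def[abs_def])
        moreover obtain n0 where n0: "\<And>n. n0 \<le> n \<Longrightarrow> t - 1 / Suc i \<le> ?D n / n"
          using elim(1) unfolding eventually_sequentially by blast
        define n1 where "n1 = Suc (max n0 (nat \<lceil>2 * C / e\<rceil>))"
        have "norm (?D n / n - t) < e" if "n1 \<le> n" for n
        proof -
          have n: "0 < n" "n0 \<le> n" "2 * C / e < n" using that unfolding n1_def by linarith+
          have "C < e / 2 * n" using n e by (simp add: divide_less_eq mult.commute)
          have "?D n / n \<le> (C + (t + 1 / Suc i) * n) / n"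
            using \<open>\<And>n. ?D n \<le> C + (t + 1 / Suc i) * n\<close>[of n] n by (intro divide_right_mono) auto
          also have "\<dots> = C / n + (t + 1 / Suc i)" using n by (simp add: add_divide_distrib)
          also have "C / n < e / 2" using \<open>C < e / 2 * n\<close> n by (simp add: divide_less_eq)
          finally have "?D n / n < t + e" using i by linarith
          moreover have "t - e < ?D n / n" using n0[OF n(2)] i e by linarith
          ultimately show ?thesis by (simp add: abs_less_iff)
        qed
        then show "\<exists>n0. \<forall>n\<ge>n0. norm (?D n / n - t) < e" by blast
      qed
    qed
  qed
  then show ?thesis using t0 tv unfolding t_def bgw_eq by simp
qed

end
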